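(* Let $S$ and $\Omega$ be Polish spaces, let $\mathbf r$ be a nonzero finite measure on $\Omega$, and let $\gamma:\Omega\times S^{\mathbb N_+}\to S$ and $\kappa:\Omega\to\mathbb N$ be measurable functions such that $\gamma[\omega](x_1,x_2,\ldots)=\gamma[\omega](x_1,\ldots,x_{\kappa(\omega)})$ depends only on the first $\kappa(\omega)$ coordinates and $\int_\Omega\mathbf r(\mathrm d\omega)\kappa(\omega)<\infty$. Let $(\boldsymbol\omega_{\mathbf i})_{\mathbf i}$ be i.i.d. with common law $|\mathbf r|^{-1}\mathbf r$ and let $(\sigma_{\mathbf i})_{\mathbf i}$ be an independent i.i.d. collection of exponentially distributed random variables with mean $|\mathbf r|^{-1}$. Fix $t\ge0$ and let $\nabla\mathbb S_t$, $G_t$ and $\mathcal F_t$ be the random set, random map and $\sigma$-field defined in the context. Let $\mu\in\mathcal P(S)$ and, conditional on $\mathcal F_t$, let $(X_{\mathbf i})_{\mathbf i\in\nabla\mathbb S_t}$ be i.i.d. $S$-valued random variables with common law $\mu$. Then $$T_t(\mu)=\text{ the law of }G_t\big((X_{\mathbf i})_{\mathbf i\in\nabla\mathbb S_t}\big).$$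
   Context: $\mathbb N=\{0,1,2,\dots\}$. $T(\mu)$ is the law of $\gamma[\boldsymbol\omega](X_1,X_2,\ldots)$ with $\boldsymbol\omega$ of law $|\mathbf r|^{-1}\mathbf r$ and $(X_i)$ i.i.d. of law $\mu$, independent of $\boldsymbol\omega$. $T_t(\mu):=\mu_t$, where $(\mu_t)_{t\ge0}$ is the unique solution with $\mu_0=\mu$ of $\frac{\partial}{\partial t}\mu_t=|\mathbf r|\{T(\mu_t)-\mu_t\}$ (meaning: for each bounded measurable $\phi:S\to\mathbb R$, $t\mapsto\int\phi\,\mathrm d\mu_t$ is continuously differentiable with derivative $|\mathbf r|\{\int\phi\,\mathrm dT(\mu_t)-\int\phi\,\mathrm d\mu_t\}$). Trees: fix $d\in\mathbb N_+\cup\{\infty\}$ with $\kappa\le d$, and let $\mathbb T$ be the set of all finite words $\mathbf i=i_1\cdots i_n$ ($n\ge0$) over the alphabet $\{1,\ldots,d\}$ ($\mathbb N_+$ if $d=\infty$), with root the empty word $\varnothing$; the parent of $i_1\cdots i_n$ ($n\ge1$) is $i_1\cdots i_{n-1}$. The families $\boldsymbol\omega_{\mathbf i},\sigma_{\mathbf i}$ are indexed by $\mathbf i\in\mathbb T$. Put $\tau^*_{\mathbf i}:=\sum_{m=0}^{n-1}\sigma_{i_1\cdots i_m}$ and $\tau^\dagger_{\mathbf i}:=\tau^*_{\mathbf i}+\sigma_{\mathbf i}$ for $\mathbf i=i_1\cdots i_n$ (the $m=0$ term is $\sigma_\varnothing$; $\tau^*_\varnothing=0$). Let $\mathbb S:=\{i_1\cdots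 i_n\in\mathbb T: i_m\le\kappa(\boldsymbol\omega_{i_1\cdots i_{m-1}})\ \forall 1\le m\le n\}$, $\mathbb S_t:=\{\mathbf i\in\mathbb S:\tau^\dagger_{\mathbf i}\le t\}$ and $\nabla\mathbb S_t:=\{\mathbf i\in\mathbb S:\tau^*_{\mathbf i}\le t<\tau^\dagger_{\mathbf i}\}$; these are a.s. finite. For a finite subtree $\mathbb U\subset\mathbb S$ that is empty or contains $\varnothing$, $\nabla\mathbb U$ is the set of $\mathbf i\in\mathbb S\setminus\mathbb U$ whose parent is in $\mathbb U$, with $\nabla\emptyset:=\{\varnothing\}$; for $(x_{\mathbf i})_{\mathbf i\in\nabla\mathbb U}\in S^{\nabla\mathbb U}$ define inductively $x_{\mathbf i}:=\gamma[\boldsymbol\omega_{\mathbf i}](x_{\mathbf i1},\ldots,x_{\mathbf i\kappa(\boldsymbol\omega_{\mathbf i})})$ for $\mathbf i\in\mathbb U$, and set $G_{\mathbb U}((x_{\mathbf i})_{\mathbf i\in\nabla\mathbb U}):=x_\varnothing$. Then $G_t:=G_{\mathbb S_t}:S^{\nabla\mathbb S_t}\to S$ and $\mathcal F_t:=\sigma(\nabla\mathbb S_t,(\boldsymbol\omega_{\mathbf i},\sigma_{\mathbf i})_{\mathbf i\in\mathbb S_t})$. *)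

theory Defs
  imports "HOL-Probability.Probability" "HOL-Library.Sublist"
begin

section \<open>The mean-field equation\<close>

abbreviation mass :: "'a measure \<Rightarrow> real" where
  "mass r \<equiv> measure r (space r)"

definition normalized :: "'a measure \<Rightarrow> 'a measure" where
  "normalized r = scale_measure (inverse (emeasure r (space r))) r"

text \<open>The map \<open>T\<close>: the law of \<open>\<gamma> w (X\<^sub>1, X\<^sub>2, \<dots>)\<close>, realised on the canonical product space.
  Sequences are indexed by \<open>{1..}\<close>, i.e. they are elements of \<open>space (\<Pi>\<^sub>M k\<in>{1..}. borel)\<close>.\<close>

definition T_map ::
  "'w measure \<Rightarrow> ('w \<Rightarrow> (nat \<Rightarrow> 'a::topological_space) \<Rightarrow> 'a) \<Rightarrow> 'a measure \<Rightarrow> 'a measure" where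
  "T_map r \<gamma> \<mu> =
     distr (normalized r \<Otimes>\<^sub>M (\<Pi>\<^sub>M k\<in>{1..}. \<mu>)) borel (\<lambda>(w, x). \<gamma> w x)"

text \<open>Only the values \<open>m t\<close> for \<open>t \<ge> 0\<close> matter; at \<open>t = 0\<close> the derivative is one-sided.\<close>

definition solves_mean_field ::
  "'w measure \<Rightarrow> ('w \<Rightarrow> (nat \<Rightarrow> 'a::topological_space) \<Rightarrow> 'a) \<Rightarrow> 'a measure
     \<Rightarrow> (real \<Rightarrow> 'a measure) \<Rightarrow> bool" where
  "solves_mean_field r \<gamma> \<mu> m \<longleftrightarrow>
     m 0 = \<mu> \<and>
     (\<forall>t\<ge>0. prob_space (m t) \<and> sets (m t) = sets borel) \<and>
     (\<forall>\<phi>::'a \<Rightarrow> real. \<phi> \<in> borel_measurable borel \<and> bounded (range \<phi>) \<longrightarrow>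
        (let D = (\<lambda>t. mass r * ((\<integral>x. \<phi> x \<partial>T_map r \<gamma> (m t)) - (\<integral>x. \<phi> x \<partial>m t)))
         in (\<forall>t\<ge>0. ((\<lambda>s. \<integral>x. \<phi> x \<partial>m s) has_real_derivative D t) (at t within {0..})) \<and>
            continuous_on {0..} D))"

text \<open>The value at time \<open>t\<close> of the unique solution. The description ranges over values at \<open>t\<close>
  because solutions, as functions on all of \<open>real\<close>, are arbitrary at negative times.\<close>

definition T_flow ::
  "'w measure \<Rightarrow> ('w \<Rightarrow> (nat \<Rightarrow> 'a::topological_space) \<Rightarrow> 'a) \<Rightarrow> real \<Rightarrow> 'a measure
     \<Rightarrow> 'a measure" where
  "T_flow r \<gamma> t \<mu> = (THE \<nu>. \<exists>m. solves_mean_field r \<gamma> \<mu> m \<and> \<nu> = m t)"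


section \<open>Trees\<close>

text \<open>The word \<open>i\<^sub>1\<cdots>i\<^sub>n\<close> is the list \<open>[i\<^sub>1, \<dots>, i\<^sub>n]\<close>, so its prefix \<open>i\<^sub>1\<cdots>i\<^sub>m\<close> is \<open>take m i\<close> and the
  letter \<open>i\<^sub>m\<^sub>+\<^sub>1\<close> is \<open>i ! m\<close>. Below, \<open>w\<close> and \<open>s\<close> are one realisation of the two families attached to
  the nodes.\<close>

definition words :: "enat \<Rightarrow> nat list set" where
  "words d = {i. \<forall>k\<in>set i. 1 \<le> k \<and> enat k \<le> d}"

definition birth_time :: "(nat list \<Rightarrow> real) \<Rightarrow> nat list \<Rightarrow> real" where
  "birth_time s i = (\<Sum>m<length i. s (take m i))"

definition death_time :: "(nat list \<Rightarrow> real) \<Rightarrow> nat list \<Rightarrow> real" where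
  "death_time s i = birth_time s i + s i"

definition tree :: "enat \<Rightarrow> ('w \<Rightarrow> nat) \<Rightarrow> (nat list \<Rightarrow> 'w) \<Rightarrow> nat list set" where
  "tree d \<kappa> w = {i \<in> words d. \<forall>m<length i. i ! m \<le> \<kappa> (w (take m i))}"

definition tree_at ::
  "enat \<Rightarrow> ('w \<Rightarrow> nat) \<Rightarrow> real \<Rightarrow> (nat list \<Rightarrow> 'w) \<Rightarrow> (nat list \<Rightarrow> real) \<Rightarrow> nat list set" where
  "tree_at d \<kappa> t w s = {i \<in> tree d \<kappa> w. death_time s i \<le> t}"

definition leaves_at ::
  "enat \<Rightarrow> ('w \<Rightarrow> nat) \<Rightarrow> real \<Rightarrow> (nat list \<Rightarrow> 'w) \<Rightarrow> (nat list \<Rightarrow> real) \<Rightarrow> nat list set" where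
  "leaves_at d \<kappa> t w s = {i \<in> tree d \<kappa> w. birth_time s i \<le> t \<and> t < death_time s i}"

text \<open>\<open>node_value \<gamma> w U x i\<close> is \<open>x\<^sub>i\<close>, computed from the values of \<open>x\<close> outside the finite subtree \<open>U\<close>.
  The sequence passed to \<open>\<gamma> (w i)\<close> also has entries beyond the first \<open>\<kappa> (w i)\<close>; they are irrelevant
  when \<open>\<gamma>\<close> depends only on the first \<open>\<kappa> (w i)\<close> coordinates. The guard \<open>finite U\<close> ensures termination.\<close>

function node_value ::
  "('w \<Rightarrow> (nat \<Rightarrow> 'a) \<Rightarrow> 'a) \<Rightarrow> (nat list \<Rightarrow> 'w) \<Rightarrow> nat list set \<Rightarrow> (nat list \<Rightarrow> 'a)
     \<Rightarrow> nat list \<Rightarrow> 'a" where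
  "node_value \<gamma> w U x i =
     (if finite U \<and> i \<in> U then \<gamma> (w i) (\<lambda>k\<in>{1..}. node_value \<gamma> w U x (i @ [k])) else x i)"
  by pat_completeness auto
termination
proof (relation "Wellfounded.measure (\<lambda>(\<gamma>, w, U, x, i). card {j \<in> U. prefix i j})",
    goal_cases)
  case 1
  show ?case by simp
next
  case (2 \<gamma> w U x i k)
  then have "{j \<in> U. prefix (i @ [k]) j} \<subset> {j \<in> U. prefix i j}"
    by (auto simp: prefix_def)
  with 2 have "card {j \<in> U. prefix (i @ [k]) j} < card {j \<in> U. prefix i j}"
    by (intro psubset_card_mono) auto
  then show ?case by simp
qed

declare node_value.simps [simp del]

definition tree_map ::
  "('w \<Rightarrow> (nat \<Rightarrow> 'a) \<Rightarrow> 'a) \<Rightarrow> (nat list \<Rightarrow> 'w) \<Rightarrow> nat list set \<Rightarrow> (nat list \<Rightarrow> 'a) \<Rightarrow> 'a" where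
  "tree_map \<gamma> w U x = node_value \<gamma> w U x []"


section \<open>Conditioning on the tree up to time \<open>t\<close>\<close>

text \<open>For random index sets \<open>J, V \<subseteq> I\<close>, the \<open>\<sigma>\<close>-field generated by \<open>J\<close> and the families
  \<open>(Y\<^sub>i)\<^sub>i\<^sub>\<in>\<^sub>V\<close> and \<open>(Z\<^sub>i)\<^sub>i\<^sub>\<in>\<^sub>V\<close>. The random set \<open>J\<close> enters through the events \<open>i \<in> J\<close>, which for countable
  \<open>I\<close> determine all events \<open>J = A\<close>.\<close>

definition random_index_sigma ::
  "'p measure \<Rightarrow> 'i set \<Rightarrow> ('p \<Rightarrow> 'i set) \<Rightarrow> ('p \<Rightarrow> 'i set) \<Rightarrow>
     ('i \<Rightarrow> 'p \<Rightarrow> 'b::topological_space) \<Rightarrow> ('i \<Rightarrow> 'p \<Rightarrow> 'c::topological_space) \<Rightarrow> 'p measure" where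
  "random_index_sigma M I J V Y Z = sigma (space M)
     ({{p \<in> space M. i \<in> J p} |i. i \<in> I} \<union>
      {{p \<in> space M. i \<in> V p \<and> Y i p \<in> B} |i B. i \<in> I \<and> B \<in> sets borel} \<union>
      {{p \<in> space M. i \<in> V p \<and> Z i p \<in> B} |i B. i \<in> I \<and> B \<in> sets borel})"

text \<open>Conditionally on \<open>F\<close>, the family \<open>(X\<^sub>i)\<^sub>i\<^sub>\<in>\<^sub>J\<close> is i.i.d. with law \<open>\<mu>\<close>, for an almost surely
  finite \<open>F\<close>-measurable random set \<open>J\<close>: almost surely, the conditional probability given \<open>F\<close> that
  \<open>X\<^sub>i \<in> B\<^sub>i\<close> for all \<open>i \<in> J\<close> is the product of \<open>\<mu>(B\<^sub>i)\<close> over \<open>i \<in> J\<close>. The variable \<open>X\<^sub>i\<close> is only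
  relevant (and only required to be measurable) on the event \<open>i \<in> J\<close>.\<close>

definition cond_iid ::
  "'p measure \<Rightarrow> 'p measure \<Rightarrow> ('p \<Rightarrow> 'i set) \<Rightarrow> ('i \<Rightarrow> 'p \<Rightarrow> 'a::topological_space) \<Rightarrow> 'a measure
     \<Rightarrow> bool" where
  "cond_iid M F J X \<mu> \<longleftrightarrow>
     (\<forall>i. X i \<in> restrict_space M {p \<in> space M. i \<in> J p} \<rightarrow>\<^sub>M borel) \<and>
     (\<forall>B. (\<forall>i. B i \<in> sets borel) \<longrightarrow>
        (AE p in M. real_cond_exp M F (indicator {p \<in> space M. \<forall>i\<in>J p. X i p \<in> B i}) p
           = (\<Prod>i\<in>J p. measure \<mu> (B i))))"


section \<open>The random objects\<close>

definition random_tree ::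
  "enat \<Rightarrow> ('w \<Rightarrow> nat) \<Rightarrow> (nat list \<Rightarrow> 'p \<Rightarrow> 'w) \<Rightarrow> (nat list \<Rightarrow> 'p \<Rightarrow> real) \<Rightarrow> real \<Rightarrow> 'p
     \<Rightarrow> nat list set" where
  "random_tree d \<kappa> \<omega> \<sigma> t p = tree_at d \<kappa> t (\<lambda>i. \<omega> i p) (\<lambda>i. \<sigma> i p)"

definition random_leaves ::
  "enat \<Rightarrow> ('w \<Rightarrow> nat) \<Rightarrow> (nat list \<Rightarrow> 'p \<Rightarrow> 'w) \<Rightarrow> (nat list \<Rightarrow> 'p \<Rightarrow> real) \<Rightarrow> real \<Rightarrow> 'p
     \<Rightarrow> nat list set" where
  "random_leaves d \<kappa> \<omega> \<sigma> t p = leaves_at d \<kappa> t (\<lambda>i. \<omega> i p) (\<lambda>i. \<sigma> i p)"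

definition random_map ::
  "enat \<Rightarrow> ('w \<Rightarrow> nat) \<Rightarrow> ('w \<Rightarrow> (nat \<Rightarrow> 'a) \<Rightarrow> 'a) \<Rightarrow> (nat list \<Rightarrow> 'p \<Rightarrow> 'w)
     \<Rightarrow> (nat list \<Rightarrow> 'p \<Rightarrow> real) \<Rightarrow> real \<Rightarrow> 'p \<Rightarrow> (nat list \<Rightarrow> 'a) \<Rightarrow> 'a" where
  "random_map d \<kappa> \<gamma> \<omega> \<sigma> t p = tree_map \<gamma> (\<lambda>i. \<omega> i p) (random_tree d \<kappa> \<omega> \<sigma> t p)"

definition history_sigma ::
  "'p measure \<Rightarrow> enat \<Rightarrow> ('w::topological_space \<Rightarrow> nat) \<Rightarrow> (nat list \<Rightarrow> 'p \<Rightarrow> 'w)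
     \<Rightarrow> (nat list \<Rightarrow> 'p \<Rightarrow> real) \<Rightarrow> real \<Rightarrow> 'p measure" where
  "history_sigma M d \<kappa> \<omega> \<sigma> t =
     random_index_sigma M (words d) (random_leaves d \<kappa> \<omega> \<sigma> t) (random_tree d \<kappa> \<omega> \<sigma> t) \<omega> \<sigma>"

end

theory Submission
  imports Defs
begin

text \<open>Realise all nodes at once: on the countable product of the laws of \<open>(\<sigma>, X, \<omega>)\<close>, one
  factor per word, the value computed at the root up to time \<open>t\<close> has some law \<open>\<nu>\<^sub>t\<close>. Cutting the
  tree at its root gives a mark of the root and independent copies of the whole tree, one per child,
  and hence the renewal equation
  \<open>\<nu>\<^sub>t = e\<^sup>-\<^sup>R\<^sup>t \<mu> + \<integral>\<^sub>0\<^sup>t R e\<^sup>-\<^sup>R\<^sup>s T(\<nu>\<^sub>t\<^sub>-\<^sub>s) ds\<close> with \<open>R = |r|\<close>. The same decomposition bounds the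
  probability that infinitely many nodes die before \<open>t\<close> by \<open>(R k t)\<^sup>n / n!\<close> for every \<open>n\<close>, where \<open>k\<close>
  is the mean of \<open>\<kappa>\<close>, so it is zero.

  Replacing the arguments of \<open>\<gamma>\<close> one at a time shows that \<open>T\<close> is Lipschitz with constant \<open>k\<close> in total
  variation. Therefore \<open>\<nu>\<close> is Lipschitz in time and the renewal equation can be differentiated, and two
  solutions differ at time \<open>t\<close> by at most \<open>2 (R (k + 1) t)\<^sup>n / n!\<close> for every \<open>n\<close>. Finally, on each
  event that fixes the finite sets of dead and of alive nodes, conditioning on the history shows that
  the given \<open>X\<close> may be replaced by an independent i.i.d. family on all nodes.\<close>

text \<open>Cutting at the root yields copies of the same object only if the index set is invariant
  under removing a first letter and does not depend on the mark of the root. The canonical space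
  therefore carries labels on all lists of natural numbers, inside or outside of the tree, with the
  alphabet \<open>\<infinity>\<close>, one choice for every \<open>d\<close>; the given marks are
  compared with it through the words that they share.

  Two kinds of default values have to be kept under control. \<open>node_value\<close> does not
  descend into an infinite tree, so the recursion at the root holds only after almost sure
  finiteness. And \<open>X i\<close> makes sense only on the event that \<open>i\<close> is alive,
  so the index set of the conditionally i.i.d. family is itself random.

  On the analytic side the renewal equation first gives only a measurable integrand. Continuity of
  the derivative, which is part of the notion of a solution, comes from a bootstrap: the equation
  bounds the increments of the law in total variation, and the Lipschitz property of
  \<open>T_map\<close> passes this on to the integrand.\<close>

section \<open>Product measures\<close>

text \<open>For \<open>i\<close> outside of \<open>I\<close> the coordinate is constantly \<open>undefined\<close> on the space of \<open>PiM I\<close>.\<close>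

lemma measurable_component_borel:
  "(\<lambda>x. x i) \<in> (\<Pi>\<^sub>M i\<in>I. borel) \<rightarrow>\<^sub>M (borel :: 'a::topological_space measure)"
proof (cases "i \<in> I")
  case False
  have "(\<lambda>x. undefined) \<in> (\<Pi>\<^sub>M i\<in>I. borel) \<rightarrow>\<^sub>M (borel :: 'a measure)" by simp
  then show ?thesis
    by (rule measurable_cong[THEN iffD1, rotated])
      (use False in \<open>auto simp: space_PiM PiE_iff extensional_def\<close>)
qed (rule measurable_component_singleton)

text \<open>The preimage of a cylinder over \<open>J \<subseteq> K\<close> is a cylinder over the
  same \<open>J\<close>, and cylinder probabilities determine a product measure. With
  \<open>f = root_value u\<close> this gives the joint law of the values of the children; with the
  identity it discards coordinates.\<close>

lemma distr_PiM_restrict_map: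
  assumes P: "prob_space P" and f: "f \<in> P \<rightarrow>\<^sub>M Q" and K: "K \<subseteq> I"
  shows "distr (\<Pi>\<^sub>M i\<in>I. P) (\<Pi>\<^sub>M k\<in>K. Q) (\<lambda>z. \<lambda>k\<in>K. f (z k)) = (\<Pi>\<^sub>M k\<in>K. distr P Q f)"
proof -
  interpret P: prob_space P by fact
  interpret D: prob_space "distr P Q f" using f by (rule P.prob_space_distr)
  interpret PD: product_prob_space "\<lambda>_. distr P Q f" K ..
  interpret PP: product_prob_space "\<lambda>_. P" I ..
  have meas: "(\<lambda>z. \<lambda>k\<in>K. f (z k)) \<in> (\<Pi>\<^sub>M i\<in>I. P) \<rightarrow>\<^sub>M (\<Pi>\<^sub>M k\<in>K. Q)"
    using K by (intro measurable_restrict measurable_compose[OF _ f] measurable_component_singleton) auto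
  show ?thesis
  proof (rule PD.PiM_eq)
    show "sets (distr (\<Pi>\<^sub>M i\<in>I. P) (\<Pi>\<^sub>M k\<in>K. Q) (\<lambda>z. \<lambda>k\<in>K. f (z k))) = sets (\<Pi>\<^sub>M k\<in>K. distr P Q f)"
      by (simp cong: sets_PiM_cong)
    fix J F assume J: "finite J" "J \<subseteq> K" and F: "\<And>j. j \<in> J \<Longrightarrow> F j \<in> sets (distr P Q f)"
    let ?G = "\<lambda>j. f -` F j \<inter> space P"
    have "emeasure (distr (\<Pi>\<^sub>M i\<in>I. P) (\<Pi>\<^sub>M k\<in>K. Q) (\<lambda>z. \<lambda>k\<in>K. f (z k)))
        (prod_emb K (\<lambda>_. distr P Q f) J (Pi\<^sub>E J F))
      = emeasure (\<Pi>\<^sub>M i\<in>I. P) {z \<in> space (\<Pi>\<^sub>M i\<in>I. P). \<forall>j\<in>J. z j \<in> ?G j}"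
    proof (subst emeasure_distr[OF meas])
      have "prod_emb K (\<lambda>_. distr P Q f) J (Pi\<^sub>E J F) \<in> sets (\<Pi>\<^sub>M k\<in>K. distr P Q f)"
        using J F by (intro sets_PiM_I) auto
      then show "prod_emb K (\<lambda>_. distr P Q f) J (Pi\<^sub>E J F) \<in> sets (\<Pi>\<^sub>M k\<in>K. Q)"
        by (simp cong: sets_PiM_cong)
      show "emeasure (Pi\<^sub>M I (\<lambda>i. P)) ((\<lambda>z. \<lambda>k\<in>K. f (z k)) -` prod_emb K (\<lambda>_. distr P Q f) J (Pi\<^sub>E J F) \<inter> space (Pi\<^sub>M I (\<lambda>i. P))) =
         emeasure (Pi\<^sub>M I (\<lambda>i. P)) {z \<in> space (Pi\<^sub>M I (\<lambda>i. P)). \<forall>j\<in>J. z j \<in> f -` F j \<inter> space P}"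
        using J K measurable_space[OF f]
        by (intro arg_cong[where f="emeasure _"])
          (auto simp: prod_emb_def space_PiM PiE_iff Pi_iff subset_eq extensional_def)
    qed
    also have "\<dots> = (\<Prod>j\<in>J. emeasure P (?G j))"
      using J K F f by (intro PP.emeasure_PiM_Collect) (auto intro: measurable_sets)
    also have "\<dots> = (\<Prod>j\<in>J. emeasure (distr P Q f) (F j))"
      using F f by (intro prod.cong refl) (simp add: emeasure_distr)
    finally show "emeasure (distr (\<Pi>\<^sub>M i\<in>I. P) (\<Pi>\<^sub>M k\<in>K. Q) (\<lambda>z. \<lambda>k\<in>K. f (z k)))
        (prod_emb K (\<lambda>_. distr P Q f) J (Pi\<^sub>E J F)) = (\<Prod>j\<in>J. emeasure (distr P Q f) (F j))" .
  qed
qed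

lemma distr_PiM_restrict:
  assumes P: "prob_space P" and K: "K \<subseteq> I"
  shows "distr (\<Pi>\<^sub>M i\<in>I. P) (\<Pi>\<^sub>M k\<in>K. P) (\<lambda>z. restrict z K) = (\<Pi>\<^sub>M k\<in>K. P)"
  using distr_PiM_restrict_map[OF P measurable_ident_sets[OF refl] K] by (simp add: restrict_def distr_id)

text \<open>Fubini on cylinders: for fixed \<open>x\<close>, the section of a cylinder over
  \<open>J\<close> is again a cylinder, so its measure is a product over \<open>j \<in> J\<close> of
  functions of the single coordinates \<open>x j\<close>, and the integral factorises.\<close>

lemma distr_PiM_pair:
  assumes A: "prob_space A" and B: "prob_space B"
  shows "distr ((\<Pi>\<^sub>M i\<in>I. A) \<Otimes>\<^sub>M (\<Pi>\<^sub>M i\<in>I. B)) (\<Pi>\<^sub>M i\<in>I. A \<Otimes>\<^sub>M B) (\<lambda>(x, y). \<lambda>i\<in>I. (x i, y i))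
    = (\<Pi>\<^sub>M i\<in>I. A \<Otimes>\<^sub>M B)"
proof -
  interpret A: prob_space A by fact
  interpret B: prob_space B by fact
  interpret AB: pair_prob_space A B ..
  interpret PA: product_prob_space "\<lambda>_. A" I ..
  interpret PB: product_prob_space "\<lambda>_. B" I ..
  interpret PAB: product_prob_space "\<lambda>_. A \<Otimes>\<^sub>M B" I ..
  let ?QA = "\<Pi>\<^sub>M i\<in>I. A" and ?QB = "\<Pi>\<^sub>M i\<in>I. B"
  let ?h = "\<lambda>(x, y). \<lambda>i\<in>I. (x i, y i)"
  have meas[measurable]: "?h \<in> ?QA \<Otimes>\<^sub>M ?QB \<rightarrow>\<^sub>M (\<Pi>\<^sub>M i\<in>I. A \<Otimes>\<^sub>M B)"
    unfolding case_prod_beta by (intro measurable_restrict) measurable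
  show ?thesis
  proof (rule PAB.PiM_eq)
    show "sets (distr (?QA \<Otimes>\<^sub>M ?QB) (\<Pi>\<^sub>M i\<in>I. A \<Otimes>\<^sub>M B) ?h) = sets (\<Pi>\<^sub>M i\<in>I. A \<Otimes>\<^sub>M B)" by simp
    fix J F assume J: "finite J" "J \<subseteq> I" and F: "\<And>j. j \<in> J \<Longrightarrow> F j \<in> sets (A \<Otimes>\<^sub>M B)"
    let ?E = "prod_emb I (\<lambda>_. A \<Otimes>\<^sub>M B) J (Pi\<^sub>E J F)"
    have E: "?E \<in> sets (\<Pi>\<^sub>M i\<in>I. A \<Otimes>\<^sub>M B)" using J F by (intro sets_PiM_I) auto
    let ?H = "?h -` ?E \<inter> space (?QA \<Otimes>\<^sub>M ?QB)"
    have H: "?H \<in> sets (?QA \<Otimes>\<^sub>M ?QB)" using E by (rule measurable_sets[OF meas])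
    interpret J: product_sigma_finite "\<lambda>_. A" ..
    have sl: "Pair x -` ?H = {y \<in> space ?QB. \<forall>j\<in>J. y j \<in> Pair (x j) -` F j}" if "x \<in> space ?QA" for x
      using that J F[THEN sets.sets_into_space]
      by (fastforce simp: prod_emb_def space_PiM PiE_iff space_pair_measure)
    have "emeasure (distr (?QA \<Otimes>\<^sub>M ?QB) (\<Pi>\<^sub>M i\<in>I. A \<Otimes>\<^sub>M B) ?h) ?E = emeasure (?QA \<Otimes>\<^sub>M ?QB) ?H"
      using E by (simp add: emeasure_distr)
    also have "\<dots> = (\<integral>\<^sup>+x. emeasure ?QB (Pair x -` ?H) \<partial>?QA)"
      by (rule PB.emeasure_pair_measure_alt[OF H])
    also have "\<dots> = (\<integral>\<^sup>+x. (\<Prod>j\<in>J. emeasure B (Pair (x j) -` F j)) \<partial>?QA)"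
    proof (rule nn_integral_cong)
      fix x assume x: "x \<in> space ?QA"
      show "emeasure ?QB (Pair x -` ?H) = (\<Prod>j\<in>J. emeasure B (Pair (x j) -` F j))"
        unfolding sl[OF x] using J F by (intro PB.emeasure_PiM_Collect) (auto intro: sets_Pair1)
    qed
    \<comment> \<open>The integrand reads only the coordinates in the finite set \<open>J\<close>,
      so the possibly infinite product is projected to \<open>J\<close>, where the integral of a
      product of one-coordinate functions splits.\<close>
    also have "\<dots> = (\<integral>\<^sup>+x. (\<Prod>j\<in>J. emeasure B (Pair (x j) -` F j)) \<partial>(\<Pi>\<^sub>M i\<in>J. A))"
    proof -
      have m: "(\<lambda>x. (\<Prod>j\<in>J. emeasure B (Pair (x j) -` F j))) \<in> borel_measurable (\<Pi>\<^sub>M i\<in>J. A)"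
        using F J by (intro borel_measurable_prod_ennreal measurable_compose[OF measurable_component_singleton B.measurable_emeasure_Pair]) auto
      show ?thesis
        by (subst distr_PiM_restrict[OF A.prob_space_axioms J(2), symmetric], subst nn_integral_distr)
          (use m J(2) in \<open>auto intro!: nn_integral_cong measurable_restrict_subset prod.cong\<close>)
    qed
    also have "\<dots> = (\<Prod>j\<in>J. \<integral>\<^sup>+a. emeasure B (Pair a -` F j) \<partial>A)"
      using F J by (intro J.product_nn_integral_prod B.measurable_emeasure_Pair) auto
    also have "\<dots> = (\<Prod>j\<in>J. emeasure (A \<Otimes>\<^sub>M B) (F j))"
      using F by (intro prod.cong refl B.emeasure_pair_measure_alt[symmetric])
    finally show "emeasure (distr (?QA \<Otimes>\<^sub>M ?QB) (\<Pi>\<^sub>M i\<in>I. A \<Otimes>\<^sub>M B) ?h) ?E = (\<Prod>j\<in>J. emeasure (A \<Otimes>\<^sub>M B) (F j))" .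
  qed
qed

text \<open>The bijection between labelled trees and pairs of a root label and one labelled tree for
  each first letter. The letter 0 is included so that both sides are indexed by full types; words
  containing it never lie in \<open>tree\<close>.\<close>

fun join_trees :: "'b \<times> (nat \<Rightarrow> nat list \<Rightarrow> 'b) \<Rightarrow> nat list \<Rightarrow> 'b" where
  "join_trees (n, z) [] = n"
| "join_trees (n, z) (k # j) = z k j"

lemma measurable_join_trees [measurable]:
  "join_trees \<in> N \<Otimes>\<^sub>M (\<Pi>\<^sub>M k\<in>UNIV. \<Pi>\<^sub>M j\<in>UNIV. N) \<rightarrow>\<^sub>M (\<Pi>\<^sub>M j\<in>UNIV. N)"
proof -
  have "(\<lambda>x. \<lambda>i\<in>UNIV. join_trees x i) \<in> N \<Otimes>\<^sub>M (\<Pi>\<^sub>M k\<in>UNIV. \<Pi>\<^sub>M j\<in>UNIV. N) \<rightarrow>\<^sub>M (\<Pi>\<^sub>M j\<in>UNIV. N)"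
  proof (rule measurable_restrict)
    fix i :: "nat list"
    have [simp]: "join_trees x [] = fst x" "join_trees x (k # j) = snd x k j" for x :: "'a \<times> _" and k j
      by (cases x; simp)+
    show "(\<lambda>x. join_trees x i) \<in> N \<Otimes>\<^sub>M (\<Pi>\<^sub>M k\<in>UNIV. \<Pi>\<^sub>M j\<in>UNIV. N) \<rightarrow>\<^sub>M N"
    proof (cases i)
      case (Cons k j)
      have *: "(\<lambda>x. snd x k) \<in> N \<Otimes>\<^sub>M (\<Pi>\<^sub>M k\<in>UNIV. \<Pi>\<^sub>M j\<in>UNIV. N) \<rightarrow>\<^sub>M (\<Pi>\<^sub>M j\<in>UNIV. N)"
        by measurable
      show ?thesis
        using measurable_compose[OF *  measurable_component_singleton[of j]] by (simp add: Cons)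
    qed simp
  qed
  then show ?thesis by (simp add: restrict_def)
qed

text \<open>Words are the disjoint union of the empty word and the pairs of a first letter and a
  word, so a finite cylinder pulls back to a root condition times a finite cylinder for each of
  finitely many first letters.\<close>

lemma distr_join_trees:
  assumes N: "prob_space N"
  defines "P \<equiv> (\<Pi>\<^sub>M j\<in>(UNIV :: nat list set). N)"
  shows "distr (N \<Otimes>\<^sub>M (\<Pi>\<^sub>M k\<in>UNIV. P)) P join_trees = P"
proof -
  interpret N: prob_space N by fact
  interpret P: product_prob_space "\<lambda>_. N" "UNIV :: nat list set" ..
  interpret PP: prob_space P unfolding P_def by (rule P.prob_space_axioms)
  interpret Q: product_prob_space "\<lambda>_. P" "UNIV :: nat set" ..
  let ?Q = "\<Pi>\<^sub>M k\<in>UNIV. P"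
  interpret QQ: prob_space ?Q by (intro prob_space_PiM PP.prob_space_axioms)
  have meas: "join_trees \<in> N \<Otimes>\<^sub>M ?Q \<rightarrow>\<^sub>M P" unfolding P_def by measurable
  have "distr (N \<Otimes>\<^sub>M ?Q) P join_trees = Pi\<^sub>M UNIV (\<lambda>_. N)"
  proof (rule P.PiM_eq)
    show "sets (distr (N \<Otimes>\<^sub>M ?Q) P join_trees) = sets (\<Pi>\<^sub>M j\<in>UNIV. N)" by (simp add: P_def)
    fix J0 :: "nat list set" and F0 assume J0: "finite J0" and F0: "\<And>j. j \<in> J0 \<Longrightarrow> F0 j \<in> sets N"
    \<comment> \<open>The empty word is adjoined with the trivial condition \<open>space N\<close>,
      a factor 1, so that a root condition is always present.\<close>
    define J where "J = insert [] J0"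
    define F where "F j = (if j \<in> J0 then F0 j else space N)" for j
    have F: "F j \<in> sets N" for j using F0 by (simp add: F_def)
    define L where "L = {(k, j). k # j \<in> J0}"
    have LJ: "J - {[]} = (\<lambda>(k, j). k # j) ` L"
    proof -
      have "i \<in> (\<lambda>(k, j). k # j) ` L" if "i \<in> J - {[]}" for i
        using that by (cases i) (auto simp: L_def J_def image_iff)
      then show ?thesis by (auto simp: L_def J_def)
    qed
    have finL: "finite L"
      using J0 LJ by (intro finite_imageD[of "\<lambda>(k, j). k # j"]) (auto simp: J_def inj_on_def simp flip: LJ)
    let ?K = "fst ` L"
    let ?Jk = "\<lambda>k. {j. (k, j) \<in> L}"
    have Lsig: "L = Sigma ?K ?Jk" by force
    have finJk: "finite (?Jk k)" for k
      by (rule finite_subset[of _ "snd ` L"]) (use finL in force)+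
    let ?C = "\<lambda>k. {y \<in> space P. \<forall>j\<in>?Jk k. y j \<in> F (k # j)}"
    have C: "emeasure P (?C k) = (\<Prod>j\<in>?Jk k. emeasure N (F (k # j)))" "?C k \<in> sets P" for k
    proof -
      show "emeasure P (?C k) = (\<Prod>j\<in>?Jk k. emeasure N (F (k # j)))"
        unfolding P_def using F finJk by (intro P.emeasure_PiM_Collect) auto
      show "?C k \<in> sets P"
        unfolding P_def using F finJk by (intro sets.sets_Collect_finite_All sets_Collect_single') auto
    qed
    let ?E = "prod_emb UNIV (\<lambda>_. N) J0 (Pi\<^sub>E J0 F0)"
    have E: "?E \<in> sets P" unfolding P_def using J0 F0 by (intro sets_PiM_I) auto
    have pre: "join_trees -` ?E \<inter> space (N \<Otimes>\<^sub>M ?Q) = F [] \<times> {z \<in> space ?Q. \<forall>k\<in>?K. z k \<in> ?C k}"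
      (is "?l = ?r")
    proof -
      have FJ: "join_trees (n, z) \<in> ?E \<longleftrightarrow> (n, z) \<in> ?r" if "n \<in> space N" "z \<in> space ?Q" for n z
      proof -
        have sp: "z k j \<in> space N" for k j
          using that by (auto simp: space_PiM PiE_iff P_def)
        have zk: "z k \<in> space P" for k using that by (auto simp: space_PiM)
        have jt: "join_trees (n, z) i \<in> space N" for i
          by (cases i) (use that sp in auto)
        have "join_trees (n, z) \<in> ?E \<longleftrightarrow> (\<forall>i\<in>J0. join_trees (n, z) i \<in> F0 i)"
          using jt by (auto simp: prod_emb_def PiE_iff)
        also have "\<dots> \<longleftrightarrow> (\<forall>i\<in>J. join_trees (n, z) i \<in> F i)"
          using jt jt[of "[]"] by (auto simp: J_def F_def)
        also have "\<dots> \<longleftrightarrow> n \<in> F [] \<and> (\<forall>i\<in>J-{[]}. join_trees (n, z) i \<in> F i)"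
          unfolding J_def by auto
        also have "\<dots> \<longleftrightarrow> n \<in> F [] \<and> (\<forall>(k,j)\<in>L. z k j \<in> F (k # j))"
          unfolding LJ by auto
        also have "\<dots> \<longleftrightarrow> (n, z) \<in> ?r"
          using that zk by force
        finally show ?thesis .
      qed
      show ?thesis
        using FJ F[THEN sets.sets_into_space, of "[]"] by (auto simp: space_pair_measure)
    qed
    have CS: "{z \<in> space ?Q. \<forall>k\<in>?K. z k \<in> ?C k} \<in> sets ?Q"
      using C finL by (intro sets.sets_Collect_finite_All sets_Collect_single') auto
    have "emeasure (distr (N \<Otimes>\<^sub>M ?Q) P join_trees) ?E = emeasure (N \<Otimes>\<^sub>M ?Q) (F [] \<times> {z \<in> space ?Q. \<forall>k\<in>?K. z k \<in> ?C k})"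
      using E meas by (simp only: emeasure_distr pre)
    also have "\<dots> = emeasure N (F []) * emeasure ?Q {z \<in> space ?Q. \<forall>k\<in>?K. z k \<in> ?C k}"
      using F CS by (intro QQ.emeasure_pair_measure_Times)
    also have "emeasure ?Q {z \<in> space ?Q. \<forall>k\<in>?K. z k \<in> ?C k} = (\<Prod>k\<in>?K. emeasure P (?C k))"
      using finL C by (intro Q.emeasure_PiM_Collect) auto
    also have "\<dots> = (\<Prod>k\<in>?K. \<Prod>j\<in>?Jk k. emeasure N (F (k # j)))"
      using C by simp
    also have "\<dots> = (\<Prod>(k, j)\<in>L. emeasure N (F (k # j)))"
      by (subst (3) Lsig, subst prod.Sigma) (use finL finJk in auto)
    also have "\<dots> = (\<Prod>i\<in>J-{[]}. emeasure N (F i))"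
      unfolding LJ by (subst prod.reindex) (auto simp: inj_on_def case_prod_beta intro!: prod.cong)
    also have "emeasure N (F []) * \<dots> = (\<Prod>i\<in>J. emeasure N (F i))"
      using J0 by (subst prod.remove[of J "[]"]) (auto simp: J_def)
    also have "\<dots> = (\<Prod>i\<in>J0. emeasure N (F0 i))"
      using J0 by (cases "[] \<in> J0") (auto simp: J_def F_def insert_absorb N.emeasure_space_1 intro!: prod.cong)
    finally show "emeasure (distr (N \<Otimes>\<^sub>M ?Q) P join_trees) ?E = (\<Prod>i\<in>J0. emeasure N (F0 i))" .
  qed
  then show ?thesis by (simp add: P_def)
qed

section \<open>Trees and their values\<close>

lemma Nil_in_words [simp]: "[] \<in> words d"
  by (simp add: words_def)

lemma Cons_in_words [simp]: "k # j \<in> words d \<longleftrightarrow> 1 \<le> k \<and> enat k \<le> d \<and> j \<in> words d"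
  by (auto simp: words_def)

lemma take_in_words: "i \<in> words d \<Longrightarrow> take m i \<in> words d"
  by (auto simp: words_def dest: in_set_takeD)

lemma tree_subset_words: "tree d \<kappa> w \<subseteq> words d"
  by (auto simp: tree_def)

lemma Nil_in_tree [simp]: "[] \<in> tree d \<kappa> w"
  by (simp add: tree_def)

lemma Cons_in_tree:
  "k # j \<in> tree d \<kappa> w \<longleftrightarrow>
    1 \<le> k \<and> enat k \<le> d \<and> k \<le> \<kappa> (w []) \<and> j \<in> tree d \<kappa> (\<lambda>i. w (k # i))"
proof -
  have "(\<forall>m<length (k # j). (k # j) ! m \<le> \<kappa> (w (take m (k # j)))) \<longleftrightarrow>
      k \<le> \<kappa> (w []) \<and> (\<forall>m<length j. j ! m \<le> \<kappa> (w (k # take m j)))"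
    unfolding length_Cons All_less_Suc2 by simp
  then show ?thesis by (simp add: tree_def) blast
qed

lemma snoc_in_tree:
  "i @ [k] \<in> tree d \<kappa> w \<longleftrightarrow> i \<in> tree d \<kappa> w \<and> 1 \<le> k \<and> enat k \<le> d \<and> k \<le> \<kappa> (w i)"
proof -
  have "(\<forall>m<length (i @ [k]). (i @ [k]) ! m \<le> \<kappa> (w (take m (i @ [k])))) \<longleftrightarrow>
      k \<le> \<kappa> (w i) \<and> (\<forall>m<length i. i ! m \<le> \<kappa> (w (take m i)))"
    unfolding length_append_singleton All_less_Suc by (simp add: nth_append)
  then show ?thesis by (auto simp: tree_def words_def)
qed

lemma birth_time_Nil [simp]: "birth_time s [] = 0"
  by (simp add: birth_time_def)

lemma birth_time_Cons: "birth_time s (k # j) = s [] + birth_time (\<lambda>i. s (k # i)) j"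
  by (simp add: birth_time_def sum.lessThan_Suc_shift del: sum.lessThan_Suc)

lemma birth_time_snoc: "birth_time s (i @ [k]) = death_time s i"
  by (simp add: birth_time_def death_time_def)

lemma death_time_Nil [simp]: "death_time s [] = s []"
  by (simp add: death_time_def)

lemma death_time_Cons: "death_time s (k # j) = s [] + death_time (\<lambda>i. s (k # i)) j"
  by (simp add: death_time_def birth_time_Cons)

lemma Nil_in_tree_at: "[] \<in> tree_at d \<kappa> t w s \<longleftrightarrow> s [] \<le> t"
  by (simp add: tree_at_def)

lemma Cons_in_tree_at:
  "k # j \<in> tree_at d \<kappa> t w s \<longleftrightarrow> 1 \<le> k \<and> enat k \<le> d \<and> k \<le> \<kappa> (w []) \<and>
    j \<in> tree_at d \<kappa> (t - s []) (\<lambda>i. w (k # i)) (\<lambda>i. s (k # i))"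
  by (auto simp: tree_at_def Cons_in_tree death_time_Cons)

lemma Nil_in_leaves_at: "[] \<in> leaves_at d \<kappa> t w s \<longleftrightarrow> 0 \<le> t \<and> t < s []"
  by (simp add: leaves_at_def)

lemma Cons_in_leaves_at:
  "k # j \<in> leaves_at d \<kappa> t w s \<longleftrightarrow> 1 \<le> k \<and> enat k \<le> d \<and> k \<le> \<kappa> (w []) \<and>
    j \<in> leaves_at d \<kappa> (t - s []) (\<lambda>i. w (k # i)) (\<lambda>i. s (k # i))"
  by (auto simp: leaves_at_def Cons_in_tree death_time_Cons birth_time_Cons)

text \<open>A child is born exactly when its parent dies (\<open>birth_time_snoc\<close>), so every
  alive node other than the root has its parent in \<open>tree_at\<close>, and each such parent has
  at most \<open>\<kappa>\<close> children.\<close>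

lemma finite_leaves_at:
  assumes "finite (tree_at d \<kappa> t w s)"
  shows "finite (leaves_at d \<kappa> t w s)"
proof (rule finite_subset)
  show "leaves_at d \<kappa> t w s \<subseteq> insert [] ((\<lambda>(i, k). i @ [k]) ` (SIGMA i:tree_at d \<kappa> t w s. {..\<kappa> (w i)}))"
  proof
    fix j assume j: "j \<in> leaves_at d \<kappa> t w s"
    show "j \<in> insert [] ((\<lambda>(i, k). i @ [k]) ` (SIGMA i:tree_at d \<kappa> t w s. {..\<kappa> (w i)}))"
    proof (cases j rule: rev_cases)
      case (snoc i k)
      with j have "i \<in> tree_at d \<kappa> t w s" "k \<le> \<kappa> (w i)"
        by (auto simp: leaves_at_def tree_at_def snoc_in_tree birth_time_snoc)
      then show ?thesis by (auto simp: snoc)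
    qed simp
  qed
qed (use assms in auto)

text \<open>Each letter of a word in the tree is at most some value of \<open>\<kappa>\<close>,
  hence at most \<open>d\<close>, so truncating the alphabet at \<open>d\<close> removes
  nothing.\<close>

lemma tree_eq_infinity:
  assumes "\<And>v. enat (\<kappa> v) \<le> d"
  shows "tree d \<kappa> w = tree \<infinity> \<kappa> w"
proof -
  have "i \<in> words d" if i: "i \<in> tree \<infinity> \<kappa> w" for i
  proof -
    have "1 \<le> k \<and> enat k \<le> d" if k: "k \<in> set i" for k
    proof -
      obtain m where m: "m < length i" "k = i ! m" using k by (auto simp: in_set_conv_nth)
      have "k \<le> \<kappa> (w (take m i))" using i m by (auto simp: tree_def)
      then have "enat k \<le> d" using assms order_trans enat_ord_simps(1) by blast
      then show ?thesis using i k by (auto simp: tree_def words_def)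
    qed
    then show ?thesis by (simp add: words_def)
  qed
  then show ?thesis by (auto simp: tree_def words_def)
qed

text \<open>Apart from the root, the tree consists of the trees of the finitely many children at the
  remaining time \<open>t - s []\<close>, so one of these must be infinite; and no node dies before
  the root, lifetimes being nonnegative.\<close>

lemma infinite_tree_atD:
  assumes inf: "infinite (tree_at \<infinity> \<kappa> t w s)" and pos: "\<And>i. 0 \<le> s i"
  shows "s [] \<le> t \<and> (\<exists>k\<in>{1..\<kappa> (w [])}.
    infinite (tree_at \<infinity> \<kappa> (t - s []) (\<lambda>i. w (k # i)) (\<lambda>i. s (k # i))))"
proof
  have nonneg: "0 \<le> death_time (\<lambda>i. s (f i)) j" for f j
    by (auto simp: death_time_def birth_time_def pos intro!: add_nonneg_nonneg sum_nonneg)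
  have death: "s [] \<le> death_time s i" for i
  proof (cases i)
    case (Cons k j)
    then show ?thesis using nonneg[of "(#) k" j] by (simp add: death_time_Cons)
  qed simp
  obtain i where "i \<in> tree_at \<infinity> \<kappa> t w s" using inf by fastforce
  then show "s [] \<le> t" using death[of i] by (auto simp: tree_at_def)
  show "\<exists>k\<in>{1..\<kappa> (w [])}. infinite (tree_at \<infinity> \<kappa> (t - s []) (\<lambda>i. w (k # i)) (\<lambda>i. s (k # i)))"
  proof (rule ccontr)
    assume "\<not> ?thesis"
    then have "finite (insert [] (\<Union>k\<in>{1..\<kappa> (w [])}. (#) k ` tree_at \<infinity> \<kappa> (t - s []) (\<lambda>i. w (k # i)) (\<lambda>i. s (k # i))))"
      by auto
    moreover have "i \<in> insert [] (\<Union>k\<in>{1..\<kappa> (w [])}. (#) k ` tree_at \<infinity> \<kappa> (t - s []) (\<lambda>i. w (k # i)) (\<lambda>i. s (k # i)))"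
      if "i \<in> tree_at \<infinity> \<kappa> t w s" for i
      using that by (cases i) (auto simp: Cons_in_tree_at)
    ultimately show False using inf by (meson finite_subset subsetI)
  qed
qed

section \<open>Evaluation of the tree map\<close>

text \<open>The recursion of \<open>node_value\<close> appends letters at the end, so a first letter
  is carried along unchanged. The induction runs over the termination measure of
  \<open>node_value\<close>, the number of descendants inside \<open>U\<close>.\<close>

lemma node_value_Cons:
  assumes U: "finite U"
  shows "node_value \<gamma> w U x (k # i)
    = node_value \<gamma> (\<lambda>j. w (k # j)) {j. k # j \<in> U} (\<lambda>j. x (k # j)) i"
proof (induction "card {j \<in> U. prefix (k # i) j}" arbitrary: i rule: less_induct)
  case less
  have fin: "finite {j. k # j \<in> U}"
    using U by (rule finite_vimageI[of U "(#) k", unfolded vimage_def]) simp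
  show ?case
  proof (cases "k # i \<in> U")
    case True
    have "node_value \<gamma> w U x ((k # i) @ [l])
        = node_value \<gamma> (\<lambda>j. w (k # j)) {j. k # j \<in> U} (\<lambda>j. x (k # j)) (i @ [l])" for l
    proof -
      have "k # i \<in> {j \<in> U. prefix (k # i) j} - {j \<in> U. prefix (k # i @ [l]) j}"
        using True by (auto simp: prefix_def)
      moreover have "{j \<in> U. prefix (k # i @ [l]) j} \<subseteq> {j \<in> U. prefix (k # i) j}"
        by (auto simp: prefix_def)
      ultimately have "{j \<in> U. prefix (k # i @ [l]) j} \<subset> {j \<in> U. prefix (k # i) j}" by blast
      then show ?thesis using less[of "i @ [l]"] U by (simp add: psubset_card_mono)
    qed
    then show ?thesis
      using True U fin node_value.simps[of \<gamma> w U x "k # i"]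
        node_value.simps[of \<gamma> "\<lambda>j. w (k # j)" "{j. k # j \<in> U}" "\<lambda>j. x (k # j)" i]
      by (simp cong: restrict_cong)
  next
    case False
    then show ?thesis by (simp add: node_value.simps)
  qed
qed

text \<open>Apart from the starting node, \<open>x\<close> matters only at children outside
  \<open>U\<close> whose last letter is at most \<open>\<kappa>\<close>; later arguments may differ
  on the two sides and are absorbed by the dependence property of \<open>\<gamma>\<close>. Marks are
  read only in \<open>U\<close>, which later permits a default mark at all other nodes.\<close>

lemma node_value_cong:
  assumes \<gamma>: "\<And>v x y. x \<in> extensional {1..} \<Longrightarrow> y \<in> extensional {1..} \<Longrightarrow>
         (\<forall>k\<in>{1..\<kappa> v}. x k = y k) \<Longrightarrow> \<gamma> v x = \<gamma> v y"
    and U: "finite U" and w: "\<And>i. i \<in> U \<Longrightarrow> w i = w' i"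
    and x: "\<And>i k. i \<in> U \<Longrightarrow> k \<in> {1..\<kappa> (w i)} \<Longrightarrow> i @ [k] \<notin> U \<Longrightarrow> x (i @ [k]) = x' (i @ [k])"
    and xi: "i \<notin> U \<Longrightarrow> x i = x' i"
  shows "node_value \<gamma> w U x i = node_value \<gamma> w' U x' i"
  using xi
proof (induction "card {j \<in> U. prefix i j}" arbitrary: i rule: less_induct)
  case less
  show ?case
  proof (cases "i \<in> U")
    case True
    have "node_value \<gamma> w U x (i @ [k]) = node_value \<gamma> w' U x' (i @ [k])" if "k \<in> {1..\<kappa> (w i)}" for k
    proof (rule less.hyps)
      have "{j \<in> U. prefix (i @ [k]) j} \<subset> {j \<in> U. prefix i j}"
        using True by (auto simp: prefix_def)
      then show "card {j \<in> U. prefix (i @ [k]) j} < card {j \<in> U. prefix i j}"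
        using U by (simp add: psubset_card_mono)
    qed (use x True that in auto)
    then have "\<gamma> (w i) (\<lambda>k\<in>{1..}. node_value \<gamma> w U x (i @ [k]))
        = \<gamma> (w i) (\<lambda>k\<in>{1..}. node_value \<gamma> w' U x' (i @ [k]))"
      by (intro \<gamma>) auto
    then show ?thesis
      using True U w node_value.simps[of \<gamma> w U x i] node_value.simps[of \<gamma> w' U x' i] by simp
  next
    case False
    then show ?thesis using less.prems by (simp add: node_value.simps)
  qed
qed

text \<open>The argument is cut off outside the alive nodes exactly as in the theorem, where the
  family is given on \<open>random_leaves\<close>.\<close>

definition tree_value ::
  "('w \<Rightarrow> (nat \<Rightarrow> 'a) \<Rightarrow> 'a) \<Rightarrow> ('w \<Rightarrow> nat) \<Rightarrow> enat \<Rightarrow> real \<Rightarrow> (nat list \<Rightarrow> 'w) \<Rightarrow> (nat list \<Rightarrow> real)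
    \<Rightarrow> (nat list \<Rightarrow> 'a) \<Rightarrow> 'a" where
  "tree_value \<gamma> \<kappa> d t w s x = tree_map \<gamma> w (tree_at d \<kappa> t w s) (restrict x (leaves_at d \<kappa> t w s))"

text \<open>On an infinite set \<open>node_value\<close> stops at the root and returns a default,
  which is why the recursion asks for a finite tree.\<close>

lemma tree_value_rec:
  assumes \<gamma>: "\<And>v x y. x \<in> extensional {1..} \<Longrightarrow> y \<in> extensional {1..} \<Longrightarrow>
         (\<forall>k\<in>{1..\<kappa> v}. x k = y k) \<Longrightarrow> \<gamma> v x = \<gamma> v y"
    and t: "0 \<le> t" and fin: "finite (tree_at \<infinity> \<kappa> t w s)"
  shows "tree_value \<gamma> \<kappa> \<infinity> t w s x = (if t < s [] then x [] else
    \<gamma> (w []) (\<lambda>k\<in>{1..}. tree_value \<gamma> \<kappa> \<infinity> (t - s []) (\<lambda>i. w (k # i)) (\<lambda>i. s (k # i)) (\<lambda>i. x (k # i))))"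
proof (cases "t < s []")
  case True
  then have "[] \<notin> tree_at \<infinity> \<kappa> t w s" by (simp add: Nil_in_tree_at)
  then show ?thesis
    using True t by (simp add: tree_value_def tree_map_def node_value.simps Nil_in_leaves_at)
next
  case False
  let ?U = "tree_at \<infinity> \<kappa> t w s" and ?x = "restrict x (leaves_at \<infinity> \<kappa> t w s)"
  have "[] \<in> ?U" using False by (simp add: Nil_in_tree_at)
  then have "tree_value \<gamma> \<kappa> \<infinity> t w s x = \<gamma> (w []) (\<lambda>k\<in>{1..}. node_value \<gamma> w ?U ?x [k])"
    using fin by (simp add: tree_value_def tree_map_def node_value.simps[of _ _ _ _ "[]"])
  also have "\<dots> = \<gamma> (w []) (\<lambda>k\<in>{1..}.
      tree_value \<gamma> \<kappa> \<infinity> (t - s []) (\<lambda>i. w (k # i)) (\<lambda>i. s (k # i)) (\<lambda>i. x (k # i)))"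
  proof (rule \<gamma>)
    \<comment> \<open>For letters beyond \<open>\<kappa> (w [])\<close> the two argument sequences
      may differ: \<open>[k]\<close> is then outside the tree, while the shifted tree does not know
      this constraint. \<open>\<gamma>\<close> does not see these entries.\<close>
    show "\<forall>k\<in>{1..\<kappa> (w [])}. (\<lambda>k\<in>{1..}. node_value \<gamma> w ?U ?x [k]) k = (\<lambda>k\<in>{1..}.
      tree_value \<gamma> \<kappa> \<infinity> (t - s []) (\<lambda>i. w (k # i)) (\<lambda>i. s (k # i)) (\<lambda>i. x (k # i))) k"
    proof
      fix k assume k: "k \<in> {1..\<kappa> (w [])}"
      then have "{j. k # j \<in> ?U} = tree_at \<infinity> \<kappa> (t - s []) (\<lambda>i. w (k # i)) (\<lambda>i. s (k # i))"
        "(\<lambda>j. ?x (k # j)) = restrict (\<lambda>i. x (k # i)) (leaves_at \<infinity> \<kappa> (t - s []) (\<lambda>i. w (k # i)) (\<lambda>i. s (k # i)))"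
        by (auto simp: Cons_in_tree_at Cons_in_leaves_at fun_eq_iff restrict_def)
      then have "node_value \<gamma> w ?U ?x [k]
          = tree_value \<gamma> \<kappa> \<infinity> (t - s []) (\<lambda>i. w (k # i)) (\<lambda>i. s (k # i)) (\<lambda>i. x (k # i))"
        unfolding tree_value_def tree_map_def node_value_Cons[OF fin] by simp
      then show "(\<lambda>k\<in>{1..}. node_value \<gamma> w ?U ?x [k]) k = (\<lambda>k\<in>{1..}.
          tree_value \<gamma> \<kappa> \<infinity> (t - s []) (\<lambda>i. w (k # i)) (\<lambda>i. s (k # i)) (\<lambda>i. x (k # i))) k"
        using k by simp
    qed
  qed auto
  finally show ?thesis using False by simp
qed

lemma tree_at_cong_words:
  assumes "\<And>i. i \<in> words d \<Longrightarrow> w i = w' i" "\<And>i. i \<in> words d \<Longrightarrow> s i = s' i"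
  shows "tree_at d \<kappa> t w s = tree_at d \<kappa> t w' s'" "leaves_at d \<kappa> t w s = leaves_at d \<kappa> t w' s'"
proof -
  have tree: "tree d \<kappa> w = tree d \<kappa> w'"
    using assms(1) by (auto simp: tree_def take_in_words)
  have "birth_time s i = birth_time s' i \<and> death_time s i = death_time s' i" if "i \<in> tree d \<kappa> w" for i
    using that tree_subset_words[of d \<kappa> w] assms(2)
    by (auto simp: death_time_def birth_time_def take_in_words intro!: sum.cong)
  then show "tree_at d \<kappa> t w s = tree_at d \<kappa> t w' s'" "leaves_at d \<kappa> t w s = leaves_at d \<kappa> t w' s'"
    by (auto simp: tree_at_def leaves_at_def tree)
qed

lemma tree_value_cong_words:
  assumes \<gamma>: "\<And>v x y. x \<in> extensional {1..} \<Longrightarrow> y \<in> extensional {1..} \<Longrightarrow>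
         (\<forall>k\<in>{1..\<kappa> v}. x k = y k) \<Longrightarrow> \<gamma> v x = \<gamma> v y"
    and w: "\<And>i. i \<in> words d \<Longrightarrow> w i = w' i" and s: "\<And>i. i \<in> words d \<Longrightarrow> s i = s' i"
  shows "tree_value \<gamma> \<kappa> d t w s x = tree_value \<gamma> \<kappa> d t w' s' x"
proof -
  have eq: "tree_at d \<kappa> t w' s' = tree_at d \<kappa> t w s" "leaves_at d \<kappa> t w' s' = leaves_at d \<kappa> t w s"
    using tree_at_cong_words[of d w w' s s'] w s by auto
  show ?thesis
  proof (cases "finite (tree_at d \<kappa> t w s)")
    case True
    moreover have "i \<in> words d" if "i \<in> tree_at d \<kappa> t w s" for i
      using that tree_subset_words by (auto simp: tree_at_def)
    ultimately show ?thesis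
      unfolding tree_value_def tree_map_def eq
      by (intro node_value_cong[where \<kappa>=\<kappa>, OF \<gamma>] w refl) auto
  next
    case False
    then show ?thesis unfolding tree_value_def tree_map_def eq by (simp add: node_value.simps)
  qed
qed

section \<open>Measurability of the tree and of its value\<close>

lemma measurable_in_tree:
  assumes \<kappa>: "\<kappa> \<in> borel \<rightarrow>\<^sub>M count_space UNIV" and A: "\<And>i. i \<in> words d \<Longrightarrow> A i \<in> M \<rightarrow>\<^sub>M borel"
  shows "Measurable.pred M (\<lambda>p. i \<in> tree d \<kappa> (\<lambda>i. A i p))"
proof (cases "i \<in> words d")
  case True
  have "Measurable.pred M (\<lambda>p. i ! m \<le> \<kappa> (A (take m i) p))" for m
  proof -
    have [measurable]: "(\<lambda>p. \<kappa> (A (take m i) p)) \<in> M \<rightarrow>\<^sub>M count_space UNIV"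
      by (rule measurable_compose[OF A \<kappa>]) (rule take_in_words[OF True])
    show ?thesis by measurable
  qed
  then show ?thesis using True by (simp add: tree_def)
next
  case False
  then show ?thesis by (simp add: tree_def)
qed

lemma measurable_birth_death:
  assumes B: "\<And>i. i \<in> words d \<Longrightarrow> B i \<in> M \<rightarrow>\<^sub>M borel" and i: "i \<in> words d"
  shows "(\<lambda>p. birth_time (\<lambda>i. B i p) i) \<in> borel_measurable M"
    "(\<lambda>p. death_time (\<lambda>i. B i p) i) \<in> borel_measurable M"
  unfolding birth_time_def death_time_def
  by (intro borel_measurable_sum borel_measurable_add B[OF take_in_words[OF i]] B[OF i])+

text \<open>The time \<open>T\<close> is random because a child is evaluated at the time that its
  parent leaves to it, so joint measurability in time and marks is required. Marks are assumed
  measurable on \<open>words d\<close>, as the given families provide.\<close>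

lemma measurable_in_tree_at:
  assumes \<kappa>: "\<kappa> \<in> borel \<rightarrow>\<^sub>M count_space UNIV" and T[measurable]: "T \<in> borel_measurable M"
    and A: "\<And>i. i \<in> words d \<Longrightarrow> A i \<in> M \<rightarrow>\<^sub>M borel" and B: "\<And>i. i \<in> words d \<Longrightarrow> B i \<in> M \<rightarrow>\<^sub>M borel"
  shows "Measurable.pred M (\<lambda>p. i \<in> tree_at d \<kappa> (T p) (\<lambda>i. A i p) (\<lambda>i. B i p))" (is ?a)
    "Measurable.pred M (\<lambda>p. i \<in> leaves_at d \<kappa> (T p) (\<lambda>i. A i p) (\<lambda>i. B i p))" (is ?b)
proof -
  have "?a \<and> ?b"
  proof (cases "i \<in> words d")
    case True
    note [measurable] = measurable_in_tree[OF \<kappa> A, of d] measurable_birth_death[OF B True]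
    show ?thesis unfolding tree_at_def leaves_at_def mem_Collect_eq by (intro conjI) measurable
  next
    case False
    then show ?thesis by (auto simp: tree_at_def leaves_at_def tree_def)
  qed
  then show ?a ?b by auto
qed

lemma measurable_random_set_eq:
  fixes J :: "'p \<Rightarrow> 'i::countable set"
  assumes "\<And>i. Measurable.pred M (\<lambda>p. i \<in> J p)"
  shows "Measurable.pred M (\<lambda>p. J p = U)"
proof -
  have *: "(\<lambda>p. J p = U) = (\<lambda>p. \<forall>i. i \<in> J p \<longleftrightarrow> i \<in> U)" by auto
  show ?thesis unfolding * using assms by measurable
qed

text \<open>A random set of nodes can take uncountably many values, but the finite sets are
  countable; sending infinite values to \<open>{}\<close> leaves a countably valued variable, over
  which measurable functions can be glued.\<close>

lemma measurable_finite_random_set: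
  fixes J :: "'p \<Rightarrow> 'i::countable set"
  assumes "\<And>i. Measurable.pred M (\<lambda>p. i \<in> J p)"
  shows "(\<lambda>p. if finite (J p) then J p else {}) \<in> M \<rightarrow>\<^sub>M count_space (Collect finite)"
    and "Measurable.pred M (\<lambda>p. finite (J p))"
proof -
  have cnt: "countable (Collect finite :: 'i set set)" by (rule countable_Collect_finite)
  have fin: "{p \<in> space M. finite (J p)} = (\<Union>U\<in>Collect finite. {p \<in> space M. J p = U})" by auto
  show *: "Measurable.pred M (\<lambda>p. finite (J p))"
    unfolding pred_def fin using measurable_random_set_eq[OF assms]
    by (intro sets.countable_UN' cnt) (auto simp: pred_def)
  have "{p \<in> space M. (if finite (J p) then J p else {}) = U} \<in> sets M" for U
  proof -
    have "Measurable.pred M (\<lambda>p. finite (J p) \<and> J p = U \<or> \<not> finite (J p) \<and> {} = U)"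
      using * measurable_random_set_eq[OF assms] by measurable
    moreover have "(\<lambda>p. finite (J p) \<and> J p = U \<or> \<not> finite (J p) \<and> {} = U) = (\<lambda>p. (if finite (J p) then J p else {}) = U)"
      by auto
    ultimately show ?thesis unfolding pred_def by metis
  qed
  then show "(\<lambda>p. if finite (J p) then J p else {}) \<in> M \<rightarrow>\<^sub>M count_space (Collect finite)"
    using cnt by (auto simp: measurable_count_space_eq_countable vimage_def Int_def conj_commute)
qed

lemma measurable_node_value:
  assumes \<gamma>: "(\<lambda>(w, x). \<gamma> w x) \<in> borel \<Otimes>\<^sub>M (\<Pi>\<^sub>M k\<in>{1..}. borel) \<rightarrow>\<^sub>M borel"
    and A: "\<And>i. i \<in> U \<Longrightarrow> A i \<in> M \<rightarrow>\<^sub>M borel" and x: "\<And>i. x i \<in> M \<rightarrow>\<^sub>M borel"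
  shows "(\<lambda>p. node_value \<gamma> (\<lambda>i. A i p) U (\<lambda>i. x i p) i) \<in> M \<rightarrow>\<^sub>M borel"
proof (induction "card {j \<in> U. prefix i j}" arbitrary: i rule: less_induct)
  case less
  show ?case
  proof (cases "finite U \<and> i \<in> U")
    case True
    have "(\<lambda>p. node_value \<gamma> (\<lambda>i. A i p) U (\<lambda>i. x i p) (i @ [k])) \<in> M \<rightarrow>\<^sub>M borel" for k
    proof (rule less)
      have "{j \<in> U. prefix (i @ [k]) j} \<subset> {j \<in> U. prefix i j}"
        using True by (auto simp: prefix_def)
      then show "card {j \<in> U. prefix (i @ [k]) j} < card {j \<in> U. prefix i j}"
        using True by (simp add: psubset_card_mono)
    qed
    then have "(\<lambda>p. (A i p, \<lambda>k\<in>{1..}. node_value \<gamma> (\<lambda>i. A i p) U (\<lambda>i. x i p) (i @ [k])))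
        \<in> M \<rightarrow>\<^sub>M borel \<Otimes>\<^sub>M (\<Pi>\<^sub>M k\<in>{1..}. borel)"
      using A True by (intro measurable_Pair measurable_restrict) auto
    from measurable_compose[OF this \<gamma>] show ?thesis
      using True by (subst node_value.simps) simp
  next
    case False
    then show ?thesis using x by (subst node_value.simps) auto
  qed
qed

lemma measurable_tree_value:
  assumes \<gamma>: "(\<lambda>(w, x). \<gamma> w x) \<in> borel \<Otimes>\<^sub>M (\<Pi>\<^sub>M k\<in>{1..}. borel) \<rightarrow>\<^sub>M borel"
    and \<kappa>: "\<kappa> \<in> borel \<rightarrow>\<^sub>M count_space UNIV" and T: "T \<in> borel_measurable M"
    and A: "\<And>i. A i \<in> M \<rightarrow>\<^sub>M borel" and B: "\<And>i. B i \<in> M \<rightarrow>\<^sub>M borel" and x: "\<And>i. x i \<in> M \<rightarrow>\<^sub>M borel"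
  shows "(\<lambda>p. tree_value \<gamma> \<kappa> d (T p) (\<lambda>i. A i p) (\<lambda>i. B i p) (\<lambda>i. x i p)) \<in> M \<rightarrow>\<^sub>M borel"
proof -
  let ?J = "\<lambda>p. tree_at d \<kappa> (T p) (\<lambda>i. A i p) (\<lambda>i. B i p)"
  let ?L = "\<lambda>p. leaves_at d \<kappa> (T p) (\<lambda>i. A i p) (\<lambda>i. B i p)"
  let ?x = "\<lambda>i p. if i \<in> ?L p then x i p else undefined"
  have "(\<lambda>p. node_value \<gamma> (\<lambda>i. A i p) (if finite (?J p) then ?J p else {}) (\<lambda>i. ?x i p) []) \<in> M \<rightarrow>\<^sub>M borel"
  proof (rule measurable_compose_countable'[where I="Collect finite"
        and f="\<lambda>U p. node_value \<gamma> (\<lambda>i. A i p) U (\<lambda>i. ?x i p) []"])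
    show "(\<lambda>p. node_value \<gamma> (\<lambda>i. A i p) U (\<lambda>i. ?x i p) []) \<in> M \<rightarrow>\<^sub>M borel" for U
    proof (rule measurable_node_value[OF \<gamma>])
      show "A i \<in> M \<rightarrow>\<^sub>M borel" for i by (rule A)
    next
      fix i
      have [measurable]: "Measurable.pred M (\<lambda>p. i \<in> ?L p)"
        by (rule measurable_in_tree_at[OF \<kappa> T A B])
      show "?x i \<in> M \<rightarrow>\<^sub>M borel" using x by measurable
    qed
    show "(\<lambda>p. if finite (?J p) then ?J p else {}) \<in> M \<rightarrow>\<^sub>M count_space (Collect finite)"
      by (rule measurable_finite_random_set) (rule measurable_in_tree_at[OF \<kappa> T A B])
  qed (rule countable_Collect_finite)
  \<comment> \<open>Sending an infinite tree to \<open>{}\<close> does not change the value: in both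
    cases \<open>node_value\<close> returns its argument at the root.\<close>
  moreover have "tree_value \<gamma> \<kappa> d (T p) (\<lambda>i. A i p) (\<lambda>i. B i p) (\<lambda>i. x i p)
    = node_value \<gamma> (\<lambda>i. A i p) (if finite (?J p) then ?J p else {}) (\<lambda>i. ?x i p) []" for p
  proof (cases "finite (?J p)")
    case False
    then show ?thesis by (simp add: tree_value_def tree_map_def node_value.simps Nil_in_leaves_at)
  qed (simp add: tree_value_def tree_map_def restrict_def)
  ultimately show ?thesis by simp
qed

section \<open>The mean-field equation\<close>

text \<open>Both \<open>g - f\<close> and \<open>g + f\<close> vanish at 0 and have a nonnegative
  derivative, so they are nondecreasing; \<open>c\<close> in the proof is the sign. In the interior
  the derivative within \<open>{0..}\<close> is two-sided, and at 0 continuity suffices.\<close>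

lemma abs_le_by_derivative:
  fixes f g :: "real \<Rightarrow> real"
  assumes f: "\<And>s. 0 \<le> s \<Longrightarrow> (f has_real_derivative f' s) (at s within {0..})"
    and g: "\<And>s. 0 \<le> s \<Longrightarrow> (g has_real_derivative g' s) (at s within {0..})"
    and le: "\<And>s. 0 \<le> s \<Longrightarrow> \<bar>f' s\<bar> \<le> g' s"
    and 0: "f 0 = 0" "g 0 = 0" and t: "0 \<le> t"
  shows "\<bar>f t\<bar> \<le> g t"
proof (cases "t = 0")
  case False
  have nonneg: "0 \<le> g t - c * f t" if c: "c = 1 \<or> c = -1" for c
  proof -
    let ?h = "\<lambda>s. g s - c * f s"
    have h: "(?h has_real_derivative g' s - c * f' s) (at s within {0..})" if "0 \<le> s" for s
      using f[OF that] g[OF that] by (auto intro!: derivative_eq_intros)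
    have "?h 0 \<le> ?h t"
    proof (rule DERIV_nonneg_imp_increasing_open[where f="?h"])
      fix s assume s: "0 < s" "s < t"
      have "at s within {0..} = at s"
        using s by (intro at_within_interior) (simp add: interior_Ici[of _ "-1"])
      then have "(?h has_real_derivative g' s - c * f' s) (at s)" using h[of s] s by simp
      moreover have "0 \<le> g' s - c * f' s" using le[of s] s c by auto
      ultimately show "\<exists>y. (?h has_real_derivative y) (at s) \<and> 0 \<le> y" by blast
    next
      show "continuous_on {0..t} ?h"
        unfolding continuous_on_eq_continuous_within
      proof
        fix s assume "s \<in> {0..t}"
        then have "continuous (at s within {0..}) ?h"
          using h[of s] by (intro DERIV_continuous) auto
        then show "continuous (at s within {0..t}) ?h"
          by (rule continuous_within_subset) auto
      qed
    qed (use t in auto)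
    then show ?thesis using 0 by simp
  qed
  show ?thesis using nonneg[of 1] nonneg[of "-1"] by auto
qed (use 0 in simp)

lemma power_div_fact_tendsto_0: "(\<lambda>n. x ^ n / fact n) \<longlonglongrightarrow> (0::real)"
  using summable_LIMSEQ_zero[OF summable_exp[of x]] by (simp add: field_simps)

text \<open>A non-integrable function has Bochner integral 0, so the bound holds for every function;
  that case is where \<open>0 \<le> B\<close> enters.\<close>

lemma (in prob_space) abs_integral_le_bound:
  fixes f :: "'a \<Rightarrow> real"
  assumes "\<And>x. x \<in> space M \<Longrightarrow> \<bar>f x\<bar> \<le> B" "0 \<le> B"
  shows "\<bar>\<integral>x. f x \<partial>M\<bar> \<le> B"
proof (cases "integrable M f")
  case True
  have "\<bar>\<integral>x. f x \<partial>M\<bar> \<le> (\<integral>x. \<bar>f x\<bar> \<partial>M)" by (rule integral_abs_bound)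
  also have "\<dots> \<le> (\<integral>x. B \<partial>M)"
    using True assms by (intro integral_mono) auto
  finally show ?thesis by (simp add: prob_space)
next
  case False
  then show ?thesis using assms by (simp add: not_integrable_integral_eq)
qed

section \<open>Total variation and the Lipschitz property of \<open>T_map\<close>\<close>

text \<open>With test functions bounded by 1, the least \<open>\<epsilon>\<close> for two Borel
  probability measures is twice the supremum over events. A relation avoids handling that
  supremum.\<close>

definition tv_close :: "real \<Rightarrow> 'a::topological_space measure \<Rightarrow> 'a measure \<Rightarrow> bool" where
  "tv_close \<epsilon> \<nu> \<nu>' \<longleftrightarrow> (\<forall>\<phi> \<in> borel_measurable borel. (\<forall>x. \<bar>\<phi> x\<bar> \<le> 1) \<longrightarrow>
     \<bar>(\<integral>x. \<phi> x \<partial>\<nu>) - (\<integral>x. \<phi> x \<partial>\<nu>')\<bar> \<le> \<epsilon>)"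

lemma tv_close_PiM:
  fixes \<nu> \<nu>' :: "'a::topological_space measure" and h :: "('i \<Rightarrow> 'a) \<Rightarrow> real"
  assumes \<nu>: "prob_space \<nu>" "sets \<nu> = sets borel" and \<nu>': "prob_space \<nu>'" "sets \<nu>' = sets borel"
    and close: "tv_close \<epsilon> \<nu> \<nu>'" and J: "finite J"
    and h: "h \<in> borel_measurable (\<Pi>\<^sub>M i\<in>J. borel)" "\<And>x. \<bar>h x\<bar> \<le> 1"
  shows "\<bar>(\<integral>x. h x \<partial>(\<Pi>\<^sub>M i\<in>J. \<nu>)) - (\<integral>x. h x \<partial>(\<Pi>\<^sub>M i\<in>J. \<nu>'))\<bar> \<le> real (card J) * \<epsilon>"
  using J h
proof (induction J arbitrary: h rule: finite_induct)
  case empty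
  then show ?case by (simp add: PiM_empty)
next
  case (insert i J)
  interpret \<nu>: prob_space \<nu> by fact
  interpret \<nu>': prob_space \<nu>' by fact
  interpret P: product_prob_space "\<lambda>_. \<nu>" UNIV ..
  interpret P': product_prob_space "\<lambda>_. \<nu>'" UNIV ..
  interpret PJ: prob_space "\<Pi>\<^sub>M i\<in>J. \<nu>" by (intro prob_space_PiM \<nu>)
  interpret PJ': prob_space "\<Pi>\<^sub>M i\<in>J. \<nu>'" by (intro prob_space_PiM \<nu>')
  interpret PI: prob_space "\<Pi>\<^sub>M i\<in>insert i J. \<nu>" by (intro prob_space_PiM \<nu>)
  interpret PI': prob_space "\<Pi>\<^sub>M i\<in>insert i J. \<nu>'" by (intro prob_space_PiM \<nu>')
  have setsJ: "sets (\<Pi>\<^sub>M i\<in>K. \<nu>) = sets (\<Pi>\<^sub>M i\<in>K. borel)" "sets (\<Pi>\<^sub>M i\<in>K. \<nu>') = sets (\<Pi>\<^sub>M i\<in>K. borel)" for K :: "'i set"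
    using \<nu> \<nu>' by (auto intro!: sets_PiM_cong)
  note [measurable_cong] = setsJ \<nu>(2) \<nu>'(2)
  note [measurable] = insert.prems(1)
  \<comment> \<open>The coordinate \<open>i\<close> is integrated out under the old and under the
    new law; \<open>?g'\<close> belongs to the hybrid in which only this coordinate has been
    exchanged.\<close>
  let ?g = "\<lambda>x. \<integral>y. h (x(i := y)) \<partial>\<nu>" and ?g' = "\<lambda>x. \<integral>y. h (x(i := y)) \<partial>\<nu>'"
  have upd: "(\<lambda>(x, y). h (x(i := y))) \<in> borel_measurable ((\<Pi>\<^sub>M i\<in>J. borel) \<Otimes>\<^sub>M borel)"
    using measurable_compose[OF measurable_add_dim insert.prems(1)] by (simp add: case_prod_beta)
  then have g: "?g \<in> borel_measurable (\<Pi>\<^sub>M i\<in>J. borel)" and g': "?g' \<in> borel_measurable (\<Pi>\<^sub>M i\<in>J. borel)"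
    by (intro \<nu>.borel_measurable_lebesgue_integral \<nu>'.borel_measurable_lebesgue_integral; simp cong: measurable_cong_sets sets_pair_measure_cong)+
  have gb: "\<bar>?g x\<bar> \<le> 1" "\<bar>?g' x\<bar> \<le> 1" for x
    using insert.prems(2) by (auto intro!: \<nu>.abs_integral_le_bound \<nu>'.abs_integral_le_bound)
  have hi: "(\<integral>x. h x \<partial>(\<Pi>\<^sub>M i\<in>insert i J. \<nu>)) = (\<integral>x. ?g x \<partial>(\<Pi>\<^sub>M i\<in>J. \<nu>))"
    using insert by (intro P.product_integral_insert PI.integrable_const_bound[of _ 1]) auto
  have hi': "(\<integral>x. h x \<partial>(\<Pi>\<^sub>M i\<in>insert i J. \<nu>')) = (\<integral>x. ?g' x \<partial>(\<Pi>\<^sub>M i\<in>J. \<nu>'))"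
    using insert by (intro P'.product_integral_insert PI'.integrable_const_bound[of _ 1]) auto
  have int: "integrable (\<Pi>\<^sub>M i\<in>J. \<nu>) ?g" "integrable (\<Pi>\<^sub>M i\<in>J. \<nu>) ?g'"
    using g g' gb by (auto intro!: PJ.integrable_const_bound[of _ 1])
  have \<epsilon>: "\<bar>?g x - ?g' x\<bar> \<le> \<epsilon>" if x: "x \<in> space (\<Pi>\<^sub>M i\<in>J. \<nu>)" for x
  proof -
    have "(\<lambda>y. h (x(i := y))) \<in> borel_measurable borel"
      using measurable_compose[OF measurable_Pair1'[of x "\<Pi>\<^sub>M i\<in>J. borel"] upd] x sets_eq_imp_space_eq[OF setsJ(1)]
      by simp
    then show ?thesis using close insert.prems(2) by (auto simp: tv_close_def)
  qed
  have "\<bar>(\<integral>x. ?g x \<partial>(\<Pi>\<^sub>M i\<in>J. \<nu>)) - (\<integral>x. ?g' x \<partial>(\<Pi>\<^sub>M i\<in>J. \<nu>))\<bar> = \<bar>\<integral>x. ?g x - ?g' x \<partial>(\<Pi>\<^sub>M i\<in>J. \<nu>)\<bar>"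
    using int by simp
  also have "\<dots> \<le> \<epsilon>"
  proof (rule PJ.abs_integral_le_bound)
    obtain x where "x \<in> space (\<Pi>\<^sub>M i\<in>J. \<nu>)" using PJ.not_empty by blast
    from order_trans[OF abs_ge_zero \<epsilon>[OF this]] show "0 \<le> \<epsilon>" .
  qed (rule \<epsilon>)
  finally have "\<bar>(\<integral>x. ?g x \<partial>(\<Pi>\<^sub>M i\<in>J. \<nu>)) - (\<integral>x. ?g' x \<partial>(\<Pi>\<^sub>M i\<in>J. \<nu>))\<bar> \<le> \<epsilon>" .
  moreover have "\<bar>(\<integral>x. ?g' x \<partial>(\<Pi>\<^sub>M i\<in>J. \<nu>)) - (\<integral>x. ?g' x \<partial>(\<Pi>\<^sub>M i\<in>J. \<nu>'))\<bar> \<le> real (card J) * \<epsilon>"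
    using g' gb(2) by (rule insert.IH)
  moreover have "real (card (insert i J)) * \<epsilon> = \<epsilon> + real (card J) * \<epsilon>"
    using insert by (simp add: algebra_simps)
  ultimately show ?case unfolding hi hi' by linarith
qed

lemma tv_close_0_imp_eq:
  fixes \<nu> \<nu>' :: "'b::topological_space measure"
  assumes \<nu>: "prob_space \<nu>" "sets \<nu> = sets borel" and \<nu>': "prob_space \<nu>'" "sets \<nu>' = sets borel"
    and close: "tv_close 0 \<nu> \<nu>'"
  shows "\<nu> = \<nu>'"
proof (rule measure_eqI)
  interpret \<nu>: prob_space \<nu> by fact
  interpret \<nu>': prob_space \<nu>' by fact
  fix A assume "A \<in> sets \<nu>"
  then have A: "A \<in> sets borel" using \<nu> by simp
  have b: "\<forall>x. \<bar>indicator A x :: real\<bar> \<le> 1" by (simp add: indicator_def)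
  have m: "(indicator A :: _ \<Rightarrow> real) \<in> borel_measurable borel" using A by simp
  have "\<bar>(\<integral>x. indicator A x \<partial>\<nu>) - (\<integral>x. indicator A x \<partial>\<nu>')\<bar> \<le> (0::real)"
    using close[unfolded tv_close_def, THEN bspec, OF m, THEN mp, OF b] .
  then show "emeasure \<nu> A = emeasure \<nu>' A"
    using A \<nu> \<nu>' by (simp add: \<nu>.emeasure_eq_measure \<nu>'.emeasure_eq_measure sets_eq_imp_space_eq[OF \<nu>(2)] sets_eq_imp_space_eq[OF \<nu>'(2)])
qed (use \<nu> \<nu>' in simp)

locale mean_field =
  fixes r :: "'w::polish_space measure"
    and \<gamma> :: "'w \<Rightarrow> (nat \<Rightarrow> 'a::polish_space) \<Rightarrow> 'a"
    and \<kappa> :: "'w \<Rightarrow> nat"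
  assumes r: "finite_measure r" "sets r = sets borel" "emeasure r (space r) \<noteq> 0"
    and \<gamma>_measurable:
      "(\<lambda>(w, x). \<gamma> w x) \<in> borel \<Otimes>\<^sub>M (\<Pi>\<^sub>M k\<in>{1..}. borel) \<rightarrow>\<^sub>M borel"
    and \<kappa>_measurable: "\<kappa> \<in> borel \<rightarrow>\<^sub>M count_space UNIV"
    and \<gamma>_depends:
      "\<And>w x y. x \<in> extensional {1..} \<Longrightarrow> y \<in> extensional {1..} \<Longrightarrow>
         (\<forall>k\<in>{1..\<kappa> w}. x k = y k) \<Longrightarrow> \<gamma> w x = \<gamma> w y"
    and \<kappa>_integrable: "(\<integral>\<^sup>+ w. of_nat (\<kappa> w) \<partial>r) < \<infinity>"
begin

abbreviation "\<Omega> \<equiv> normalized r"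
abbreviation "R \<equiv> mass r"

lemma R_pos: "0 < R"
  using r finite_measure.emeasure_eq_measure[OF r(1), of "space r"]
  by (simp add: zero_less_measure_iff)

lemma sets_\<Omega> [simp, measurable_cong]: "sets \<Omega> = sets borel"
  using r by (simp add: normalized_def)

lemma prob_space_\<Omega>: "prob_space \<Omega>"
proof
  have "emeasure r (space r) \<noteq> \<infinity>" using finite_measure.emeasure_finite[OF r(1)] by simp
  then show "emeasure \<Omega> (space \<Omega>) = 1"
    using r by (simp add: normalized_def space_scale_measure mult.commute top.not_eq_extremum flip: divide_ennreal_def)
qed

sublocale \<Omega>: prob_space \<Omega> by (rule prob_space_\<Omega>)

definition "mean_arity = (\<integral>w. real (\<kappa> w) \<partial>\<Omega>)"

lemma \<kappa>_real_measurable [measurable]: "(\<lambda>w. real (\<kappa> w)) \<in> borel_measurable borel"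
  by (rule measurable_compose[OF \<kappa>_measurable]) simp

lemma integrable_\<kappa>: "integrable \<Omega> (\<lambda>w. real (\<kappa> w))"
proof (rule integrableI_bounded)
  have "(\<integral>\<^sup>+ w. ennreal (norm (real (\<kappa> w))) \<partial>\<Omega>) = inverse (emeasure r (space r)) * (\<integral>\<^sup>+ w. of_nat (\<kappa> w) \<partial>r)"
    unfolding normalized_def using r \<kappa>_measurable
    by (subst nn_integral_scale_measure) (auto simp: ennreal_of_nat_eq_real_of_nat cong: measurable_cong_sets)
  also have "\<dots> < \<infinity>"
  proof -
    have "inverse (emeasure r (space r)) < top"
      using r by (simp flip: top.not_eq_extremum)
    then show ?thesis using \<kappa>_integrable by (simp add: ennreal_mult_less_top)
  qed
  finally show "(\<integral>\<^sup>+ w. ennreal (norm (real (\<kappa> w))) \<partial>\<Omega>) < \<infinity>" .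
qed simp

lemma nn_integral_\<kappa>: "(\<integral>\<^sup>+ w. of_nat (\<kappa> w) \<partial>\<Omega>) = ennreal mean_arity"
  unfolding mean_arity_def
  by (subst nn_integral_eq_integral[symmetric, OF integrable_\<kappa>]) (auto simp: ennreal_of_nat_eq_real_of_nat)

lemma mean_arity_nonneg: "0 \<le> mean_arity"
  by (simp add: mean_arity_def)

lemma \<gamma>_measurable_\<Omega>:
  assumes "sets \<nu> = sets borel"
  shows "(\<lambda>(w, x). \<gamma> w x) \<in> \<Omega> \<Otimes>\<^sub>M (\<Pi>\<^sub>M k\<in>{1..}. \<nu>) \<rightarrow>\<^sub>M borel"
proof -
  have "sets (\<Omega> \<Otimes>\<^sub>M (\<Pi>\<^sub>M k\<in>{1..}. \<nu>)) = sets (borel \<Otimes>\<^sub>M (\<Pi>\<^sub>M k\<in>{1..}. borel))"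
    using assms by (intro sets_pair_measure_cong sets_PiM_cong) auto
  from measurable_cong_sets[OF this refl] show ?thesis using \<gamma>_measurable by blast
qed

lemma integral_T_map:
  fixes \<phi> :: "'a \<Rightarrow> real"
  assumes \<nu>: "prob_space \<nu>" "sets \<nu> = sets borel"
    and \<phi>: "\<phi> \<in> borel_measurable borel" "\<And>x. \<bar>\<phi> x\<bar> \<le> B"
  shows "(\<integral>x. \<phi> x \<partial>T_map r \<gamma> \<nu>) = (\<integral>w. (\<integral>x. \<phi> (\<gamma> w x) \<partial>(\<Pi>\<^sub>M k\<in>{1..}. \<nu>)) \<partial>\<Omega>)"
    and "prob_space (T_map r \<gamma> \<nu>)"
proof -
  interpret P: prob_space "\<Pi>\<^sub>M k\<in>{1::nat..}. \<nu>" by (intro prob_space_PiM \<nu>)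
  interpret PP: pair_prob_space \<Omega> "\<Pi>\<^sub>M k\<in>{1::nat..}. \<nu>" ..
  note m = \<gamma>_measurable_\<Omega>[OF \<nu>(2)]
  have m2: "(\<lambda>p. \<phi> (case p of (w, x) \<Rightarrow> \<gamma> w x)) \<in> borel_measurable (\<Omega> \<Otimes>\<^sub>M (\<Pi>\<^sub>M k\<in>{1..}. \<nu>))"
    by (rule measurable_compose[OF m \<phi>(1)])
  have "(\<integral>x. \<phi> x \<partial>T_map r \<gamma> \<nu>) = (\<integral>p. \<phi> (case p of (w, x) \<Rightarrow> \<gamma> w x) \<partial>(\<Omega> \<Otimes>\<^sub>M (\<Pi>\<^sub>M k\<in>{1..}. \<nu>)))"
    unfolding T_map_def using m \<phi> by (intro integral_distr)
  also have "\<dots> = (\<integral>w. (\<integral>x. \<phi> (\<gamma> w x) \<partial>(\<Pi>\<^sub>M k\<in>{1..}. \<nu>)) \<partial>\<Omega>)"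
  proof -
    have "integrable (\<Omega> \<Otimes>\<^sub>M (\<Pi>\<^sub>M k\<in>{1..}. \<nu>)) (\<lambda>p. \<phi> (case p of (w, x) \<Rightarrow> \<gamma> w x))"
      using m2 \<phi>(2) by (intro PP.integrable_const_bound[of _ B]) auto
    from PP.integral_fst'[OF this] show ?thesis by simp
  qed
  finally show "(\<integral>x. \<phi> x \<partial>T_map r \<gamma> \<nu>) = (\<integral>w. (\<integral>x. \<phi> (\<gamma> w x) \<partial>(\<Pi>\<^sub>M k\<in>{1..}. \<nu>)) \<partial>\<Omega>)" .
  show "prob_space (T_map r \<gamma> \<nu>)"
    unfolding T_map_def by (rule PP.prob_space_distr[OF m])
qed

text \<open>Given \<open>w\<close>, only \<open>\<kappa> w\<close> coordinates enter, so exchanging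
  the law costs at most \<open>\<kappa> w * \<epsilon>\<close>; the average over \<open>w\<close> is
  finite because \<open>\<kappa>\<close> is integrable.\<close>

lemma tv_close_T_map:
  assumes \<nu>: "prob_space \<nu>" "sets \<nu> = sets borel" and \<nu>': "prob_space \<nu>'" "sets \<nu>' = sets borel"
    and close: "tv_close \<epsilon> \<nu> \<nu>'"
  shows "tv_close (mean_arity * \<epsilon>) (T_map r \<gamma> \<nu>) (T_map r \<gamma> \<nu>')"
  unfolding tv_close_def
proof (intro ballI impI)
  fix \<phi> :: "'a \<Rightarrow> real" assume \<phi>[measurable]: "\<phi> \<in> borel_measurable borel" and b: "\<forall>x. \<bar>\<phi> x\<bar> \<le> 1"
  let ?h = "\<lambda>\<nu> w. \<integral>x. \<phi> (\<gamma> w x) \<partial>(\<Pi>\<^sub>M k\<in>{1..}. \<nu>)"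
  have hw: "(\<lambda>x. \<phi> (\<gamma> w x)) \<in> borel_measurable (\<Pi>\<^sub>M k\<in>{1..}. borel)" for w
    using measurable_compose[OF measurable_Pair1'[of w borel] measurable_compose[OF \<gamma>_measurable \<phi>]]
    by simp
  \<comment> \<open>Passage from infinitely many arguments to the first \<open>\<kappa> w\<close>.
    On the finite product \<open>restrict _ {1..}\<close> acts as the identity, entries beyond
    \<open>\<kappa> w\<close> being \<open>undefined\<close>; it makes the embedding into sequences
    visibly measurable.\<close>
  have fin: "?h \<nu> w = (\<integral>x. \<phi> (\<gamma> w (restrict x {1..})) \<partial>(\<Pi>\<^sub>M k\<in>{1..\<kappa> w}. \<nu>)) \<and>
      (\<lambda>x. \<phi> (\<gamma> w (restrict x {1..}))) \<in> borel_measurable (\<Pi>\<^sub>M k\<in>{1..\<kappa> w}. borel)"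
    if \<nu>: "prob_space \<nu>" "sets \<nu> = sets borel" for \<nu> w
  proof
    have sets: "sets (\<Pi>\<^sub>M k\<in>K. \<nu>) = sets (\<Pi>\<^sub>M k\<in>K. borel)" for K :: "nat set"
      using \<nu> by (intro sets_PiM_cong) auto
    have e: "(\<lambda>x. restrict x {1..}) \<in> (\<Pi>\<^sub>M k\<in>{1..\<kappa> w}. borel) \<rightarrow>\<^sub>M (\<Pi>\<^sub>M k\<in>{1..}. borel)"
      by (intro measurable_restrict measurable_component_borel)
    show m: "(\<lambda>x. \<phi> (\<gamma> w (restrict x {1..}))) \<in> borel_measurable (\<Pi>\<^sub>M k\<in>{1..\<kappa> w}. borel)"
      by (rule measurable_compose[OF e hw])
    have "(\<integral>x. \<phi> (\<gamma> w (restrict x {1..})) \<partial>(\<Pi>\<^sub>M k\<in>{1..\<kappa> w}. \<nu>)) =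
      (\<integral>x. \<phi> (\<gamma> w (restrict x {1..})) \<partial>distr (\<Pi>\<^sub>M k\<in>{1..}. \<nu>) (\<Pi>\<^sub>M k\<in>{1..\<kappa> w}. \<nu>) (\<lambda>z. restrict z {1..\<kappa> w}))"
      by (subst distr_PiM_restrict[OF \<nu>(1)]) auto
    also have "\<dots> = (\<integral>x. \<phi> (\<gamma> w (restrict (restrict x {1..\<kappa> w}) {1..})) \<partial>(\<Pi>\<^sub>M k\<in>{1..}. \<nu>))"
      using m by (intro integral_distr measurable_restrict_subset) (auto simp: sets cong: measurable_cong_sets)
    also have "\<dots> = ?h \<nu> w"
      by (intro Bochner_Integration.integral_cong arg_cong[where f=\<phi>] \<gamma>_depends)
        (auto simp: space_PiM PiE_iff)
    finally show "?h \<nu> w = (\<integral>x. \<phi> (\<gamma> w (restrict x {1..})) \<partial>(\<Pi>\<^sub>M k\<in>{1..\<kappa> w}. \<nu>))" ..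
  qed
  have diff: "\<bar>?h \<nu> w - ?h \<nu>' w\<bar> \<le> real (\<kappa> w) * \<epsilon>" for w
  proof -
    have "\<bar>(\<integral>x. \<phi> (\<gamma> w (restrict x {1..})) \<partial>(\<Pi>\<^sub>M k\<in>{1..\<kappa> w}. \<nu>))
        - (\<integral>x. \<phi> (\<gamma> w (restrict x {1..})) \<partial>(\<Pi>\<^sub>M k\<in>{1..\<kappa> w}. \<nu>'))\<bar> \<le> real (card {1..\<kappa> w}) * \<epsilon>"
      using fin[OF \<nu>, of w] b by (intro tv_close_PiM[OF \<nu> \<nu>' close]) auto
    then show ?thesis using fin[OF \<nu>, of w] fin[OF \<nu>', of w] by simp
  qed
  have int: "integrable \<Omega> (?h \<nu>)" if \<nu>: "prob_space \<nu>" "sets \<nu> = sets borel" for \<nu>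
  proof (rule \<Omega>.integrable_const_bound[of _ 1])
    interpret P: prob_space "\<Pi>\<^sub>M k\<in>{1::nat..}. \<nu>" by (intro prob_space_PiM \<nu>)
    show "AE x in \<Omega>. norm (?h \<nu> x) \<le> 1"
      unfolding real_norm_def using b by (intro AE_I2 P.abs_integral_le_bound) auto
    show "?h \<nu> \<in> borel_measurable \<Omega>"
      using measurable_compose[OF \<gamma>_measurable_\<Omega>[OF \<nu>(2)] \<phi>]
      by (intro P.borel_measurable_lebesgue_integral) (simp add: case_prod_beta)
  qed
  have "\<bar>(\<integral>x. \<phi> x \<partial>T_map r \<gamma> \<nu>) - (\<integral>x. \<phi> x \<partial>T_map r \<gamma> \<nu>')\<bar> = \<bar>\<integral>w. ?h \<nu> w - ?h \<nu>' w \<partial>\<Omega>\<bar>"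
    using int[OF \<nu>] int[OF \<nu>'] b
    by (simp add: integral_T_map(1)[OF \<nu> \<phi>, of 1] integral_T_map(1)[OF \<nu>' \<phi>, of 1])
  also have "\<dots> \<le> (\<integral>w. \<bar>?h \<nu> w - ?h \<nu>' w\<bar> \<partial>\<Omega>)" by (rule integral_abs_bound)
  also have "\<dots> \<le> (\<integral>w. real (\<kappa> w) * \<epsilon> \<partial>\<Omega>)"
    using int[OF \<nu>] int[OF \<nu>'] integrable_\<kappa> diff by (intro integral_mono) auto
  also have "\<dots> = mean_arity * \<epsilon>" by (simp add: mean_arity_def)
  finally show "\<bar>(\<integral>x. \<phi> x \<partial>T_map r \<gamma> \<nu>) - (\<integral>x. \<phi> x \<partial>T_map r \<gamma> \<nu>')\<bar> \<le> mean_arity * \<epsilon>" .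
qed

section \<open>Uniqueness of solutions\<close>

text \<open>Each test function is compared separately with an explicit bound, since the supremum
  over test functions need not be differentiable. Feeding a bound for all test functions back into
  the equation integrates it once more in time, which produces the factorial.\<close>

lemma solution_unique:
  assumes m: "solves_mean_field r \<gamma> \<mu> m" and m': "solves_mean_field r \<gamma> \<mu> m'" and t: "0 \<le> t"
  shows "m t = m' t"
proof -
  have p: "prob_space (m s)" "sets (m s) = sets borel" "prob_space (m' s)" "sets (m' s) = sets borel" if "0 \<le> s" for s
    using m m' that by (auto simp: solves_mean_field_def)
  \<comment> \<open>\<open>R\<close> times the Lipschitz constant \<open>mean_arity + 1\<close> of
    \<open>T_map\<close> minus the identity.\<close>
  define L where "L = R * (mean_arity + 1)"
  have close: "tv_close (2 * (L * s) ^ n / fact n) (m s) (m' s)" if s: "0 \<le> s" for n s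
    using s
  proof (induction n arbitrary: s)
    case 0
    interpret A: prob_space "m s" using p 0 by simp
    interpret B: prob_space "m' s" using p 0 by simp
    show ?case unfolding tv_close_def
    proof (intro ballI impI)
      fix \<phi> :: "'a \<Rightarrow> real" assume "\<forall>x. \<bar>\<phi> x\<bar> \<le> 1"
      then have "\<bar>\<integral>x. \<phi> x \<partial>m s\<bar> \<le> 1" "\<bar>\<integral>x. \<phi> x \<partial>m' s\<bar> \<le> 1"
        by (auto intro!: A.abs_integral_le_bound B.abs_integral_le_bound)
      then show "\<bar>(\<integral>x. \<phi> x \<partial>m s) - (\<integral>x. \<phi> x \<partial>m' s)\<bar> \<le> 2 * (L * s) ^ 0 / fact 0" by simp
    qed
  next
    case (Suc n)
    show ?case unfolding tv_close_def
    proof (intro ballI impI)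
      fix \<phi> :: "'a \<Rightarrow> real" assume \<phi>: "\<phi> \<in> borel_measurable borel" and b: "\<forall>x. \<bar>\<phi> x\<bar> \<le> 1"
      have bd: "bounded (range \<phi>)" using b by (auto simp: bounded_iff)
      let ?D = "\<lambda>m s. R * ((\<integral>x. \<phi> x \<partial>T_map r \<gamma> (m s)) - (\<integral>x. \<phi> x \<partial>m s))"
      \<comment> \<open>The bound with \<open>Suc n\<close> is the primitive, vanishing at 0, of
        \<open>L\<close> times the bound with \<open>n\<close>.\<close>
      show "\<bar>(\<integral>x. \<phi> x \<partial>m s) - (\<integral>x. \<phi> x \<partial>m' s)\<bar> \<le> 2 * (L * s) ^ Suc n / fact (Suc n)"
      proof (rule abs_le_by_derivative[where f="\<lambda>s. (\<integral>x. \<phi> x \<partial>m s) - (\<integral>x. \<phi> x \<partial>m' s)" and f'="\<lambda>s. ?D m s - ?D m' s"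
            and g="\<lambda>s. 2 * (L * s) ^ Suc n / fact (Suc n)" and g'="\<lambda>s. L * (2 * (L * s) ^ n / fact n)"])
        fix s :: real assume s: "0 \<le> s"
        have "((\<lambda>s. \<integral>x. \<phi> x \<partial>m s) has_real_derivative ?D m s) (at s within {0..})"
             "((\<lambda>s. \<integral>x. \<phi> x \<partial>m' s) has_real_derivative ?D m' s) (at s within {0..})"
          using m m' \<phi> bd s by (auto simp: solves_mean_field_def Let_def)
        then show "((\<lambda>s. (\<integral>x. \<phi> x \<partial>m s) - (\<integral>x. \<phi> x \<partial>m' s)) has_real_derivative ?D m s - ?D m' s) (at s within {0..})"
          by (rule DERIV_diff)
        have "((\<lambda>s. 2 * L ^ Suc n / fact (Suc n) * s ^ Suc n) has_real_derivative
            2 * L ^ Suc n / fact (Suc n) * (real (Suc n) * s ^ n)) (at s within {0..})"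
          using DERIV_pow[of "Suc n" s "{0..}"] by (intro DERIV_cmult) simp
        moreover have "2 * L ^ Suc n / fact (Suc n) * (real (Suc n) * s ^ n) = L * (2 * (L * s) ^ n / fact n)"
          by (simp add: fact_Suc power_mult_distrib field_simps del: of_nat_Suc)
        ultimately show "((\<lambda>s. 2 * (L * s) ^ Suc n / fact (Suc n)) has_real_derivative L * (2 * (L * s) ^ n / fact n)) (at s within {0..})"
          by (simp add: power_mult_distrib mult.assoc del: power_Suc fact_Suc)
        let ?e = "2 * (L * s) ^ n / fact n"
        note ih = Suc.IH[OF s]
        have "\<bar>(\<integral>x. \<phi> x \<partial>m s) - (\<integral>x. \<phi> x \<partial>m' s)\<bar> \<le> ?e"
          using ih \<phi> b by (auto simp: tv_close_def)
        moreover have "\<bar>(\<integral>x. \<phi> x \<partial>T_map r \<gamma> (m s)) - (\<integral>x. \<phi> x \<partial>T_map r \<gamma> (m' s))\<bar> \<le> mean_arity * ?e"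
          using tv_close_T_map[OF p[OF s] ih] \<phi> b by (auto simp: tv_close_def)
        ultimately have "\<bar>((\<integral>x. \<phi> x \<partial>T_map r \<gamma> (m s)) - (\<integral>x. \<phi> x \<partial>m s)) -
            ((\<integral>x. \<phi> x \<partial>T_map r \<gamma> (m' s)) - (\<integral>x. \<phi> x \<partial>m' s))\<bar> \<le> (mean_arity + 1) * ?e"
          unfolding distrib_right mult_1 by linarith
        then have "R * \<bar>((\<integral>x. \<phi> x \<partial>T_map r \<gamma> (m s)) - (\<integral>x. \<phi> x \<partial>m s)) -
            ((\<integral>x. \<phi> x \<partial>T_map r \<gamma> (m' s)) - (\<integral>x. \<phi> x \<partial>m' s))\<bar> \<le> R * ((mean_arity + 1) * ?e)"
          using R_pos by (intro mult_left_mono) auto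
        then show "\<bar>?D m s - ?D m' s\<bar> \<le> L * ?e"
          using R_pos by (simp add: L_def mult.assoc flip: right_diff_distrib add: abs_mult)
      qed (use m m' Suc.prems in \<open>auto simp: solves_mean_field_def\<close>)
    qed
  qed
  have "tv_close 0 (m t) (m' t)" unfolding tv_close_def
  proof (intro ballI impI)
    fix \<phi> :: "'a \<Rightarrow> real" assume \<phi>: "\<phi> \<in> borel_measurable borel" "\<forall>x. \<bar>\<phi> x\<bar> \<le> 1"
    have "(\<lambda>n. 2 * ((L * t) ^ n / fact n)) \<longlonglongrightarrow> 2 * 0"
      by (intro tendsto_mult tendsto_const power_div_fact_tendsto_0)
    then have "(\<lambda>n. 2 * (L * t) ^ n / fact n) \<longlonglongrightarrow> 0" by simp
    then show "\<bar>(\<integral>x. \<phi> x \<partial>m t) - (\<integral>x. \<phi> x \<partial>m' t)\<bar> \<le> 0"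
      using close[OF t] \<phi> by (intro LIMSEQ_le_const) (auto simp: tv_close_def)
  qed
  then show ?thesis using p[OF t] by (intro tv_close_0_imp_eq) auto
qed


section \<open>From the renewal equation to the differential equation\<close>

text \<open>The equation is written with the integration variable \<open>u = t - s\<close> and the
  factor \<open>exp (- R * t)\<close> in front, so that \<open>t\<close> occurs in the integral only
  as its upper limit and the fundamental theorem applies. In the notation of the proof, the factor
  contributes \<open>- R * F\<close> to the derivative and the upper limit
  \<open>R * \<Psi>\<close>.\<close>

lemma renewal_imp_solution:
  fixes \<nu> :: "real \<Rightarrow> 'a measure"
  assumes \<mu>: "prob_space \<mu>" "sets \<mu> = sets borel"
    and \<nu>: "\<And>t. prob_space (\<nu> t)" "\<And>t. sets (\<nu> t) = sets borel"
    and meas: "\<And>\<phi> :: 'a \<Rightarrow> real. \<phi> \<in> borel_measurable borel \<Longrightarrow> (\<And>x. \<bar>\<phi> x\<bar> \<le> 1) \<Longrightarrow>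
      (\<lambda>u. \<integral>x. \<phi> x \<partial>T_map r \<gamma> (\<nu> u)) \<in> borel_measurable borel"
    and renewal: "\<And>(\<phi> :: 'a \<Rightarrow> real) t. \<phi> \<in> borel_measurable borel \<Longrightarrow> (\<And>x. \<bar>\<phi> x\<bar> \<le> 1) \<Longrightarrow> 0 \<le> t \<Longrightarrow>
      (\<integral>x. \<phi> x \<partial>\<nu> t) = exp (- R * t) * ((\<integral>x. \<phi> x \<partial>\<mu>) +
        (LINT u:{0..t}|lborel. R * exp (R * u) * (\<integral>x. \<phi> x \<partial>T_map r \<gamma> (\<nu> u))))"
  shows "solves_mean_field r \<gamma> \<mu> \<nu>"
proof -
  have T: "prob_space (T_map r \<gamma> (\<nu> u))" for u
    using integral_T_map(2)[OF \<nu>, of "\<lambda>_. 0" 0] by simp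
  define \<Psi> where "\<Psi> \<phi> u = (\<integral>x. \<phi> x \<partial>T_map r \<gamma> (\<nu> u))" for \<phi> :: "'a \<Rightarrow> real" and u
  define w where "w \<phi> u = R * exp (R * u) * \<Psi> \<phi> u" for \<phi> u
  define I where "I \<phi> t = integral {0..t} (w \<phi>)" for \<phi> t
  define F where "F \<phi> t = (\<integral>x. \<phi> x \<partial>\<nu> t)" for \<phi> :: "'a \<Rightarrow> real" and t
  have \<Psi>_le: "\<bar>\<Psi> \<phi> u\<bar> \<le> 1" if "\<And>x. \<bar>\<phi> x\<bar> \<le> 1" for \<phi> u
    unfolding \<Psi>_def by (intro prob_space.abs_integral_le_bound[OF T] that) simp
  have F_le: "\<bar>F \<phi> u\<bar> \<le> 1" if "\<And>x. \<bar>\<phi> x\<bar> \<le> 1" for \<phi> u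
    unfolding F_def by (intro prob_space.abs_integral_le_bound[OF \<nu>(1)] that) simp
  have exp_int: "((\<lambda>u. R * exp (R * u)) has_integral exp (R * t) - exp (R * s)) {s..t}" if "s \<le> t" for s t
    by (rule fundamental_theorem_of_calculus[OF that])
      (auto intro!: derivative_eq_intros simp flip: has_real_derivative_iff_has_vector_derivative)
  have w_int: "set_integrable lborel {0..t} (w \<phi>)"
    if \<phi>: "\<phi> \<in> borel_measurable borel" "\<And>x. \<bar>\<phi> x\<bar> \<le> 1" for \<phi> t
  proof (rule set_integrable_bound[where f="\<lambda>u. R * exp (R * u)"])
    show "set_integrable lborel {0..t} (\<lambda>u. R * exp (R * u))"
      by (intro borel_integrable_atLeastAtMost' continuous_intros)
    have [measurable]: "\<Psi> \<phi> \<in> borel_measurable borel" unfolding \<Psi>_def using meas[OF \<phi>] .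
    show "set_borel_measurable lborel {0..t} (w \<phi>)"
      unfolding set_borel_measurable_def w_def by measurable
    show "AE x in lborel. x \<in> {0..t} \<longrightarrow> norm (w \<phi> x) \<le> norm (R * exp (R * x))"
      using \<Psi>_le[OF \<phi>(2)] R_pos by (auto simp: w_def abs_mult intro!: mult_left_le)
  qed
  have I: "w \<phi> integrable_on {0..t}" "(LINT u:{0..t}|lborel. w \<phi> u) = I \<phi> t"
    if \<phi>: "\<phi> \<in> borel_measurable borel" "\<And>x. \<bar>\<phi> x\<bar> \<le> 1" for \<phi> t
    using set_borel_integral_eq_integral[OF w_int[OF \<phi>]] by (auto simp: I_def)
  have F_eq: "F \<phi> t = exp (- R * t) * ((\<integral>x. \<phi> x \<partial>\<mu>) + I \<phi> t)"
    if \<phi>: "\<phi> \<in> borel_measurable borel" "\<And>x. \<bar>\<phi> x\<bar> \<le> 1" and t: "0 \<le> t" for \<phi> t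
    using renewal[OF \<phi> t] I(2)[OF \<phi>, of t] unfolding F_def w_def \<Psi>_def by simp
  \<comment> \<open>As \<open>\<Psi>\<close> is bounded by 1, the increments of \<open>I\<close> are
    dominated by those of \<open>exp (R * t)\<close>, a primitive of the weight.\<close>
  have I_diff: "\<bar>I \<phi> t - I \<phi> s\<bar> \<le> exp (R * t) - exp (R * s)"
    if \<phi>: "\<phi> \<in> borel_measurable borel" "\<And>x. \<bar>\<phi> x\<bar> \<le> 1" and st: "0 \<le> s" "s \<le> t" for \<phi> s t
  proof -
    have "I \<phi> t - I \<phi> s = integral {s..t} (w \<phi>)"
      using Henstock_Kurzweil_Integration.integral_combine[OF st I(1)[OF \<phi>]] by (simp add: I_def)
    also have "norm \<dots> \<le> integral {s..t} (\<lambda>u. R * exp (R * u))"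
    proof (rule integral_norm_bound_integral)
      show "w \<phi> integrable_on {s..t}"
        using I(1)[OF \<phi>, of t] by (rule integrable_on_subinterval) (use st in auto)
      show "(\<lambda>u. R * exp (R * u)) integrable_on {s..t}" using exp_int[OF st(2)] by blast
      show "norm (w \<phi> x) \<le> R * exp (R * x)" for x
        using \<Psi>_le[OF \<phi>(2)] R_pos by (auto simp: w_def abs_mult intro!: mult_left_le)
    qed
    also have "\<dots> = exp (R * t) - exp (R * s)" using exp_int[OF st(2)] by (rule integral_unique)
    finally show ?thesis by simp
  qed
  \<comment> \<open>Both the damping of the past and the new contribution amount to at most
    \<open>1 - exp (- R * (t - s))\<close>, and \<open>1 - exp (- x) \<le> x\<close> gives the
    factor \<open>2 * R\<close>.\<close>
  have close: "tv_close (2 * R * (t - s)) (\<nu> t) (\<nu> s)" if st: "0 \<le> s" "s \<le> t" for s t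
    unfolding tv_close_def
  proof (intro ballI impI)
    fix \<phi> :: "'a \<Rightarrow> real" assume "\<phi> \<in> borel_measurable borel" "\<forall>x. \<bar>\<phi> x\<bar> \<le> 1"
    then have \<phi>: "\<phi> \<in> borel_measurable borel" "\<And>x. \<bar>\<phi> x\<bar> \<le> 1" by auto
    let ?e = "exp (- R * (t - s))"
    have e: "exp (- R * t) = ?e * exp (- R * s)"
      by (simp add: algebra_simps flip: exp_add)
    have e1: "exp (- R * t) * (exp (R * t) - exp (R * s)) = 1 - ?e"
      by (simp add: algebra_simps flip: exp_add)
    have "F \<phi> t - F \<phi> s = exp (- R * t) * (I \<phi> t - I \<phi> s) - (1 - ?e) * F \<phi> s"
      unfolding F_eq[OF \<phi> order_trans[OF st]] F_eq[OF \<phi> st(1)] e by (simp add: algebra_simps)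
    also have "\<bar>\<dots>\<bar> \<le> \<bar>exp (- R * t) * (I \<phi> t - I \<phi> s)\<bar> + \<bar>(1 - ?e) * F \<phi> s\<bar>" by simp
    also have "\<bar>exp (- R * t) * (I \<phi> t - I \<phi> s)\<bar> \<le> 1 - ?e"
      unfolding abs_mult e1[symmetric] using I_diff[OF \<phi> st] by (simp add: mult_left_mono)
    also have "\<bar>(1 - ?e) * F \<phi> s\<bar> \<le> 1 - ?e"
    proof -
      have "?e \<le> 1" using R_pos st by simp
      then have "\<bar>1 - ?e\<bar> = 1 - ?e" by simp
      then show ?thesis
        unfolding abs_mult using F_le[OF \<phi>(2)] \<open>?e \<le> 1\<close> by (simp add: mult_left_le)
    qed
    also have "1 - ?e + (1 - ?e) \<le> 2 * R * (t - s)"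
      using exp_ge_add_one_self[of "- R * (t - s)"] by simp
    finally show "\<bar>(\<integral>x. \<phi> x \<partial>\<nu> t) - (\<integral>x. \<phi> x \<partial>\<nu> s)\<bar> \<le> 2 * R * (t - s)"
      by (simp add: F_def)
  qed
  \<comment> \<open>Continuity of the integrand, so far only measurable, follows from the time
    regularity just shown and the Lipschitz property of \<open>T_map\<close>.\<close>
  have \<Psi>_cont: "continuous_on {0..} (\<Psi> \<phi>)"
    if \<phi>: "\<phi> \<in> borel_measurable borel" "\<And>x. \<bar>\<phi> x\<bar> \<le> 1" for \<phi>
  proof -
    let ?L = "mean_arity * (2 * R)"
    have *: "\<bar>\<Psi> \<phi> t - \<Psi> \<phi> s\<bar> \<le> ?L * (t - s)" if "0 \<le> s" "s \<le> t" for s t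
      using tv_close_T_map[OF \<nu> \<nu> close[OF that]] \<phi> by (auto simp: tv_close_def \<Psi>_def mult.assoc)
    have "?L-lipschitz_on {0..} (\<Psi> \<phi>)"
    proof (rule lipschitz_onI)
      fix s t :: real assume st: "s \<in> {0..}" "t \<in> {0..}"
      show "dist (\<Psi> \<phi> s) (\<Psi> \<phi> t) \<le> ?L * dist s t"
        using *[of s t] *[of t s] st by (cases "s \<le> t") (auto simp: dist_real_def abs_minus_commute)
    qed (use mean_arity_nonneg R_pos in simp)
    then show ?thesis by (rule lipschitz_on_continuous_on)
  qed
  have deriv: "(F \<phi> has_real_derivative R * (\<Psi> \<phi> t - F \<phi> t)) (at t within {0..})"
    if \<phi>: "\<phi> \<in> borel_measurable borel" "\<And>x. \<bar>\<phi> x\<bar> \<le> 1" and t: "0 \<le> t" for \<phi> t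
  proof -
    \<comment> \<open>The interval reaches beyond \<open>t\<close>, so that near \<open>t\<close> it
      coincides with \<open>{0..}\<close> and the derivative within \<open>{0..}\<close> results,
      one-sided at 0.\<close>
    have "continuous_on {0..t+1} (w \<phi>)"
      unfolding w_def by (intro continuous_intros continuous_on_subset[OF \<Psi>_cont[OF \<phi>]]) auto
    then have "(I \<phi> has_real_derivative w \<phi> t) (at t within {0..t+1})"
      unfolding I_def using t by (intro integral_has_real_derivative) auto
    moreover have "at t within {0..t+1} = at t within {0..}"
      by (rule at_within_nhd[of t "{..<t+1}"]) auto
    ultimately have dI: "(I \<phi> has_real_derivative w \<phi> t) (at t within {0..})" by simp
    have "((\<lambda>t. exp (- R * t) * ((\<integral>x. \<phi> x \<partial>\<mu>) + I \<phi> t)) has_real_derivative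
        exp (- R * t) * (- R) * ((\<integral>x. \<phi> x \<partial>\<mu>) + I \<phi> t) + exp (- R * t) * w \<phi> t) (at t within {0..})"
      by (rule derivative_eq_intros dI refl | simp)+
    moreover have "exp (- R * t) * (- R) * ((\<integral>x. \<phi> x \<partial>\<mu>) + I \<phi> t) + exp (- R * t) * w \<phi> t = R * (\<Psi> \<phi> t - F \<phi> t)"
      unfolding F_eq[OF \<phi> t] w_def by (simp add: algebra_simps exp_minus_inverse flip: exp_add)
    ultimately have d: "((\<lambda>t. exp (- R * t) * ((\<integral>x. \<phi> x \<partial>\<mu>) + I \<phi> t)) has_real_derivative
        R * (\<Psi> \<phi> t - F \<phi> t)) (at t within {0..})" by simp
    show ?thesis
      by (rule has_field_derivative_transform_within[OF d zero_less_one]) (use t F_eq[OF \<phi>] in auto)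
  qed
  have "\<nu> 0 = \<mu>"
  proof (rule tv_close_0_imp_eq[OF \<nu> \<mu>])
    show "tv_close 0 (\<nu> 0) \<mu>"
      unfolding tv_close_def
    proof (intro ballI impI)
      fix \<phi> :: "'a \<Rightarrow> real" assume "\<phi> \<in> borel_measurable borel" "\<forall>x. \<bar>\<phi> x\<bar> \<le> 1"
      then have "F \<phi> 0 = exp (- R * 0) * ((\<integral>x. \<phi> x \<partial>\<mu>) + I \<phi> 0)"
        by (intro F_eq) auto
      also have "\<dots> = (\<integral>x. \<phi> x \<partial>\<mu>)" by (simp add: I_def)
      finally have "F \<phi> 0 = (\<integral>x. \<phi> x \<partial>\<mu>)" .
      then show "\<bar>(\<integral>x. \<phi> x \<partial>\<nu> 0) - (\<integral>x. \<phi> x \<partial>\<mu>)\<bar> \<le> 0" by (simp add: F_def)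
    qed
  qed
  moreover have "\<forall>t\<ge>0. (F \<phi> has_real_derivative R * (\<Psi> \<phi> t - F \<phi> t)) (at t within {0..})"
    "continuous_on {0..} (\<lambda>t. R * (\<Psi> \<phi> t - F \<phi> t))"
    if \<phi>: "\<phi> \<in> borel_measurable borel" "bounded (range \<phi>)" for \<phi>
  proof -
    \<comment> \<open>A general bounded test function is scaled into the unit ball, where the
      equation is available.\<close>
    obtain B where B: "0 < B" "\<And>x. \<bar>\<phi> x\<bar> \<le> B"
      using \<phi>(2) unfolding bounded_pos real_norm_def by blast
    define \<phi>' where "\<phi>' x = \<phi> x / B" for x
    have \<phi>': "\<phi>' \<in> borel_measurable borel" "\<And>x. \<bar>\<phi>' x\<bar> \<le> 1"
      using \<phi> B by (auto simp: \<phi>'_def[abs_def])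
    have "\<phi> = (\<lambda>x. B * \<phi>' x)"
      by (rule ext) (use B(1) in \<open>simp add: \<phi>'_def\<close>)
    then have scale: "F \<phi> = (\<lambda>t. B * F \<phi>' t)" "\<Psi> \<phi> = (\<lambda>t. B * \<Psi> \<phi>' t)"
      by (auto simp: F_def \<Psi>_def fun_eq_iff)
    show *: "\<forall>t\<ge>0. (F \<phi> has_real_derivative R * (\<Psi> \<phi> t - F \<phi> t)) (at t within {0..})"
    proof (intro allI impI)
      fix t :: real assume "0 \<le> t"
      from DERIV_cmult[OF deriv[OF \<phi>' this], of B]
      show "(F \<phi> has_real_derivative R * (\<Psi> \<phi> t - F \<phi> t)) (at t within {0..})"
        unfolding scale by (simp add: algebra_simps)
    qed
    have "continuous_on {0..} (F \<phi>)"
      unfolding continuous_on_eq_continuous_within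
      by (intro ballI DERIV_continuous[OF *[rule_format]]) simp
    moreover have "continuous_on {0..} (\<Psi> \<phi>)"
      unfolding scale by (intro continuous_intros \<Psi>_cont \<phi>')
    ultimately show "continuous_on {0..} (\<lambda>t. R * (\<Psi> \<phi> t - F \<phi> t))"
      by (intro continuous_intros)
  qed
  ultimately show ?thesis
    using \<nu> unfolding solves_mean_field_def Let_def F_def \<Psi>_def by auto
qed

end

section \<open>The branching process on a canonical space\<close>

locale branching = mean_field r \<gamma> \<kappa>
  for r :: "'w::polish_space measure"
    and \<gamma> :: "'w \<Rightarrow> (nat \<Rightarrow> 'a::polish_space) \<Rightarrow> 'a"
    and \<kappa> :: "'w \<Rightarrow> nat" +
  fixes \<mu> :: "'a measure"
  assumes \<mu>: "prob_space \<mu>" "sets \<mu> = sets borel"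
begin

definition E :: "real measure" where "E = density lborel (exponential_density R)"
text \<open>The law of the label of one node. Every node carries a value, although only those of
  alive nodes enter the tree map; this keeps the labels i.i.d. over all words.\<close>

definition N :: "(real \<times> 'a \<times> 'w) measure" where "N = E \<Otimes>\<^sub>M (\<mu> \<Otimes>\<^sub>M \<Omega>)"
definition P :: "(nat list \<Rightarrow> real \<times> 'a \<times> 'w) measure" where "P = (\<Pi>\<^sub>M i\<in>UNIV. N)"
abbreviation Q :: "(nat \<Rightarrow> nat list \<Rightarrow> real \<times> 'a \<times> 'w) measure" where "Q \<equiv> (\<Pi>\<^sub>M k\<in>UNIV. P)"

definition root_value :: "real \<Rightarrow> (nat list \<Rightarrow> real \<times> 'a \<times> 'w) \<Rightarrow> 'a" where
  "root_value t y = tree_value \<gamma> \<kappa> \<infinity> t (\<lambda>i. snd (snd (y i))) (\<lambda>i. fst (y i)) (\<lambda>i. fst (snd (y i)))"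

definition dead :: "real \<Rightarrow> (nat list \<Rightarrow> real \<times> 'a \<times> 'w) \<Rightarrow> nat list set" where
  "dead t y = tree_at \<infinity> \<kappa> t (\<lambda>i. snd (snd (y i))) (\<lambda>i. fst (y i))"

definition law :: "real \<Rightarrow> 'a measure" where
  "law t = distr P borel (root_value t)"

sublocale \<mu>: prob_space \<mu> by (rule \<mu>)

sublocale E: prob_space E
  unfolding E_def by (rule prob_space_exponential_density[OF R_pos])

sublocale M\<Omega>: pair_prob_space \<mu> \<Omega> ..

sublocale EN: pair_prob_space E "\<mu> \<Otimes>\<^sub>M \<Omega>" ..

lemma prob_space_N: "prob_space N"
  unfolding N_def by (rule EN.prob_space_axioms)

sublocale P: prob_space P
  unfolding P_def by (intro prob_space_PiM prob_space_N)

lemma prob_space_Q: "prob_space Q"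
  by (intro prob_space_PiM P.prob_space_axioms)

sublocale NQ: pair_prob_space N Q
  by (intro pair_prob_space.intro pair_sigma_finite.intro prob_space_N prob_space_Q prob_space_imp_sigma_finite)

lemma sets_E [simp, measurable_cong]: "sets E = sets borel"
  by (simp add: E_def)

lemma space_E [simp]: "space E = UNIV"
  by (simp add: E_def)

lemma sets_N: "sets N = sets (borel \<Otimes>\<^sub>M (borel \<Otimes>\<^sub>M borel))"
  unfolding N_def by (intro sets_pair_measure_cong \<mu> sets_\<Omega> sets_E)

lemma measurable_components [measurable]:
  "(\<lambda>n. fst n) \<in> N \<rightarrow>\<^sub>M borel" "(\<lambda>n. fst (snd n)) \<in> N \<rightarrow>\<^sub>M borel" "(\<lambda>n. snd (snd n)) \<in> N \<rightarrow>\<^sub>M borel"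
  using sets_N by (auto cong: measurable_cong_sets)

lemma measurable_coordinate: "f \<in> N \<rightarrow>\<^sub>M borel \<Longrightarrow> (\<lambda>y. f (y i)) \<in> P \<rightarrow>\<^sub>M borel"
  unfolding P_def by (rule measurable_compose[OF measurable_component_singleton]) simp_all

lemma measurable_root_value [measurable]:
  "(\<lambda>(t, y). root_value t y) \<in> borel \<Otimes>\<^sub>M P \<rightarrow>\<^sub>M borel"
  unfolding root_value_def case_prod_beta
  by (intro measurable_tree_value[OF \<gamma>_measurable \<kappa>_measurable] measurable_fst
    measurable_compose[OF measurable_snd measurable_coordinate] measurable_components)

lemma measurable_root_value_at [measurable]: "root_value t \<in> P \<rightarrow>\<^sub>M borel"
  using measurable_compose[OF measurable_Pair1'[of t borel P] measurable_root_value] by simp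

lemma measurable_dead: "Measurable.pred P (\<lambda>y. i \<in> dead t y)"
  unfolding dead_def
  by (intro measurable_in_tree_at[OF \<kappa>_measurable] measurable_coordinate measurable_components) simp

lemma measurable_finite_dead [measurable]: "Measurable.pred P (\<lambda>y. finite (dead t y))"
  by (rule measurable_finite_random_set(2)[OF measurable_dead])

lemma prob_space_law: "prob_space (law t)"
  unfolding law_def by (intro P.prob_space_distr) simp

lemma sets_law [simp]: "sets (law t) = sets borel"
  by (simp add: law_def)

lemma join_measurable [measurable]: "join_trees \<in> N \<Otimes>\<^sub>M Q \<rightarrow>\<^sub>M P"
  unfolding P_def by (rule measurable_join_trees)

lemma distr_join: "distr (N \<Otimes>\<^sub>M Q) P join_trees = P"
  unfolding P_def by (rule distr_join_trees[OF prob_space_N])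

section \<open>Almost sure finiteness of the set of dead nodes\<close>

lemma AE_nonneg: "AE y in P. \<forall>i. 0 \<le> fst (y i)"
proof -
  have "AE s in E. 0 \<le> s"
    unfolding E_def by (subst AE_density) (auto simp: exponential_density_def)
  then have "AE n in N. 0 \<le> fst n"
  proof -
    have "{n \<in> space N. 0 \<le> fst n} \<in> sets N" by measurable
    with \<open>AE s in E. 0 \<le> s\<close> show ?thesis
      unfolding N_def by (intro EN.AE_pair_measure) auto
  qed
  then have "AE y in P. 0 \<le> fst (y i)" for i
    unfolding P_def by (intro AE_PiM_component prob_space_N) auto
  then show ?thesis by (simp add: AE_all_countable)
qed

lemma AE_N_Q:
  assumes "AE y in P. B y"
  shows "AE n in N. AE z in Q. B (join_trees (n, z))"
proof -
  have "AE p in N \<Otimes>\<^sub>M Q. B (join_trees p)"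
    using assms by (intro AE_distrD[OF join_measurable]) (unfold distr_join)
  then show ?thesis by (rule NQ.AE_pair)
qed

text \<open>Nonnegative lifetimes are needed here: otherwise descendants of a node that is still alive
  could belong to \<open>dead\<close>.\<close>

lemma emeasure_infinite_dead_le:
  assumes "0 \<le> t"
  shows "emeasure P {y \<in> space P. infinite (dead t y)} \<le> ennreal ((R * mean_arity * t) ^ n / fact n)"
  using assms
proof (induction n arbitrary: t)
  case 0
  then show ?case using P.emeasure_le_1 by simp
next
  case (Suc n)
  let ?K = "R * mean_arity"
  define A where "A t = {y \<in> space P. infinite (dead t y)}" for t
  have A [measurable]: "A t \<in> sets P" for t unfolding A_def by measurable
  \<comment> \<open>The bound of the induction hypothesis at the time \<open>t - s\<close> left to
    the children when the root dies at \<open>s\<close>.\<close>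
  let ?c = "\<lambda>s. (?K * (t - s)) ^ n / fact n"
  let ?h = "\<lambda>s. ennreal (?c s) * indicator {0..t} s"
  \<comment> \<open>Given the root label, an infinite tree forces an infinite tree below some child.
    The union bound over the \<open>\<kappa>\<close> children, each distributed like the whole,
    gives the factor.\<close>
  have inner: "(\<integral>\<^sup>+z. indicator (A t) (join_trees (m, z)) \<partial>Q) \<le> ?h (fst m) * of_nat (\<kappa> (snd (snd m)))"
    if m: "AE z in Q. \<forall>i. 0 \<le> fst (join_trees (m, z) i)" "m \<in> space N" for m
  proof (cases "fst m \<in> {0..t}")
    case True
    let ?s = "fst m" and ?k = "\<kappa> (snd (snd m))"
    have "(\<integral>\<^sup>+z. indicator (A t) (join_trees (m, z)) \<partial>Q) \<le> (\<integral>\<^sup>+z. (\<Sum>k\<in>{1..?k}. indicator (A (t - ?s)) (z k)) \<partial>Q)"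
    proof (rule nn_integral_mono_AE)
      show "AE z in Q. indicator (A t) (join_trees (m, z)) \<le> (\<Sum>k\<in>{1..?k}. indicator (A (t - ?s)) (z k) :: ennreal)"
        using m(1) AE_space
      proof eventually_elim
        case (elim z)
        show ?case
        proof (cases "join_trees (m, z) \<in> A t")
          case True
          then obtain k where k: "k \<in> {1..?k}" "infinite (dead (t - ?s) (z k))"
            using infinite_tree_atD[of \<kappa> t "\<lambda>i. snd (snd (join_trees (m, z) i))" "\<lambda>i. fst (join_trees (m, z) i)"] elim
            by (auto simp: A_def dead_def)
          have "z k \<in> space P" using elim by (auto simp: space_PiM)
          then have "z k \<in> A (t - ?s)" using k by (simp add: A_def)
          then have "1 \<le> (indicator (A (t - ?s)) (z k) :: ennreal)" by simp
          also have "\<dots> \<le> (\<Sum>k\<in>{1..?k}. indicator (A (t - ?s)) (z k))"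
            using k(1) by (intro member_le_sum) auto
          finally show ?thesis by (simp add: indicator_def)
        qed simp
      qed
    qed
    also have "\<dots> = (\<Sum>k\<in>{1..?k}. \<integral>\<^sup>+z. indicator (A (t - ?s)) (z k) \<partial>Q)"
      by (rule nn_integral_sum) measurable
    also have "\<dots> = (\<Sum>k\<in>{1..?k}. emeasure P (A (t - ?s)))"
    proof (rule sum.cong[OF refl])
      fix k
      have "(\<integral>\<^sup>+z. indicator (A (t - ?s)) (z k) \<partial>Q) = (\<integral>\<^sup>+y. indicator (A (t - ?s)) y \<partial>distr Q P (\<lambda>z. z k))"
        by (subst nn_integral_distr) auto
      also have "distr Q P (\<lambda>z. z k) = P"
        by (intro distr_PiM_component P.prob_space_axioms) auto
      finally show "(\<integral>\<^sup>+z. indicator (A (t - ?s)) (z k) \<partial>Q) = emeasure P (A (t - ?s))" by simp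
    qed
    also have "\<dots> = of_nat ?k * emeasure P (A (t - ?s))" by simp
    also have "\<dots> \<le> of_nat ?k * ennreal (?c ?s)"
      using Suc.IH[of "t - ?s"] True by (intro mult_left_mono) (auto simp: A_def)
    finally show ?thesis using True by (simp add: mult.commute)
  next
    case False
    \<comment> \<open>Negative lifetimes are excluded by the hypothesis on \<open>m\<close>, so here
      the root outlives \<open>t\<close> and the tree cannot be infinite.\<close>
    have "AE z in Q. join_trees (m, z) \<notin> A t"
      using m(1)
    proof eventually_elim
      case (elim z)
      then have "0 \<le> fst m" by (metis join_trees.simps(1))
      then show ?case
        using infinite_tree_atD[of \<kappa> t "\<lambda>i. snd (snd (join_trees (m, z) i))" "\<lambda>i. fst (join_trees (m, z) i)"] elim False
        by (auto simp: A_def dead_def)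
    qed
    then have "(\<integral>\<^sup>+z. indicator (A t) (join_trees (m, z)) \<partial>Q) = (\<integral>\<^sup>+z. 0 \<partial>Q)"
      by (intro nn_integral_cong_AE) auto
    then show ?thesis by simp
  qed
  have K: "0 \<le> ?K" using R_pos mean_arity_nonneg by simp
  have "emeasure P (A t) = (\<integral>\<^sup>+y. indicator (A t) y \<partial>distr (N \<Otimes>\<^sub>M Q) P join_trees)"
    by (simp add: distr_join)
  also have "\<dots> = (\<integral>\<^sup>+p. indicator (A t) (join_trees p) \<partial>(N \<Otimes>\<^sub>M Q))"
    by (intro nn_integral_distr) auto
  also have "\<dots> = (\<integral>\<^sup>+m. \<integral>\<^sup>+z. indicator (A t) (join_trees (m, z)) \<partial>Q \<partial>N)"
    by (intro NQ.M2.nn_integral_fst[symmetric]) measurable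
  also have "\<dots> \<le> (\<integral>\<^sup>+m. ?h (fst m) * of_nat (\<kappa> (snd (snd m))) \<partial>N)"
  proof (rule nn_integral_mono_AE)
    show "AE m in N. (\<integral>\<^sup>+z. indicator (A t) (join_trees (m, z)) \<partial>Q) \<le> ?h (fst m) * of_nat (\<kappa> (snd (snd m)))"
      using AE_N_Q[OF AE_nonneg] AE_space
    proof eventually_elim
      case (elim m)
      then show ?case by (rule inner)
    qed
  qed
  also have "\<dots> = (\<integral>\<^sup>+s. \<integral>\<^sup>+x. \<integral>\<^sup>+w. ?h s * of_nat (\<kappa> w) \<partial>\<Omega> \<partial>\<mu> \<partial>E)"
  proof -
    have [measurable]: "(\<lambda>w. of_nat (\<kappa> w) :: ennreal) \<in> borel_measurable borel"
      by (rule measurable_compose[OF \<kappa>_measurable]) simp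
    have "(\<lambda>m. ?h (fst m) * of_nat (\<kappa> (snd (snd m)))) \<in> borel_measurable (E \<Otimes>\<^sub>M (\<mu> \<Otimes>\<^sub>M \<Omega>))"
      by measurable
    then have "(\<integral>\<^sup>+m. ?h (fst m) * of_nat (\<kappa> (snd (snd m))) \<partial>N) = (\<integral>\<^sup>+s. \<integral>\<^sup>+q. ?h s * of_nat (\<kappa> (snd q)) \<partial>(\<mu> \<Otimes>\<^sub>M \<Omega>) \<partial>E)"
      unfolding N_def by (subst M\<Omega>.P.nn_integral_fst[symmetric]) auto
    also have "\<dots> = (\<integral>\<^sup>+s. \<integral>\<^sup>+x. \<integral>\<^sup>+w. ?h s * of_nat (\<kappa> w) \<partial>\<Omega> \<partial>\<mu> \<partial>E)"
      by (intro nn_integral_cong, subst \<Omega>.nn_integral_fst[symmetric]) auto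
    finally show ?thesis .
  qed
  also have "\<dots> = (\<integral>\<^sup>+s. ?h s * ennreal mean_arity \<partial>E)"
    using \<kappa>_measurable by (simp add: nn_integral_cmult nn_integral_\<kappa> \<mu>.emeasure_space_1 mult.assoc cong: measurable_cong_sets)
  also have "\<dots> = (\<integral>\<^sup>+s. ennreal (exponential_density R s) * (?h s * ennreal mean_arity) \<partial>lborel)"
    unfolding E_def by (subst nn_integral_density) auto
  \<comment> \<open>The exponential density is bounded by its value \<open>R\<close> at 0, which
    leaves a polynomial in \<open>t - s\<close> that integrates to the next term.\<close>
  also have "\<dots> \<le> (\<integral>\<^sup>+s. ennreal (?K * ?c s) * indicator {0..t} s \<partial>lborel)"
  proof (rule nn_integral_mono)
    fix s :: real
    show "ennreal (exponential_density R s) * (?h s * ennreal mean_arity) \<le> ennreal (?K * ?c s) * indicator {0..t} s"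
    proof (cases "s \<in> {0..t}")
      case True
      have c: "0 \<le> ?c s" using K True by simp
      have "exponential_density R s \<le> R"
        using R_pos True by (simp add: exponential_density_def)
      then have "exponential_density R s * (?c s * mean_arity) \<le> R * (?c s * mean_arity)"
        by (rule mult_right_mono[OF _ mult_nonneg_nonneg[OF c mean_arity_nonneg]])
      moreover have "0 \<le> (?K * (t - s)) ^ n * mean_arity / fact n"
        using mult_nonneg_nonneg[OF c mean_arity_nonneg] by simp
      ultimately show ?thesis
        using True c mean_arity_nonneg exponential_density_nonneg[OF R_pos, of s]
        by (simp add: mult_ac flip: ennreal_mult)
    qed simp
  qed
  also have "\<dots> = ennreal (- ((?K * (t - t)) ^ Suc n / fact (Suc n)) - (- ((?K * (t - 0)) ^ Suc n / fact (Suc n))))"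
  proof (rule nn_integral_FTC_Icc[where F="\<lambda>s. - ((?K * (t - s)) ^ Suc n / fact (Suc n))" and f="\<lambda>s. ?K * ?c s"])
    fix s assume s: "s \<in> {0..t}"
    have "((\<lambda>s. - ((?K * (t - s)) ^ Suc n / fact (Suc n))) has_real_derivative
        - ((real (Suc n) * (?K * (t - s)) ^ n * (- ?K)) / fact (Suc n))) (at s)"
      by (rule derivative_eq_intros refl | simp del: power_Suc fact_Suc of_nat_Suc)+
    moreover have "- ((real (Suc n) * (?K * (t - s)) ^ n * (- ?K)) / fact (Suc n)) = ?K * ?c s"
      by (simp add: field_simps fact_Suc del: of_nat_Suc)
    ultimately show "((\<lambda>s. - ((?K * (t - s)) ^ Suc n / fact (Suc n))) has_real_derivative ?K * ?c s) (at s)"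
      by (simp only:)
    show "0 \<le> ?K * ?c s" using K s by simp
  qed (use Suc.prems in auto)
  finally show ?case by (simp add: A_def)
qed

lemma AE_finite_dead:
  assumes "0 \<le> t"
  shows "AE y in P. finite (dead t y)"
proof -
  let ?e = "emeasure P {y \<in> space P. infinite (dead t y)}"
  have "(\<lambda>n. ennreal ((R * mean_arity * t) ^ n / fact n)) \<longlonglongrightarrow> ennreal 0"
    by (intro tendsto_ennrealI power_div_fact_tendsto_0)
  then have "?e \<le> ennreal 0"
    using emeasure_infinite_dead_le[OF assms] by (intro LIMSEQ_le_const) auto
  then have "?e = 0" by simp
  then show ?thesis by (subst AE_iff_measurable[OF _ refl]) auto
qed


section \<open>Decomposition at the root and the renewal equation\<close>

text \<open>\<open>join_trees\<close> attaches a copy also to the letter 0; the restriction discards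
  it.\<close>

definition child_values :: "real \<Rightarrow> (nat \<Rightarrow> nat list \<Rightarrow> real \<times> 'a \<times> 'w) \<Rightarrow> nat \<Rightarrow> 'a" where
  "child_values u z = (\<lambda>k\<in>{1..}. root_value u (z k))"

lemma measurable_child_values [measurable]:
  "(\<lambda>(u, z). child_values u z) \<in> borel \<Otimes>\<^sub>M Q \<rightarrow>\<^sub>M (\<Pi>\<^sub>M k\<in>{1..}. borel)"
  unfolding child_values_def case_prod_beta
proof (rule measurable_restrict)
  fix k :: nat
  have "(\<lambda>p. (fst p, snd p k)) \<in> borel \<Otimes>\<^sub>M Q \<rightarrow>\<^sub>M borel \<Otimes>\<^sub>M P" by measurable
  from measurable_compose[OF this measurable_root_value]
  show "(\<lambda>p. root_value (fst p) (snd p k)) \<in> borel \<Otimes>\<^sub>M Q \<rightarrow>\<^sub>M borel" by simp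
qed

lemma measurable_child_values_at [measurable]: "child_values u \<in> Q \<rightarrow>\<^sub>M (\<Pi>\<^sub>M k\<in>{1..}. borel)"
  using measurable_compose[OF measurable_Pair1'[of u borel Q] measurable_child_values] by simp

lemma distr_child_values: "distr Q (\<Pi>\<^sub>M k\<in>{1..}. borel) (child_values u) = (\<Pi>\<^sub>M k\<in>{1..}. law u)"
  unfolding child_values_def[abs_def] law_def
  by (rule distr_PiM_restrict_map[OF P.prob_space_axioms measurable_root_value_at subset_UNIV])

lemma measurable_\<gamma>_child_values [measurable]:
  "(\<lambda>(u, w, z). \<gamma> w (child_values u z)) \<in> borel \<Otimes>\<^sub>M borel \<Otimes>\<^sub>M Q \<rightarrow>\<^sub>M borel"
proof -
  have "(\<lambda>p. (fst (snd p), child_values (fst p) (snd (snd p)))) \<in> borel \<Otimes>\<^sub>M borel \<Otimes>\<^sub>M Q \<rightarrow>\<^sub>M borel \<Otimes>\<^sub>M (\<Pi>\<^sub>M k\<in>{1..}. borel)"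
    using measurable_compose[OF _ measurable_child_values, of "\<lambda>p. (fst p, snd (snd p))" "borel \<Otimes>\<^sub>M borel \<Otimes>\<^sub>M Q"]
    by (intro measurable_Pair) (simp_all add: case_prod_beta)
  from measurable_compose[OF this \<gamma>_measurable] show ?thesis by (simp add: case_prod_beta)
qed

text \<open>\<open>tree_value_rec\<close> requires a finite tree, which holds almost surely for the
  glued tree because its law is again \<open>P\<close>.\<close>

lemma AE_root_value_join:
  assumes "0 \<le> t"
  shows "AE p in N \<Otimes>\<^sub>M Q. root_value t (join_trees p) =
    (if t < fst (fst p) then fst (snd (fst p))
     else \<gamma> (snd (snd (fst p))) (child_values (t - fst (fst p)) (snd p)))"
proof -
  have "AE p in N \<Otimes>\<^sub>M Q. finite (dead t (join_trees p))"
    by (rule AE_distrD[OF join_measurable], unfold distr_join, rule AE_finite_dead[OF assms])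
  then show ?thesis
  proof eventually_elim
    case (elim p)
    obtain m z where p: "p = (m, z)" by (cases p)
    have "tree_value \<gamma> \<kappa> \<infinity> t (\<lambda>i. snd (snd (join_trees p i))) (\<lambda>i. fst (join_trees p i)) (\<lambda>i. fst (snd (join_trees p i)))
      = (if t < fst (join_trees p []) then fst (snd (join_trees p [])) else
          \<gamma> (snd (snd (join_trees p []))) (\<lambda>k\<in>{1..}. tree_value \<gamma> \<kappa> \<infinity> (t - fst (join_trees p []))
            (\<lambda>i. snd (snd (join_trees p (k # i)))) (\<lambda>i. fst (join_trees p (k # i))) (\<lambda>i. fst (snd (join_trees p (k # i))))))"
    proof (rule tree_value_rec[OF _ assms])
      show "\<gamma> v x = \<gamma> v y" if "x \<in> extensional {1..}" "y \<in> extensional {1..}" "\<forall>k\<in>{1..\<kappa> v}. x k = y k" for v x y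
        using that by (rule \<gamma>_depends)
      show "finite (tree_at \<infinity> \<kappa> t (\<lambda>i. snd (snd (join_trees p i))) (\<lambda>i. fst (join_trees p i)))"
        using elim by (simp add: dead_def)
    qed
    then show ?case
      unfolding p by (simp add: root_value_def child_values_def)
  qed
qed

text \<open>The root survives \<open>t\<close> with probability \<open>exp (- R * t)\<close>. For a
  death at \<open>s \<le> t\<close>, the reflection \<open>u = t - s\<close> rewrites the density as
  \<open>exp (- R * t)\<close> times \<open>R * exp (R * u)\<close>.\<close>

lemma integral_E:
  fixes g :: "real \<Rightarrow> real"
  assumes [measurable]: "g \<in> borel_measurable borel" and g: "\<And>s. \<bar>g s\<bar> \<le> 1" and t: "0 \<le> t"
  shows "(\<integral>s. (if t < s then c else g (t - s)) \<partial>E) =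
    exp (- R * t) * (c + (LINT u:{0..t}|lborel. R * exp (R * u) * g u))"
proof -
  let ?f = "\<lambda>s. indicator {..t} s * g (t - s)"
  have intf: "integrable E ?f"
    using g by (intro E.integrable_const_bound[of _ 1]) (auto simp: abs_mult indicator_def)
  have intc: "integrable E (\<lambda>s. indicator {t<..} s * c)"
    by (rule E.integrable_const_bound[of _ "\<bar>c\<bar>"], rule AE_I2) (auto simp: indicator_def)
  have "(\<integral>s. (if t < s then c else g (t - s)) \<partial>E) = (\<integral>s. indicator {t<..} s * c + ?f s \<partial>E)"
    by (intro Bochner_Integration.integral_cong) (auto simp: indicator_def)
  also have "\<dots> = (\<integral>s. indicator {t<..} s * c \<partial>E) + (\<integral>s. ?f s \<partial>E)"
    using intf intc by (rule Bochner_Integration.integral_add[rotated])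
  also have "(\<integral>s. indicator {t<..} s * c \<partial>E) = exp (- R * t) * c"
  proof -
    have "emeasure E {..t} = ennreal (1 - exp (- R * t))"
      unfolding E_def using emeasure_erlang_density[OF R_pos, of 0 t] t by (simp add: erlang_CDF_0)
    moreover have "exp (- R * t) \<le> 1" using R_pos t by simp
    ultimately have "measure E {..t} = 1 - exp (- R * t)" by (simp add: measure_def)
    moreover have "{t<..} = space E - {..t}" by auto
    ultimately have "measure E {t<..} = exp (- R * t)"
      using E.prob_compl[of "{..t}"] by simp
    then show ?thesis by simp
  qed
  also have "(\<integral>s. ?f s \<partial>E) = (\<integral>s. exponential_density R s * ?f s \<partial>lborel)"
    unfolding E_def using exponential_density_nonneg[OF R_pos] by (subst integral_density) auto
  also have "\<dots> = (\<integral>u. exponential_density R (t - u) * ?f (t - u) \<partial>lborel)"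
    by (subst lborel_integral_real_affine[of "-1" _ t]) auto
  \<comment> \<open>The indicator in \<open>?f\<close> supplies \<open>0 \<le> u\<close>, the
    vanishing of the density at negative times supplies \<open>u \<le> t\<close>.\<close>
  also have "\<dots> = (\<integral>u. exp (- R * t) * (indicator {0..t} u * (R * exp (R * u) * g u)) \<partial>lborel)"
    by (intro Bochner_Integration.integral_cong)
      (auto simp: indicator_def exponential_density_def algebra_simps simp flip: exp_add)
  also have "\<dots> = exp (- R * t) * (LINT u:{0..t}|lborel. R * exp (R * u) * g u)"
    by (simp add: set_lebesgue_integral_def)
  finally show ?thesis by (simp add: algebra_simps)
qed

text \<open>Given that the root dies at \<open>s\<close>, the children contribute i.i.d. values of
  law \<open>law (t - s)\<close>, independent of the mark of the root, which is exactly the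
  construction of \<open>T_map\<close>. Measurability in \<open>u\<close> comes from the joint
  measurability of \<open>root_value\<close> in time and tree.\<close>

lemma law_renewal:
  fixes \<phi> :: "'a \<Rightarrow> real"
  assumes \<phi>[measurable]: "\<phi> \<in> borel_measurable borel" and b: "\<And>x. \<bar>\<phi> x\<bar> \<le> 1"
  shows "(\<lambda>u. \<integral>x. \<phi> x \<partial>T_map r \<gamma> (law u)) \<in> borel_measurable borel"
    and "0 \<le> t \<Longrightarrow> (\<integral>x. \<phi> x \<partial>law t) = exp (- R * t) * ((\<integral>x. \<phi> x \<partial>\<mu>) +
        (LINT u:{0..t}|lborel. R * exp (R * u) * (\<integral>x. \<phi> x \<partial>T_map r \<gamma> (law u))))"
proof -
  \<comment> \<open>The mean of the test function at a root with mark \<open>w\<close> that leaves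
    the time \<open>u\<close> to its children.\<close>
  define H where "H u w = (\<integral>z. \<phi> (\<gamma> w (child_values u z)) \<partial>Q)" for u w
  define \<Psi> where "\<Psi> u = (\<integral>x. \<phi> x \<partial>T_map r \<gamma> (law u))" for u
  have "(\<lambda>p. \<phi> (\<gamma> (snd (fst p)) (child_values (fst (fst p)) (snd p)))) \<in> borel_measurable ((borel \<Otimes>\<^sub>M borel) \<Otimes>\<^sub>M Q)"
    using measurable_compose[OF _ measurable_compose[OF measurable_\<gamma>_child_values \<phi>],
        of "\<lambda>p. (fst (fst p), snd (fst p), snd p)" "(borel \<Otimes>\<^sub>M borel) \<Otimes>\<^sub>M Q"]
    by (simp add: case_prod_beta)
  then have H [measurable]: "case_prod H \<in> borel_measurable (borel \<Otimes>\<^sub>M borel)"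
    unfolding H_def case_prod_beta
    by (intro NQ.M2.borel_measurable_lebesgue_integral) (simp add: case_prod_beta)
  have H_le: "\<bar>H u w\<bar> \<le> 1" for u w
    unfolding H_def by (intro NQ.M2.abs_integral_le_bound b) simp
  have \<Psi>: "\<Psi> u = (\<integral>w. H u w \<partial>\<Omega>)" for u
  proof -
    have "\<Psi> u = (\<integral>w. \<integral>x. \<phi> (\<gamma> w x) \<partial>(\<Pi>\<^sub>M k\<in>{1..}. law u) \<partial>\<Omega>)"
      unfolding \<Psi>_def by (rule integral_T_map(1)[OF prob_space_law sets_law \<phi> b])
    also have "\<dots> = (\<integral>w. H u w \<partial>\<Omega>)"
    proof (rule Bochner_Integration.integral_cong[OF refl])
      fix w
      have "(\<lambda>x. \<phi> (\<gamma> w x)) \<in> borel_measurable (\<Pi>\<^sub>M k\<in>{1..}. borel)"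
        using measurable_compose[OF measurable_Pair1'[of w borel] measurable_compose[OF \<gamma>_measurable \<phi>]]
        by simp
      then show "(\<integral>x. \<phi> (\<gamma> w x) \<partial>(\<Pi>\<^sub>M k\<in>{1..}. law u)) = H u w"
        unfolding H_def distr_child_values[symmetric] by (intro integral_distr measurable_child_values_at)
    qed
    finally show ?thesis .
  qed
  have \<Psi>_meas [measurable]: "\<Psi> \<in> borel_measurable borel"
    unfolding \<Psi>[abs_def] by (intro \<Omega>.borel_measurable_lebesgue_integral) measurable
  then show "(\<lambda>u. \<integral>x. \<phi> x \<partial>T_map r \<gamma> (law u)) \<in> borel_measurable borel"
    unfolding \<Psi>_def .
  have \<Psi>_le: "\<bar>\<Psi> u\<bar> \<le> 1" for u
    unfolding \<Psi> by (intro \<Omega>.abs_integral_le_bound H_le) simp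
  assume t: "0 \<le> t"
  let ?G = "\<lambda>p. if t < fst (fst p) then \<phi> (fst (snd (fst p)))
     else \<phi> (\<gamma> (snd (snd (fst p))) (child_values (t - fst (fst p)) (snd p)))"
  have G: "?G \<in> borel_measurable (N \<Otimes>\<^sub>M Q)"
  proof -
    have 1: "(\<lambda>p. (t - fst (fst p), snd (snd (fst p)), snd p)) \<in> N \<Otimes>\<^sub>M Q \<rightarrow>\<^sub>M borel \<Otimes>\<^sub>M borel \<Otimes>\<^sub>M Q"
      by (intro measurable_Pair borel_measurable_diff measurable_compose[OF measurable_fst] measurable_components) simp_all
    have [measurable]: "(\<lambda>p. \<phi> (\<gamma> (snd (snd (fst p))) (child_values (t - fst (fst p)) (snd p)))) \<in> borel_measurable (N \<Otimes>\<^sub>M Q)"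
      using measurable_compose[OF 1 measurable_compose[OF measurable_\<gamma>_child_values \<phi>]] by simp
    show ?thesis by measurable
  qed
  have "(\<integral>x. \<phi> x \<partial>law t) = (\<integral>y. \<phi> (root_value t y) \<partial>distr (N \<Otimes>\<^sub>M Q) P join_trees)"
    unfolding law_def distr_join by (intro integral_distr) auto
  also have "\<dots> = (\<integral>p. \<phi> (root_value t (join_trees p)) \<partial>(N \<Otimes>\<^sub>M Q))"
    by (intro integral_distr) measurable
  also have "\<dots> = (\<integral>p. ?G p \<partial>(N \<Otimes>\<^sub>M Q))"
  proof (rule integral_cong_AE)
    show "AE p in N \<Otimes>\<^sub>M Q. \<phi> (root_value t (join_trees p)) = ?G p"
      using AE_root_value_join[OF t] by eventually_elim simp
  qed (use G in measurable)
  also have "\<dots> = (\<integral>m. \<integral>z. ?G (m, z) \<partial>Q \<partial>N)"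
    using G b by (intro NQ.integral_fst'[symmetric] NQ.integrable_const_bound[of _ 1]) auto
  also have "\<dots> = (\<integral>m. (if t < fst m then \<phi> (fst (snd m)) else H (t - fst m) (snd (snd m))) \<partial>N)"
    by (intro Bochner_Integration.integral_cong refl) (simp add: H_def NQ.M2.prob_space)
  also have "\<dots> = (\<integral>s. \<integral>q. (if t < s then \<phi> (fst q) else H (t - s) (snd q)) \<partial>(\<mu> \<Otimes>\<^sub>M \<Omega>) \<partial>E)"
  proof -
    have "(\<lambda>m. if t < fst m then \<phi> (fst (snd m)) else H (t - fst m) (snd (snd m))) \<in> borel_measurable N"
      by measurable
    then have "integrable (E \<Otimes>\<^sub>M (\<mu> \<Otimes>\<^sub>M \<Omega>)) (\<lambda>m. if t < fst m then \<phi> (fst (snd m)) else H (t - fst m) (snd (snd m)))"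
      unfolding N_def using b H_le by (intro EN.integrable_const_bound[of _ 1]) auto
    from EN.integral_fst'[OF this] show ?thesis unfolding N_def fst_conv snd_conv by (rule sym)
  qed
  also have "\<dots> = (\<integral>s. (if t < s then \<integral>x. \<phi> x \<partial>\<mu> else \<Psi> (t - s)) \<partial>E)"
  proof (rule Bochner_Integration.integral_cong[OF refl])
    fix s :: real
    have [measurable]: "fst \<in> \<mu> \<Otimes>\<^sub>M \<Omega> \<rightarrow>\<^sub>M borel" "snd \<in> \<mu> \<Otimes>\<^sub>M \<Omega> \<rightarrow>\<^sub>M borel"
      using measurable_fst[of \<mu> \<Omega>] measurable_snd[of \<mu> \<Omega>] \<mu> sets_\<Omega> by (simp_all cong: measurable_cong_sets)
    have "integrable (\<mu> \<Otimes>\<^sub>M \<Omega>) (\<lambda>q. \<phi> (fst q))" "integrable (\<mu> \<Otimes>\<^sub>M \<Omega>) (\<lambda>q. H (t - s) (snd q))"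
      using b H_le by (auto intro!: M\<Omega>.P.integrable_const_bound[of _ 1])
    from this[THEN M\<Omega>.integral_fst'[symmetric]]
    show "(\<integral>q. (if t < s then \<phi> (fst q) else H (t - s) (snd q)) \<partial>(\<mu> \<Otimes>\<^sub>M \<Omega>)) =
        (if t < s then \<integral>x. \<phi> x \<partial>\<mu> else \<Psi> (t - s))"
      by (simp add: \<Psi> \<Omega>.prob_space \<mu>.prob_space)
  qed
  also have "\<dots> = exp (- R * t) * ((\<integral>x. \<phi> x \<partial>\<mu>) + (LINT u:{0..t}|lborel. R * exp (R * u) * \<Psi> u))"
    using \<Psi>_le t by (intro integral_E) measurable
  finally show "(\<integral>x. \<phi> x \<partial>law t) = exp (- R * t) * ((\<integral>x. \<phi> x \<partial>\<mu>) +
        (LINT u:{0..t}|lborel. R * exp (R * u) * (\<integral>x. \<phi> x \<partial>T_map r \<gamma> (law u))))"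
    unfolding \<Psi>_def .
qed

theorem T_flow_eq_law:
  assumes "0 \<le> t"
  shows "T_flow r \<gamma> t \<mu> = law t"
proof -
  have "solves_mean_field r \<gamma> \<mu> law"
    by (intro renewal_imp_solution \<mu> prob_space_law sets_law law_renewal) auto
  then show ?thesis
    unfolding T_flow_def using solution_unique assms by (intro the_equality) blast+
qed

end

section \<open>Conditionally i.i.d. families\<close>

locale conditionally_iid = prob_space M
  for M :: "'p measure" +
  fixes F :: "'p measure" and J :: "'p \<Rightarrow> 'i::countable set" and X :: "'i \<Rightarrow> 'p \<Rightarrow> 'a::topological_space"
    and \<mu> :: "'a measure"
  assumes subalg: "subalgebra M F"
    and J: "\<And>i. Measurable.pred F (\<lambda>p. i \<in> J p)"
    and cond_iid: "cond_iid M F J X \<mu>"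
    and \<mu>: "prob_space \<mu>" "sets \<mu> = sets borel"
begin

sublocale \<mu>: prob_space \<mu> by (rule \<mu>)

sublocale fin: finite_measure_subalgebra M F
  by unfold_locales (rule subalg)

lemma J_M: "Measurable.pred M (\<lambda>p. i \<in> J p)"
  using J measurable_from_subalg[OF subalg] by blast

text \<open>\<open>cond_iid\<close> provides measurability of \<open>X i\<close> on the event
  \<open>i \<in> J\<close>; a constant off this event gives a random variable on the whole
  space.\<close>

definition X' :: "'i \<Rightarrow> 'p \<Rightarrow> 'a" where
  "X' i p = (if i \<in> J p then X i p else undefined)"

lemma measurable_X' [measurable]: "X' i \<in> M \<rightarrow>\<^sub>M borel"
proof -
  have "X i \<in> restrict_space M {p \<in> space M. i \<in> J p} \<rightarrow>\<^sub>M borel"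
    using cond_iid by (simp add: cond_iid_def)
  then have "X i \<in> restrict_space M {p. i \<in> J p} \<rightarrow>\<^sub>M borel"
    by (rule measurable_cong_sets[THEN eqset_imp_iff, THEN iffD1, rotated 2])
       (auto simp: sets_restrict_space dest: sets.sets_into_space intro!: image_cong)
  moreover have "{p \<in> space M. i \<in> J p} \<in> sets M" using J_M[of i] by (simp add: pred_def)
  ultimately show ?thesis
    unfolding X'_def[abs_def]
    by (intro measurable_If_restrict_space_iff[THEN iffD2]) auto
qed

text \<open>On \<open>A\<close> the random index set is the constant \<open>V\<close>, so the
  product in \<open>cond_iid\<close> is a number there, and integrating the conditional expectation
  over \<open>A\<close>, an event of \<open>F\<close>, pulls it out.\<close>

lemma prob_rectangle:
  assumes A: "A \<in> sets F" "\<And>p. p \<in> A \<Longrightarrow> J p = V" and B: "\<And>i. i \<in> V \<Longrightarrow> B i \<in> sets borel"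
  shows "prob (A \<inter> {p \<in> space M. \<forall>i\<in>V. X' i p \<in> B i}) = prob A * (\<Prod>i\<in>V. measure \<mu> (B i))"
proof -
  \<comment> \<open>\<open>cond_iid\<close> asks for Borel sets at every index, while
    \<open>B\<close> is known to be Borel on \<open>V\<close>.\<close>
  define B' where "B' i = (if i \<in> V then B i else UNIV)" for i
  let ?C = "{p \<in> space M. \<forall>i\<in>J p. X i p \<in> B' i}"
  have AM: "A \<in> sets M" using A(1) subalg by (auto simp: subalgebra_def)
  have B': "B' i \<in> sets borel" for i using B by (simp add: B'_def)
  have C_eq: "?C = {p \<in> space M. \<forall>i. i \<in> J p \<longrightarrow> X' i p \<in> B' i}"
    by (auto simp: X'_def)
  have C: "?C \<in> sets M"
  proof -
    note [measurable] = J_M B'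
    show ?thesis unfolding C_eq by measurable
  qed
  have "A \<inter> {p \<in> space M. \<forall>i\<in>V. X' i p \<in> B i} = A \<inter> ?C"
    using A(2) by (auto simp: X'_def B'_def)
  then have "prob (A \<inter> {p \<in> space M. \<forall>i\<in>V. X' i p \<in> B i}) = (\<integral>p. indicator A p * indicator ?C p \<partial>M)"
    using AM C sets.sets_into_space[OF AM] by (simp add: Int_absorb2 flip: indicator_inter_arith)
  also have "\<dots> = (LINT p:A|M. indicator ?C p)"
    by (simp add: set_lebesgue_integral_def)
  also have "\<dots> = (LINT p:A|M. real_cond_exp M F (indicator ?C) p)"
    using A(1) C by (intro fin.real_cond_exp_intA) (auto intro!: integrable_real_indicator simp: emeasure_eq_measure)
  also have "\<dots> = (LINT p:A|M. (\<Prod>i\<in>V. measure \<mu> (B i)))"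
  proof -
    have ae: "AE p in M. real_cond_exp M F (indicator ?C) p = (\<Prod>i\<in>J p. measure \<mu> (B' i))"
      using cond_iid B' by (simp add: cond_iid_def)
    then have "AE p in M. indicator A p *\<^sub>R real_cond_exp M F (indicator ?C) p = indicator A p *\<^sub>R (\<Prod>i\<in>V. measure \<mu> (B i))"
      by eventually_elim (auto simp: indicator_def A(2) B'_def)
    then show ?thesis
      unfolding set_lebesgue_integral_def using AM by (intro integral_cong_AE) auto
  qed
  also have "\<dots> = prob A * (\<Prod>i\<in>V. measure \<mu> (B i))"
    using AM sets.sets_into_space[OF AM] by (simp add: set_lebesgue_integral_def Int_absorb2)
  finally show ?thesis .
qed

text \<open>Under the conditional measure given \<open>A\<close>, the rectangles identify the law of
  the family as the product measure, which extends the product formula to all measurable sets. For a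
  null event both sides vanish.\<close>

lemma emeasure_event_values:
  assumes V: "finite V" and A: "A \<in> sets F" "\<And>p. p \<in> A \<Longrightarrow> J p = V" and B: "B \<in> sets (\<Pi>\<^sub>M i\<in>V. borel)"
  shows "emeasure M (A \<inter> (\<lambda>p. \<lambda>i\<in>V. X' i p) -` B) = emeasure M A * emeasure (\<Pi>\<^sub>M i\<in>V. \<mu>) B"
proof (cases "prob A = 0")
  case True
  have AM: "A \<in> sets M" using A(1) subalg by (auto simp: subalgebra_def)
  then have "emeasure M (A \<inter> (\<lambda>p. \<lambda>i\<in>V. X' i p) -` B) \<le> emeasure M A"
    by (intro emeasure_mono) auto
  then show ?thesis using True by (simp add: emeasure_eq_measure)
next
  case False
  let ?X = "\<lambda>p. \<lambda>i\<in>V. X' i p"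
  have AM: "A \<in> sets M" using A(1) subalg by (auto simp: subalgebra_def)
  have A0: "emeasure M A \<noteq> 0" using False by (simp add: emeasure_eq_measure)
  interpret P: product_sigma_finite "\<lambda>_. \<mu>" ..
  have X [measurable]: "?X \<in> M \<rightarrow>\<^sub>M (\<Pi>\<^sub>M i\<in>V. borel)" by measurable
  have "distr (uniform_measure M A) (\<Pi>\<^sub>M i\<in>V. borel) ?X = (\<Pi>\<^sub>M i\<in>V. \<mu>)"
  proof (rule P.PiM_eqI[OF V])
    show "sets (distr (uniform_measure M A) (\<Pi>\<^sub>M i\<in>V. borel) ?X) = sets (\<Pi>\<^sub>M i\<in>V. \<mu>)"
      using \<mu> by (auto intro!: sets_PiM_cong)
    fix C assume "\<And>i. i \<in> V \<Longrightarrow> C i \<in> sets \<mu>"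
    then have C: "\<And>i. i \<in> V \<Longrightarrow> C i \<in> sets borel" using \<mu> by simp
    have "emeasure (distr (uniform_measure M A) (\<Pi>\<^sub>M i\<in>V. borel) ?X) (Pi\<^sub>E V C) =
        emeasure M (A \<inter> (?X -` Pi\<^sub>E V C \<inter> space M)) / emeasure M A"
      using C V AM by (subst emeasure_distr) (auto intro!: sets_PiM_I_finite emeasure_uniform_measure measurable_sets[OF X])
    also have "A \<inter> (?X -` Pi\<^sub>E V C \<inter> space M) = A \<inter> {p \<in> space M. \<forall>i\<in>V. X' i p \<in> C i}"
      by (auto simp: PiE_iff)
    also have "emeasure M \<dots> = emeasure M A * (\<Prod>i\<in>V. emeasure \<mu> (C i))"
    proof -
      have "prob (A \<inter> {p \<in> space M. \<forall>i\<in>V. X' i p \<in> C i}) = prob A * (\<Prod>i\<in>V. measure \<mu> (C i))"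
        by (rule prob_rectangle[OF A(1)]) (use A(2) C in auto)
      then show ?thesis
        unfolding emeasure_eq_measure \<mu>.emeasure_eq_measure
        by (simp add: ennreal_mult prod_nonneg prod_ennreal)
    qed
    also have "\<dots> / emeasure M A = (\<Prod>i\<in>V. emeasure \<mu> (C i))"
      using A0 by (subst mult.commute) (simp add: mult_divide_eq_ennreal)
    finally show "emeasure (distr (uniform_measure M A) (\<Pi>\<^sub>M i\<in>V. borel) ?X) (Pi\<^sub>E V C) = (\<Prod>i\<in>V. emeasure \<mu> (C i))" .
  qed
  then have "emeasure (\<Pi>\<^sub>M i\<in>V. \<mu>) B = emeasure (distr (uniform_measure M A) (\<Pi>\<^sub>M i\<in>V. borel) ?X) B" by simp
  also have "\<dots> = emeasure M (A \<inter> (?X -` B \<inter> space M)) / emeasure M A"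
    using B AM by (subst emeasure_distr) (auto intro!: emeasure_uniform_measure measurable_sets[OF X])
  also have "A \<inter> (?X -` B \<inter> space M) = A \<inter> ?X -` B"
    using sets.sets_into_space[OF AM] by auto
  finally have e: "emeasure (\<Pi>\<^sub>M i\<in>V. \<mu>) B = emeasure M (A \<inter> ?X -` B) / emeasure M A" .
  show ?thesis
    unfolding e ennreal_times_divide using A0 by (simp add: mult.commute[of "emeasure M A"] mult_divide_eq_ennreal)
qed

text \<open>The freezing principle: restricted to \<open>A\<close>, the joint law of
  \<open>p\<close>, seen through \<open>F\<close>, and of the values is a product measure, so Fubini
  lets \<open>p\<close> be held fixed while the values are integrated.\<close>

lemma emeasure_joint:
  assumes V: "finite V" and A: "A \<in> sets F" "\<And>p. p \<in> A \<Longrightarrow> J p = V"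
    and S: "S \<in> sets (F \<Otimes>\<^sub>M (\<Pi>\<^sub>M i\<in>V. borel))"
  shows "emeasure M {p \<in> A. (p, \<lambda>i\<in>V. X' i p) \<in> S}
    = (\<integral>\<^sup>+p. indicator A p * emeasure (\<Pi>\<^sub>M i\<in>V. \<mu>) (Pair p -` S) \<partial>M)"
proof -
  let ?X = "\<lambda>p. \<lambda>i\<in>V. X' i p"
  \<comment> \<open>Viewing \<open>M\<close> on the smaller \<open>\<sigma>\<close>-field makes
    \<open>p\<close> itself the variable that carries the history.\<close>
  let ?F = "restr_to_subalg M F"
  have AM: "A \<in> sets M" using A(1) subalg by (auto simp: subalgebra_def)
  have [simp]: "sets ?F = sets F" "space ?F = space M"
    using sets_restr_to_subalg[OF subalg] space_restr_to_subalg[of M F] by auto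
  have spF: "space F = space M" using subalg by (simp add: subalgebra_def)
  have setsV: "sets (\<Pi>\<^sub>M i\<in>V. \<mu>) = sets (\<Pi>\<^sub>M i\<in>V. borel)"
    using \<mu> by (intro sets_PiM_cong) auto
  interpret PV: prob_space "\<Pi>\<^sub>M i\<in>V. \<mu>" by (intro prob_space_PiM \<mu>)
  have id: "(\<lambda>p. p) \<in> M \<rightarrow>\<^sub>M F" using subalg by (auto simp: subalgebra_def measurable_def)
  have X: "?X \<in> M \<rightarrow>\<^sub>M (\<Pi>\<^sub>M i\<in>V. borel)" by measurable
  have pX: "(\<lambda>p. (p, ?X p)) \<in> density M (indicator A) \<rightarrow>\<^sub>M F \<Otimes>\<^sub>M (\<Pi>\<^sub>M i\<in>V. borel)"
    using id X by simp
  let ?D = "distr (density M (indicator A)) (F \<Otimes>\<^sub>M (\<Pi>\<^sub>M i\<in>V. borel)) (\<lambda>p. (p, ?X p))"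
  have D: "emeasure ?D T = emeasure M {p \<in> A. (p, ?X p) \<in> T}" if "T \<in> sets (F \<Otimes>\<^sub>M (\<Pi>\<^sub>M i\<in>V. borel))" for T
  proof -
    have T: "(\<lambda>p. (p, ?X p)) -` T \<inter> space M \<in> sets M"
      using measurable_sets[OF pX that] by simp
    have "emeasure ?D T = emeasure (density M (indicator A)) ((\<lambda>p. (p, ?X p)) -` T \<inter> space M)"
      using pX that by (simp add: emeasure_distr)
    also have "\<dots> = emeasure M (A \<inter> ((\<lambda>p. (p, ?X p)) -` T \<inter> space M))"
      using AM T by (subst emeasure_density) (auto simp flip: indicator_inter_arith)
    also have "A \<inter> ((\<lambda>p. (p, ?X p)) -` T \<inter> space M) = {p \<in> A. (p, ?X p) \<in> T}"
      using sets.sets_into_space[OF AM] by auto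
    finally show ?thesis .
  qed
  have dens: "emeasure (density ?F (indicator A)) C = emeasure M (A \<inter> C)" if C: "C \<in> sets F" for C
  proof -
    have "(indicator A :: _ \<Rightarrow> ennreal) \<in> borel_measurable ?F"
      using A(1) by (intro borel_measurable_indicator) simp
    then have "emeasure (density ?F (indicator A)) C = (\<integral>\<^sup>+p. indicator (A \<inter> C) p \<partial>?F)"
      using C by (simp add: emeasure_density indicator_inter_arith)
    also have "\<dots> = emeasure ?F (A \<inter> C)"
      using A(1) C by (intro nn_integral_indicator) auto
    also have "\<dots> = emeasure M (A \<inter> C)" using A(1) C by (intro emeasure_restr_to_subalg subalg) auto
    finally show ?thesis .
  qed
  have "density ?F (indicator A) \<Otimes>\<^sub>M (\<Pi>\<^sub>M i\<in>V. \<mu>) = ?D"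
  proof (rule pair_measure_eqI)
    have "finite_measure (density ?F (indicator A))"
      using dens[OF sets.top] by (intro finite_measureI) (simp add: spF)
    then show "sigma_finite_measure (density ?F (indicator A))"
      by (simp add: finite_measure.axioms)
    show "sigma_finite_measure (\<Pi>\<^sub>M i\<in>V. \<mu>)" by unfold_locales
    show "sets (density ?F (indicator A) \<Otimes>\<^sub>M (\<Pi>\<^sub>M i\<in>V. \<mu>)) = sets ?D"
      by (simp add: setsV cong: sets_pair_measure_cong)
    fix C B assume "C \<in> sets (density ?F (indicator A))" and "B \<in> sets (\<Pi>\<^sub>M i\<in>V. \<mu>)"
    then have C: "C \<in> sets F" and B: "B \<in> sets (\<Pi>\<^sub>M i\<in>V. borel)" by (auto simp: setsV)
    \<comment> \<open>\<open>A \<inter> C\<close> is again an event of \<open>F\<close> on which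
      \<open>J\<close> equals \<open>V\<close>, so the product formula applies to it.\<close>
    have "emeasure ?D (C \<times> B) = emeasure M ((A \<inter> C) \<inter> ?X -` B)"
      using C B by (subst D) (auto intro!: arg_cong[where f="emeasure M"])
    also have "\<dots> = emeasure M (A \<inter> C) * emeasure (\<Pi>\<^sub>M i\<in>V. \<mu>) B"
      using A C B by (intro emeasure_event_values V) auto
    finally show "emeasure (density ?F (indicator A)) C * emeasure (\<Pi>\<^sub>M i\<in>V. \<mu>) B = emeasure ?D (C \<times> B)"
      by (simp add: dens[OF C])
  qed
  moreover have S': "S \<in> sets (density ?F (indicator A) \<Otimes>\<^sub>M (\<Pi>\<^sub>M i\<in>V. \<mu>))"
    using S by (simp add: setsV cong: sets_pair_measure_cong)
  moreover have Sm: "(\<lambda>p. emeasure (\<Pi>\<^sub>M i\<in>V. \<mu>) (Pair p -` S)) \<in> borel_measurable F"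
    using PV.measurable_emeasure_Pair[OF S'] by (simp cong: measurable_cong_sets)
  ultimately have "emeasure M {p \<in> A. (p, ?X p) \<in> S} = (\<integral>\<^sup>+p. emeasure (\<Pi>\<^sub>M i\<in>V. \<mu>) (Pair p -` S) \<partial>density ?F (indicator A))"
    using D[OF S] PV.emeasure_pair_measure_alt[OF S'] by simp
  also have "\<dots> = (\<integral>\<^sup>+p. indicator A p * emeasure (\<Pi>\<^sub>M i\<in>V. \<mu>) (Pair p -` S) \<partial>?F)"
    using A(1) Sm by (intro nn_integral_density) (auto cong: measurable_cong_sets)
  also have "\<dots> = (\<integral>\<^sup>+p. indicator A p * emeasure (\<Pi>\<^sub>M i\<in>V. \<mu>) (Pair p -` S) \<partial>M)"
    using A(1) Sm by (intro nn_integral_subalgebra2[OF subalg]) auto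
  finally show ?thesis .
qed

end

section \<open>The given random tree\<close>

lemma (in mean_field) tree_value_eq_infinity:
  assumes "\<And>v. enat (\<kappa> v) \<le> d"
  shows "tree_value \<gamma> \<kappa> d t = tree_value \<gamma> \<kappa> \<infinity> t" "tree_at d \<kappa> t = tree_at \<infinity> \<kappa> t"
  by (auto simp: fun_eq_iff tree_value_def tree_at_def leaves_at_def tree_eq_infinity[of \<kappa> d, OF assms])

context branching begin

section \<open>Transfer between the given marks and the canonical space\<close>

text \<open>Marks are indexed by \<open>I\<close>, values by all words. The same functionals are
  evaluated for \<open>I = words d\<close>, where the given marks live, and for
  \<open>I = UNIV\<close>, the canonical space.\<close>

abbreviation env :: "nat list set \<Rightarrow> (((nat list \<Rightarrow> 'w) \<times> (nat list \<Rightarrow> real)) \<times> (nat list \<Rightarrow> 'a)) measure" where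
  "env I \<equiv> ((\<Pi>\<^sub>M i\<in>I. borel) \<Otimes>\<^sub>M (\<Pi>\<^sub>M i\<in>I. borel)) \<Otimes>\<^sub>M (\<Pi>\<^sub>M i\<in>UNIV. borel)"

lemma measurable_env [measurable]:
  "(\<lambda>e. fst (fst e) i) \<in> env I \<rightarrow>\<^sub>M borel" "(\<lambda>e. snd (fst e) i) \<in> env I \<rightarrow>\<^sub>M borel"
  "(\<lambda>e. snd e i) \<in> env I \<rightarrow>\<^sub>M borel"
proof -
  have f: "(\<lambda>e. fst (fst e)) \<in> env I \<rightarrow>\<^sub>M (\<Pi>\<^sub>M i\<in>I. borel)" and s: "(\<lambda>e. snd (fst e)) \<in> env I \<rightarrow>\<^sub>M (\<Pi>\<^sub>M i\<in>I. borel)"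
    and x: "(\<lambda>e. snd e) \<in> env I \<rightarrow>\<^sub>M (\<Pi>\<^sub>M i\<in>UNIV. borel)"
    by measurable
  show "(\<lambda>e. fst (fst e) i) \<in> env I \<rightarrow>\<^sub>M borel" "(\<lambda>e. snd (fst e) i) \<in> env I \<rightarrow>\<^sub>M borel"
    "(\<lambda>e. snd e i) \<in> env I \<rightarrow>\<^sub>M borel"
    using measurable_compose[OF f measurable_component_borel] measurable_compose[OF s measurable_component_borel]
      measurable_compose[OF x measurable_component_borel] by auto
qed

lemma measurable_tree_value_env [measurable]:
  "(\<lambda>e. tree_value \<gamma> \<kappa> d t (fst (fst e)) (snd (fst e)) (snd e)) \<in> env I \<rightarrow>\<^sub>M borel"
  by (rule measurable_tree_value[OF \<gamma>_measurable \<kappa>_measurable]) (rule measurable_const[of t borel] measurable_env UNIV_I | simp)+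

lemma measurable_finite_tree_env [measurable]:
  "Measurable.pred (env I) (\<lambda>e. finite (tree_at d \<kappa> t (fst (fst e)) (snd (fst e))))"
  by (rule measurable_finite_random_set(2), rule measurable_in_tree_at[OF \<kappa>_measurable])
    (rule measurable_env | simp)+

text \<open>Unzipping twice separates the labels into three independent families; Tonelli then moves
  the values to the innermost integral, where they are integrated for fixed marks.\<close>

lemma nn_integral_P:
  assumes h: "h \<in> borel_measurable (env UNIV)"
  shows "(\<integral>\<^sup>+y. h ((\<lambda>i. snd (snd (y i)), \<lambda>i. fst (y i)), \<lambda>i. fst (snd (y i))) \<partial>P) =
    (\<integral>\<^sup>+a. \<integral>\<^sup>+b. \<integral>\<^sup>+x. h ((a, b), x) \<partial>(\<Pi>\<^sub>M i\<in>UNIV. \<mu>) \<partial>(\<Pi>\<^sub>M i\<in>UNIV. E) \<partial>(\<Pi>\<^sub>M i\<in>UNIV. \<Omega>))"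
proof -
  let ?A = "\<Pi>\<^sub>M i\<in>(UNIV :: nat list set). \<Omega>" and ?B = "\<Pi>\<^sub>M i\<in>(UNIV :: nat list set). E"
    and ?X = "\<Pi>\<^sub>M i\<in>(UNIV :: nat list set). \<mu>"
  let ?XA = "\<Pi>\<^sub>M i\<in>(UNIV :: nat list set). \<mu> \<Otimes>\<^sub>M \<Omega>"
  interpret A: prob_space ?A by (intro prob_space_PiM prob_space_\<Omega>)
  interpret B: prob_space ?B by (intro prob_space_PiM E.prob_space_axioms)
  interpret X: prob_space ?X by (intro prob_space_PiM \<mu>)
  interpret XA: prob_space ?XA by (intro prob_space_PiM M\<Omega>.P.prob_space_axioms)
  interpret pAX: pair_sigma_finite ?A ?X ..
  interpret pAB: pair_sigma_finite ?A ?B ..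
  have sets: "sets ?A = sets (\<Pi>\<^sub>M i\<in>UNIV. borel)" "sets ?B = sets (\<Pi>\<^sub>M i\<in>UNIV. borel)"
    "sets ?X = sets (\<Pi>\<^sub>M i\<in>UNIV. borel)"
    using \<mu> by (auto intro!: sets_PiM_cong)
  note [measurable_cong] = sets
  note [measurable] = h
  let ?g = "\<lambda>y :: nat list \<Rightarrow> real \<times> 'a \<times> 'w. h ((\<lambda>i. snd (snd (y i)), \<lambda>i. fst (y i)), \<lambda>i. fst (snd (y i)))"
  have zipN: "(\<lambda>(b, q). \<lambda>i\<in>UNIV. (b i, q i)) \<in> ?B \<Otimes>\<^sub>M ?XA \<rightarrow>\<^sub>M P"
    unfolding P_def N_def case_prod_beta by (intro measurable_restrict) measurable
  have zipX: "(\<lambda>(x, a). \<lambda>i\<in>UNIV. (x i, a i)) \<in> ?X \<Otimes>\<^sub>M ?A \<rightarrow>\<^sub>M ?XA"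
    unfolding case_prod_beta by (intro measurable_restrict) measurable
  have g: "?g \<in> borel_measurable P"
  proof -
    have "(\<lambda>y. ((\<lambda>i\<in>UNIV. snd (snd (y i)), \<lambda>i\<in>UNIV. fst (y i)), \<lambda>i\<in>UNIV. fst (snd (y i)))) \<in> P \<rightarrow>\<^sub>M env UNIV"
      by (intro measurable_Pair measurable_restrict measurable_coordinate measurable_components)
    from measurable_compose[OF this h] show ?thesis by (simp add: restrict_def)
  qed
  have "(\<integral>\<^sup>+y. ?g y \<partial>P) = (\<integral>\<^sup>+y. ?g y \<partial>distr (?B \<Otimes>\<^sub>M ?XA) P (\<lambda>(b, q). \<lambda>i\<in>UNIV. (b i, q i)))"
    unfolding P_def N_def distr_PiM_pair[OF E.prob_space_axioms M\<Omega>.P.prob_space_axioms] ..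
  also have "\<dots> = (\<integral>\<^sup>+p. ?g ((\<lambda>(b, q). \<lambda>i\<in>UNIV. (b i, q i)) p) \<partial>(?B \<Otimes>\<^sub>M ?XA))"
    using g by (intro nn_integral_distr[OF zipN]) simp
  also have "\<dots> = (\<integral>\<^sup>+b. \<integral>\<^sup>+q. h ((\<lambda>i. snd (q i), b), \<lambda>i. fst (q i)) \<partial>?XA \<partial>?B)"
    using measurable_compose[OF zipN g] by (subst XA.nn_integral_fst[symmetric]) (simp_all add: case_prod_beta)
  also have "\<dots> = (\<integral>\<^sup>+b. \<integral>\<^sup>+x. \<integral>\<^sup>+a. h ((a, b), x) \<partial>?A \<partial>?X \<partial>?B)"
  proof (rule nn_integral_cong)
    fix b assume b: "b \<in> space ?B"
    have hb: "(\<lambda>q. h ((\<lambda>i. snd (q i), b), \<lambda>i. fst (q i))) \<in> borel_measurable ?XA"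
      using measurable_compose[OF measurable_Pair1'[OF b] measurable_compose[OF zipN g]] by simp
    have "(\<integral>\<^sup>+q. h ((\<lambda>i. snd (q i), b), \<lambda>i. fst (q i)) \<partial>?XA) =
        (\<integral>\<^sup>+q. h ((\<lambda>i. snd (q i), b), \<lambda>i. fst (q i)) \<partial>distr (?X \<Otimes>\<^sub>M ?A) ?XA (\<lambda>(x, a). \<lambda>i\<in>UNIV. (x i, a i)))"
      unfolding distr_PiM_pair[OF \<mu>(1) prob_space_\<Omega>] ..
    also have "\<dots> = (\<integral>\<^sup>+p. h ((snd p, b), fst p) \<partial>(?X \<Otimes>\<^sub>M ?A))"
      using hb by (subst nn_integral_distr[OF zipX]) (simp_all add: case_prod_beta)
    also have "\<dots> = (\<integral>\<^sup>+x. \<integral>\<^sup>+a. h ((a, b), x) \<partial>?A \<partial>?X)"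
      using measurable_compose[OF zipX hb] by (subst A.nn_integral_fst[symmetric]) (simp_all add: case_prod_beta)
    finally show "(\<integral>\<^sup>+q. h ((\<lambda>i. snd (q i), b), \<lambda>i. fst (q i)) \<partial>?XA) = (\<integral>\<^sup>+x. \<integral>\<^sup>+a. h ((a, b), x) \<partial>?A \<partial>?X)" .
  qed
  also have "\<dots> = (\<integral>\<^sup>+b. \<integral>\<^sup>+a. \<integral>\<^sup>+x. h ((a, b), x) \<partial>?X \<partial>?A \<partial>?B)"
  proof (rule nn_integral_cong)
    fix b assume b: "b \<in> space ?B"
    have h': "h \<in> borel_measurable ((?A \<Otimes>\<^sub>M ?B) \<Otimes>\<^sub>M ?X)" by measurable
    have "(\<lambda>p. ((fst p, b), snd p)) \<in> ?A \<Otimes>\<^sub>M ?X \<rightarrow>\<^sub>M (?A \<Otimes>\<^sub>M ?B) \<Otimes>\<^sub>M ?X"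
      by (intro measurable_Pair measurable_fst measurable_snd measurable_const b)
    from measurable_compose[OF this h'] show "(\<integral>\<^sup>+x. \<integral>\<^sup>+a. h ((a, b), x) \<partial>?A \<partial>?X) = (\<integral>\<^sup>+a. \<integral>\<^sup>+x. h ((a, b), x) \<partial>?X \<partial>?A)"
      by (intro pAX.Fubini') (simp add: case_prod_beta)
  qed
  also have "\<dots> = (\<integral>\<^sup>+a. \<integral>\<^sup>+b. \<integral>\<^sup>+x. h ((a, b), x) \<partial>?X \<partial>?B \<partial>?A)"
  proof (rule pAB.Fubini')
    have "h \<in> borel_measurable ((?A \<Otimes>\<^sub>M ?B) \<Otimes>\<^sub>M ?X)" by measurable
    from X.borel_measurable_nn_integral_fst[OF this]
    show "(\<lambda>(a, b). \<integral>\<^sup>+x. h ((a, b), x) \<partial>?X) \<in> borel_measurable (?A \<Otimes>\<^sub>M ?B)"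
      by (simp add: case_prod_beta)
  qed
  finally show ?thesis .
qed

end

locale tree_model = branching r \<gamma> \<kappa> \<mu> + M: prob_space M
  for r :: "'w::polish_space measure" and \<gamma> :: "'w \<Rightarrow> (nat \<Rightarrow> 'a::polish_space) \<Rightarrow> 'a"
    and \<kappa> :: "'w \<Rightarrow> nat" and \<mu> :: "'a measure" and M :: "'p measure" +
  fixes d :: enat and \<omega> :: "nat list \<Rightarrow> 'p \<Rightarrow> 'w" and \<sigma> :: "nat list \<Rightarrow> 'p \<Rightarrow> real"
  assumes d: "\<And>w. enat (\<kappa> w) \<le> d"
    and \<omega>_iid: "M.indep_vars (\<lambda>_. borel) \<omega> (words d)"
      "\<And>i. i \<in> words d \<Longrightarrow> distr M borel (\<omega> i) = normalized r"
    and \<sigma>_iid: "M.indep_vars (\<lambda>_. borel) \<sigma> (words d)"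
      "\<And>i. i \<in> words d \<Longrightarrow> distributed M lborel (\<sigma> i) (exponential_density (mass r))"
    and \<omega>_\<sigma>_indep:
      "M.indep_set
         (sets (vimage_algebra (space M) (\<lambda>p. \<lambda>i\<in>words d. \<omega> i p) (\<Pi>\<^sub>M i\<in>words d. borel)))
         (sets (vimage_algebra (space M) (\<lambda>p. \<lambda>i\<in>words d. \<sigma> i p) (\<Pi>\<^sub>M i\<in>words d. borel)))"
begin

lemma \<omega>_measurable: "i \<in> words d \<Longrightarrow> \<omega> i \<in> M \<rightarrow>\<^sub>M borel"
  and \<sigma>_measurable: "i \<in> words d \<Longrightarrow> \<sigma> i \<in> M \<rightarrow>\<^sub>M borel"
  using \<omega>_iid(1) \<sigma>_iid(1) by (auto simp: M.indep_vars_def)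

definition marks :: "'p \<Rightarrow> (nat list \<Rightarrow> 'w) \<times> (nat list \<Rightarrow> real)" where
  "marks p = (\<lambda>i\<in>words d. \<omega> i p, \<lambda>i\<in>words d. \<sigma> i p)"

lemma measurable_marks [measurable]:
  "marks \<in> M \<rightarrow>\<^sub>M (\<Pi>\<^sub>M i\<in>words d. borel) \<Otimes>\<^sub>M (\<Pi>\<^sub>M i\<in>words d. borel)"
  unfolding marks_def by (intro measurable_Pair measurable_restrict \<omega>_measurable \<sigma>_measurable)

lemma distr_marks:
  "distr M ((\<Pi>\<^sub>M i\<in>words d. borel) \<Otimes>\<^sub>M (\<Pi>\<^sub>M i\<in>words d. borel)) marks =
    (\<Pi>\<^sub>M i\<in>words d. \<Omega>) \<Otimes>\<^sub>M (\<Pi>\<^sub>M i\<in>words d. E)"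
proof -
  let ?w = "\<lambda>p. \<lambda>i\<in>words d. \<omega> i p" and ?s = "\<lambda>p. \<lambda>i\<in>words d. \<sigma> i p"
  let ?W = "\<Pi>\<^sub>M i\<in>words d. (borel :: 'w measure)" and ?S = "\<Pi>\<^sub>M i\<in>words d. (borel :: real measure)"
  have ne: "words d \<noteq> {}" using Nil_in_words by blast
  have w: "?w \<in> M \<rightarrow>\<^sub>M ?W" by (intro measurable_restrict \<omega>_measurable)
  have s: "?s \<in> M \<rightarrow>\<^sub>M ?S" by (intro measurable_restrict \<sigma>_measurable)
  have ws: "(\<lambda>p. (?w p, ?s p)) \<in> M \<rightarrow>\<^sub>M ?W \<Otimes>\<^sub>M ?S" using w s by (rule measurable_Pair)
  have "distr M ?W ?w \<Otimes>\<^sub>M distr M ?S ?s = distr M (?W \<Otimes>\<^sub>M ?S) (\<lambda>p. (?w p, ?s p))"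
  proof (rule pair_measure_eqI)
    interpret dw: prob_space "distr M ?W ?w" using w by (rule M.prob_space_distr)
    interpret ds: prob_space "distr M ?S ?s" using s by (rule M.prob_space_distr)
    show "sigma_finite_measure (distr M ?W ?w)" "sigma_finite_measure (distr M ?S ?s)" by unfold_locales
    fix A B assume "A \<in> sets (distr M ?W ?w)" "B \<in> sets (distr M ?S ?s)"
    then have A: "A \<in> sets ?W" and B: "B \<in> sets ?S" by auto
    have "(?w -` A \<inter> space M) \<inter> (?s -` B \<inter> space M) = (\<lambda>p. (?w p, ?s p)) -` (A \<times> B) \<inter> space M" by auto
    moreover have "M.prob ((?w -` A \<inter> space M) \<inter> (?s -` B \<inter> space M)) = M.prob (?w -` A \<inter> space M) * M.prob (?s -` B \<inter> space M)"
      using A B by (intro M.indep_setD[OF \<omega>_\<sigma>_indep] in_vimage_algebra)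
    ultimately show "emeasure (distr M ?W ?w) A * emeasure (distr M ?S ?s) B =
        emeasure (distr M (?W \<Otimes>\<^sub>M ?S) (\<lambda>p. (?w p, ?s p))) (A \<times> B)"
      using A B w s ws by (simp add: emeasure_distr M.emeasure_eq_measure flip: ennreal_mult)
  qed simp
  then have "distr M (?W \<Otimes>\<^sub>M ?S) (\<lambda>p. (?w p, ?s p)) = distr M ?W ?w \<Otimes>\<^sub>M distr M ?S ?s" ..
  also have "distr M ?W ?w = (\<Pi>\<^sub>M i\<in>words d. distr M borel (\<omega> i))"
    using M.indep_vars_iff_distr_eq_PiM'[OF ne \<omega>_measurable] \<omega>_iid(1) by simp
  also have "\<dots> = (\<Pi>\<^sub>M i\<in>words d. \<Omega>)" by (intro PiM_cong refl \<omega>_iid(2))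
  also have "distr M ?S ?s = (\<Pi>\<^sub>M i\<in>words d. distr M borel (\<sigma> i))"
    using M.indep_vars_iff_distr_eq_PiM'[OF ne \<sigma>_measurable] \<sigma>_iid(1) by simp
  also have "\<dots> = (\<Pi>\<^sub>M i\<in>words d. E)"
  proof (intro PiM_cong refl)
    fix i assume "i \<in> words d"
    from distributed_distr_eq_density[OF \<sigma>_iid(2)[OF this]]
    show "distr M borel (\<sigma> i) = E" by (simp add: E_def cong: distr_cong)
  qed
  finally show ?thesis unfolding marks_def .
qed

text \<open>Projecting the canonical marks from all words to \<open>words d\<close> yields the law
  of the given marks, and by \<open>restr\<close> the functional does not notice the projection. The
  values form an independent family on all words on both sides.\<close>

lemma nn_integral_marks:
  assumes h: "\<And>I. h \<in> borel_measurable (env I)"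
    and restr: "\<And>a b x. h ((restrict a (words d), restrict b (words d)), x) = h ((a, b), x)"
  shows "(\<integral>\<^sup>+p. \<integral>\<^sup>+x. h (marks p, x) \<partial>(\<Pi>\<^sub>M i\<in>UNIV. \<mu>) \<partial>M) =
    (\<integral>\<^sup>+y. h ((\<lambda>i. snd (snd (y i)), \<lambda>i. fst (y i)), \<lambda>i. fst (snd (y i))) \<partial>P)"
proof -
  let ?X = "\<Pi>\<^sub>M i\<in>(UNIV :: nat list set). \<mu>"
  let ?A = "\<lambda>I :: nat list set. \<Pi>\<^sub>M i\<in>I. \<Omega>" and ?B = "\<lambda>I :: nat list set. \<Pi>\<^sub>M i\<in>I. E"
  interpret X: prob_space ?X by (intro prob_space_PiM \<mu>)
  have pA: "prob_space (?A I)" and pB: "prob_space (?B I)" for I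
    by (intro prob_space_PiM prob_space_\<Omega> E.prob_space_axioms)+
  interpret B: prob_space "?B (words d)" by (rule pB)
  have sets: "sets (?A I) = sets (\<Pi>\<^sub>M i\<in>I. borel)" "sets (?B I) = sets (\<Pi>\<^sub>M i\<in>I. borel)"
    "sets ?X = sets (\<Pi>\<^sub>M i\<in>UNIV. borel)" for I
    using \<mu> by (auto intro!: sets_PiM_cong)
  note [measurable_cong] = sets
  define g where "g q = (\<integral>\<^sup>+x. h (q, x) \<partial>?X)" for q
  have g: "g \<in> borel_measurable ((\<Pi>\<^sub>M i\<in>I. borel) \<Otimes>\<^sub>M (\<Pi>\<^sub>M i\<in>I. borel))" for I
    unfolding g_def using h[of I] by (intro X.borel_measurable_nn_integral_fst) measurable
  have g': "g \<in> borel_measurable (?A I \<Otimes>\<^sub>M ?B I)" for I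
    using g[of I] by measurable
  have "(\<integral>\<^sup>+p. \<integral>\<^sup>+x. h (marks p, x) \<partial>?X \<partial>M) = (\<integral>\<^sup>+q. g q \<partial>(?A (words d) \<Otimes>\<^sub>M ?B (words d)))"
    unfolding distr_marks[symmetric] using g by (subst nn_integral_distr) (auto simp: g_def)
  also have "\<dots> = (\<integral>\<^sup>+a. \<integral>\<^sup>+b. g (a, b) \<partial>?B (words d) \<partial>?A (words d))"
    by (rule B.nn_integral_fst[OF g', symmetric])
  also have "\<dots> = (\<integral>\<^sup>+a. \<integral>\<^sup>+b. g (a, b) \<partial>?B (words d) \<partial>distr (?A UNIV) (?A (words d)) (\<lambda>a. restrict a (words d)))"
    by (simp add: distr_PiM_restrict[OF prob_space_\<Omega>])
  also have "\<dots> = (\<integral>\<^sup>+a. \<integral>\<^sup>+b. g (restrict a (words d), b) \<partial>?B (words d) \<partial>?A UNIV)"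
    by (rule nn_integral_distr) (auto intro!: measurable_restrict_subset B.borel_measurable_nn_integral_fst g')
  also have "\<dots> = (\<integral>\<^sup>+a. \<integral>\<^sup>+b. g (a, b) \<partial>?B UNIV \<partial>?A UNIV)"
  proof (rule nn_integral_cong)
    fix a assume a: "a \<in> space (?A UNIV)"
    have ra: "restrict a (words d) \<in> space (?A (words d))"
      using a by (auto simp: space_PiM)
    have "(\<integral>\<^sup>+b. g (restrict a (words d), b) \<partial>?B (words d)) =
        (\<integral>\<^sup>+b. g (restrict a (words d), b) \<partial>distr (?B UNIV) (?B (words d)) (\<lambda>b. restrict b (words d)))"
      by (simp add: distr_PiM_restrict[OF E.prob_space_axioms])
    also have "\<dots> = (\<integral>\<^sup>+b. g (restrict a (words d), restrict b (words d)) \<partial>?B UNIV)"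
      using measurable_compose[OF measurable_Pair1'[OF ra] g']
      by (intro nn_integral_distr) (auto intro!: measurable_restrict_subset)
    finally show "(\<integral>\<^sup>+b. g (restrict a (words d), b) \<partial>?B (words d)) = (\<integral>\<^sup>+b. g (a, b) \<partial>?B UNIV)"
      by (simp add: g_def restr)
  qed
  also have "\<dots> = (\<integral>\<^sup>+y. h ((\<lambda>i. snd (snd (y i)), \<lambda>i. fst (y i)), \<lambda>i. fst (snd (y i))) \<partial>P)"
    unfolding nn_integral_P[OF h] g_def ..
  finally show ?thesis .
qed


abbreviation alive :: "real \<Rightarrow> 'p \<Rightarrow> nat list set" where
  "alive \<equiv> random_leaves d \<kappa> \<omega> \<sigma>"

abbreviation extinct :: "real \<Rightarrow> 'p \<Rightarrow> nat list set" where
  "extinct \<equiv> random_tree d \<kappa> \<omega> \<sigma>"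

abbreviation value_at :: "real \<Rightarrow> 'p \<Rightarrow> (nat list \<Rightarrow> 'a) \<Rightarrow> 'a" where
  "value_at t p \<equiv> tree_value \<gamma> \<kappa> d t (\<lambda>i. \<omega> i p) (\<lambda>i. \<sigma> i p)"

lemma extinct_marks: "tree_at d \<kappa> t (fst (marks p)) (snd (marks p)) = extinct t p"
  unfolding random_tree_def by (rule tree_at_cong_words) (auto simp: marks_def)

lemma value_at_marks: "tree_value \<gamma> \<kappa> d t (fst (marks p)) (snd (marks p)) x = value_at t p x"
proof (rule tree_value_cong_words)
  show "\<gamma> v x = \<gamma> v y" if "x \<in> extensional {1..}" "y \<in> extensional {1..}" "\<forall>k\<in>{1..\<kappa> v}. x k = y k" for v x y
    using that by (rule \<gamma>_depends)
qed (auto simp: marks_def)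

lemma measurable_extinct: "Measurable.pred M (\<lambda>p. i \<in> extinct t p)"
  and measurable_alive: "Measurable.pred M (\<lambda>p. i \<in> alive t p)"
  unfolding random_tree_def random_leaves_def
  by (rule measurable_in_tree_at[OF \<kappa>_measurable measurable_const \<omega>_measurable \<sigma>_measurable]; simp)+

lemma AE_finite_extinct:
  assumes t: "0 \<le> t"
  shows "AE p in M. finite (extinct t p)"
proof -
  interpret X: prob_space "\<Pi>\<^sub>M i\<in>(UNIV :: nat list set). \<mu>" by (intro prob_space_PiM \<mu>)
  \<comment> \<open>The event of an infinite tree becomes a functional of the marks, constant in the
    values, so that \<open>nn_integral_marks\<close> transports its probability.\<close>
  let ?h = "\<lambda>e. if finite (tree_at d \<kappa> t (fst (fst e)) (snd (fst e))) then 0 else 1 :: ennreal"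
  have [measurable]: "Measurable.pred M (\<lambda>p. finite (extinct t p))"
    by (rule measurable_finite_random_set(2)[OF measurable_extinct])
  have "(\<integral>\<^sup>+p. (if finite (extinct t p) then 0 else 1) \<partial>M) =
      (\<integral>\<^sup>+p. \<integral>\<^sup>+x. ?h (marks p, x) \<partial>(\<Pi>\<^sub>M i\<in>(UNIV :: nat list set). \<mu>) \<partial>M)"
    by (simp add: extinct_marks X.emeasure_space_1)
  also have "\<dots> = (\<integral>\<^sup>+y. ?h ((\<lambda>i. snd (snd (y i)), \<lambda>i. fst (y i)), \<lambda>i. fst (snd (y i))) \<partial>P)"
  proof (rule nn_integral_marks)
    show "?h \<in> borel_measurable (env I)" for I by measurable
    show "?h ((restrict a (words d), restrict b (words d)), x) = ?h ((a, b), x)" for a b x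
      using tree_at_cong_words(1)[of d "restrict a (words d)" a "restrict b (words d)" b] by simp
  qed
  also have "\<dots> = (\<integral>\<^sup>+y. 0 \<partial>P)"
  proof (rule nn_integral_cong_AE)
    show "AE y in P. ?h ((\<lambda>i. snd (snd (y i)), \<lambda>i. fst (y i)), \<lambda>i. fst (snd (y i))) = 0"
      using AE_finite_dead[OF t] by eventually_elim (simp add: dead_def tree_value_eq_infinity(2)[OF d])
  qed
  finally have "AE p in M. (if finite (extinct t p) then 0 else 1 :: ennreal) = 0"
    by (subst nn_integral_0_iff_AE[symmetric]) auto
  then show ?thesis by eventually_elim (auto split: if_splits)
qed

lemma nn_integral_value_at:
  assumes A: "A \<in> sets borel"
  shows "(\<integral>\<^sup>+p. \<integral>\<^sup>+x. indicator A (value_at t p x) \<partial>(\<Pi>\<^sub>M i\<in>UNIV. \<mu>) \<partial>M) = emeasure (law t) A"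
proof -
  let ?h = "\<lambda>e. indicator A (tree_value \<gamma> \<kappa> d t (fst (fst e)) (snd (fst e)) (snd e)) :: ennreal"
  have "(\<integral>\<^sup>+p. \<integral>\<^sup>+x. indicator A (value_at t p x) \<partial>(\<Pi>\<^sub>M i\<in>UNIV. \<mu>) \<partial>M) =
      (\<integral>\<^sup>+p. \<integral>\<^sup>+x. ?h (marks p, x) \<partial>(\<Pi>\<^sub>M i\<in>UNIV. \<mu>) \<partial>M)"
    by (simp add: value_at_marks)
  also have "\<dots> = (\<integral>\<^sup>+y. ?h ((\<lambda>i. snd (snd (y i)), \<lambda>i. fst (y i)), \<lambda>i. fst (snd (y i))) \<partial>P)"
  proof (rule nn_integral_marks)
    show "?h \<in> borel_measurable (env I)" for I
      using A measurable_tree_value_env by measurable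
    have \<gamma>: "\<gamma> v x = \<gamma> v y" if "x \<in> extensional {1..}" "y \<in> extensional {1..}" "\<forall>k\<in>{1..\<kappa> v}. x k = y k" for v x y
      using that by (rule \<gamma>_depends)
    show "?h ((restrict a (words d), restrict b (words d)), x) = ?h ((a, b), x)" for a b x
    proof -
      have "tree_value \<gamma> \<kappa> d t (restrict a (words d)) (restrict b (words d)) x = tree_value \<gamma> \<kappa> d t a b x"
        by (rule tree_value_cong_words[where \<kappa>=\<kappa>, OF \<gamma>]) auto
      then show ?thesis by simp
    qed
  qed
  also have "\<dots> = (\<integral>\<^sup>+y. indicator A (root_value t y) \<partial>P)"
    by (simp add: root_value_def tree_value_eq_infinity(1)[OF d])
  also have "\<dots> = (\<integral>\<^sup>+x. indicator A x \<partial>law t)"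
    unfolding law_def using A by (subst nn_integral_distr) auto
  also have "\<dots> = emeasure (law t) A" using A by simp
  finally show ?thesis .
qed

section \<open>Conditioning on the history up to time \<open>t\<close>\<close>

abbreviation history :: "real \<Rightarrow> 'p measure" where
  "history t \<equiv> history_sigma M d \<kappa> \<omega> \<sigma> t"

text \<open>A mark is visible to the history only once its node has died, hence the default
  \<open>undefined\<close> for other nodes. The events \<open>i \<in> extinct t p\<close> arise from
  the generators for the marks with the full Borel set.\<close>

lemma subalgebra_history: "subalgebra M (history t)"
  and measurable_alive_history: "Measurable.pred (history t) (\<lambda>p. i \<in> alive t p)"
  and measurable_extinct_history: "Measurable.pred (history t) (\<lambda>p. i \<in> extinct t p)"
  and measurable_mark_history: "(\<lambda>p. if i \<in> extinct t p then \<omega> i p else undefined) \<in> history t \<rightarrow>\<^sub>M borel"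
proof -
  let ?G = "{{p \<in> space M. i \<in> alive t p} |i. i \<in> words d} \<union>
      {{p \<in> space M. i \<in> extinct t p \<and> \<omega> i p \<in> B} |i B. i \<in> words d \<and> B \<in> sets borel} \<union>
      {{p \<in> space M. i \<in> extinct t p \<and> \<sigma> i p \<in> B} |i B. i \<in> words d \<and> B \<in> sets borel}"
  have H: "history t = sigma (space M) ?G"
    by (simp add: history_sigma_def random_index_sigma_def)
  have G: "?G \<subseteq> Pow (space M)" by auto
  have sp: "space (history t) = space M" by (simp add: H space_measure_of[OF G])
  have st: "sets (history t) = sigma_sets (space M) ?G" by (simp add: H sets_measure_of[OF G])
  have "?G \<subseteq> sets M"
  proof -
    have 1: "{p \<in> space M. i \<in> extinct t p \<and> Z p \<in> B} \<in> sets M" if "Z \<in> M \<rightarrow>\<^sub>M borel" "B \<in> sets borel"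
      for i and Z :: "'p \<Rightarrow> 'c::topological_space" and B
    proof -
      note [measurable] = that measurable_extinct
      show ?thesis by measurable
    qed
    have 2: "{p \<in> space M. i \<in> alive t p} \<in> sets M" for i
      using measurable_alive by (simp add: pred_def)
    show ?thesis
      by (safe; (rule 2 | (rule 1[OF \<omega>_measurable]; assumption) | (rule 1[OF \<sigma>_measurable]; assumption)))
  qed
  then show "subalgebra M (history t)"
    unfolding subalgebra_def sp st by (simp add: sets.sigma_sets_subset)
  show "Measurable.pred (history t) (\<lambda>p. i \<in> alive t p)"
  proof (cases "i \<in> words d")
    case True
    then show ?thesis unfolding pred_def sp st by (intro sigma_sets.Basic) blast
  next
    case False
    then have "i \<notin> alive t p" for p
      using tree_subset_words by (auto simp: random_leaves_def leaves_at_def)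
    then show ?thesis by simp
  qed
  have ext: "i \<notin> extinct t p" if "i \<notin> words d" for p
    using tree_subset_words that by (auto simp: random_tree_def tree_at_def)
  have mark: "{p \<in> space M. i \<in> extinct t p \<and> \<omega> i p \<in> B} \<in> sets (history t)"
    if "i \<in> words d" "B \<in> sets borel" for B
    unfolding st
    by (rule sigma_sets.Basic, rule UnI1, rule UnI2, rule CollectI, rule exI[of _ i], rule exI[of _ B]) (use that in simp)
  show e: "Measurable.pred (history t) (\<lambda>p. i \<in> extinct t p)"
  proof (cases "i \<in> words d")
    case True
    from mark[OF this, of UNIV] show ?thesis unfolding pred_def sp by simp
  next
    case False
    then show ?thesis using ext by simp
  qed
  show "(\<lambda>p. if i \<in> extinct t p then \<omega> i p else undefined) \<in> history t \<rightarrow>\<^sub>M borel"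
  proof (cases "i \<in> words d")
    case True
    show ?thesis
    proof (rule measurableI)
      fix B :: "'w set" assume B: "B \<in> sets borel"
      have 1: "{p \<in> space M. i \<in> extinct t p \<and> \<omega> i p \<in> B} \<in> sets (history t)"
        using True B by (rule mark)
      have 2: "{p \<in> space M. i \<notin> extinct t p} \<in> sets (history t)"
        using sets.sets_Collect_neg[OF e[unfolded pred_def]] unfolding sp .
      have "(\<lambda>p. if i \<in> extinct t p then \<omega> i p else undefined) -` B \<inter> space (history t) =
        {p \<in> space M. i \<in> extinct t p \<and> \<omega> i p \<in> B} \<union> (if undefined \<in> B then {p \<in> space M. i \<notin> extinct t p} else {})"
        by (cases "undefined \<in> B") (auto simp: sp split: if_splits)
      then show "(\<lambda>p. if i \<in> extinct t p then \<omega> i p else undefined) -` B \<inter> space (history t) \<in> sets (history t)"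
        using 1 2 by simp
    qed simp
  next
    case False
    then show ?thesis using ext by simp
  qed
qed

lemma random_map_eq_value_at:
  "random_map d \<kappa> \<gamma> \<omega> \<sigma> t p (restrict x (alive t p)) = value_at t p x"
  by (simp add: random_map_def tree_value_def random_leaves_def random_tree_def)

theorem distr_random_map:
  assumes t: "0 \<le> t" and X: "cond_iid M (history t) (alive t) X \<mu>"
  shows "distr M borel (\<lambda>p. random_map d \<kappa> \<gamma> \<omega> \<sigma> t p (\<lambda>i\<in>alive t p. X i p)) = law t"
proof -
  interpret C: conditionally_iid M "history t" "alive t" X \<mu>
    by unfold_locales (rule subalgebra_history measurable_alive_history X \<mu>)+
  let ?PX = "\<Pi>\<^sub>M i\<in>(UNIV :: nat list set). \<mu>"
  interpret PX: prob_space ?PX by (intro prob_space_PiM \<mu>)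
  have setsX: "sets (\<Pi>\<^sub>M i\<in>I. \<mu>) = sets (\<Pi>\<^sub>M i\<in>I. borel)" for I :: "nat list set"
    using \<mu> by (intro sets_PiM_cong) auto
  let ?G = "\<lambda>p. value_at t p (\<lambda>i. X i p)"
  have \<gamma>: "\<gamma> v x = \<gamma> v y" if "x \<in> extensional {1..}" "y \<in> extensional {1..}" "\<forall>k\<in>{1..\<kappa> v}. x k = y k" for v x y
    using that by (rule \<gamma>_depends)
  have G_eq: "?G p = tree_value \<gamma> \<kappa> d t (fst (marks p)) (snd (marks p)) (\<lambda>i. C.X' i p)" for p
  proof -
    have "restrict (\<lambda>i. C.X' i p) (alive t p) = restrict (\<lambda>i. X i p) (alive t p)"
      by (auto simp: C.X'_def fun_eq_iff)
    then show ?thesis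
      unfolding value_at_marks by (metis random_map_eq_value_at)
  qed
  have G [measurable]: "?G \<in> M \<rightarrow>\<^sub>M borel"
  proof -
    have "(\<lambda>p. (marks p, \<lambda>i\<in>UNIV. C.X' i p)) \<in> M \<rightarrow>\<^sub>M env (words d)"
      by (intro measurable_Pair measurable_marks measurable_restrict C.measurable_X')
    from measurable_compose[OF this measurable_tree_value_env] show ?thesis
      unfolding G_eq by (simp add: restrict_def)
  qed
  have distr_eq: "emeasure M (?G -` A \<inter> space M) = emeasure (law t) A" if A: "A \<in> sets borel" for A
  proof -
    \<comment> \<open>The probability of \<open>A\<close> when fresh independent values are attached
      to all nodes while the marks stay as in \<open>p\<close>; its mean is
      \<open>emeasure (law t) A\<close>.\<close>
    define f where "f p = (\<integral>\<^sup>+x. indicator A (value_at t p x) \<partial>?PX)" for p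
    let ?S = "?G -` A \<inter> space M"
    have S: "?S \<in> sets M" using G A by (rule measurable_sets)
    have f: "f \<in> borel_measurable M"
    proof -
      have "(\<lambda>e. (marks (fst e), snd e)) \<in> M \<Otimes>\<^sub>M ?PX \<rightarrow>\<^sub>M env (words d)"
        using measurable_snd[of M ?PX] by (intro measurable_Pair measurable_compose[OF measurable_fst measurable_marks]) (simp_all add: setsX cong: measurable_cong_sets)
      from measurable_compose[OF this measurable_tree_value_env[of d t]]
      have "(\<lambda>e. value_at t (fst e) (snd e)) \<in> M \<Otimes>\<^sub>M ?PX \<rightarrow>\<^sub>M borel"
        by (simp add: value_at_marks)
      from measurable_compose[OF this borel_measurable_indicator[OF A]] show ?thesis
        unfolding f_def by (intro PX.borel_measurable_nn_integral) (simp add: case_prod_beta')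
    qed
    \<comment> \<open>Finite sets of words are countable, so for finite sets these events form a
      countable family; they belong to the history and almost surely exhaust the space.\<close>
    define Ev where "Ev = (\<lambda>(U, V). {p \<in> space M. extinct t p = U \<and> alive t p = V})"
    let ?I = "Collect finite \<times> Collect finite :: (nat list set \<times> nat list set) set"
    have EvF: "Ev UV \<in> sets (history t)" for UV
    proof -
      have "Measurable.pred (history t) (\<lambda>p. extinct t p = U \<and> alive t p = V)" for U V
        using measurable_random_set_eq[OF measurable_extinct_history] measurable_random_set_eq[OF measurable_alive_history]
        by (rule pred_intros_logic)
      then show ?thesis
        using subalgebra_history[of t] by (cases UV) (simp add: Ev_def pred_def subalgebra_def)
    qed
    have EvM: "Ev UV \<in> sets M" for UV
      using EvF[of UV] subalgebra_history[of t] unfolding subalgebra_def by blast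
    have key: "emeasure M (?S \<inter> Ev UV) = (\<integral>\<^sup>+p. indicator (Ev UV) p * f p \<partial>M)" if UV: "UV \<in> ?I" for UV
    proof -
      obtain U V where UV_eq: "UV = (U, V)" and U: "finite U" and V: "finite V" using UV by auto
      \<comment> \<open>A version of the marks that is measurable for the history;
        \<open>node_value\<close> reads marks in \<open>U\<close> only, so the default does not
        affect the value.\<close>
      let ?w = "\<lambda>i p. if i \<in> extinct t p then \<omega> i p else undefined"
      let ?T = "{e \<in> space (history t \<Otimes>\<^sub>M (\<Pi>\<^sub>M i\<in>V. borel)). node_value \<gamma> (\<lambda>i. ?w i (fst e)) U (snd e) [] \<in> A}"
      have m: "(\<lambda>e. node_value \<gamma> (\<lambda>i. ?w i (fst e)) U (\<lambda>i. snd e i) []) \<in> history t \<Otimes>\<^sub>M (\<Pi>\<^sub>M i\<in>V. borel) \<rightarrow>\<^sub>M borel"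
        by (intro measurable_node_value[OF \<gamma>_measurable] measurable_compose[OF measurable_fst measurable_mark_history]
            measurable_compose[OF measurable_snd measurable_component_borel])
      have T: "?T \<in> sets (history t \<Otimes>\<^sub>M (\<Pi>\<^sub>M i\<in>V. borel))"
        using measurable_sets[OF m A] by (simp add: vimage_def Int_def conj_commute)
      have node: "node_value \<gamma> (\<lambda>i. ?w i p) U (restrict x V) [] = value_at t p x" if "p \<in> Ev UV" for p x
      proof -
        have p: "extinct t p = U" "alive t p = V" using that by (auto simp: Ev_def UV_eq)
        have "node_value \<gamma> (\<lambda>i. ?w i p) U (restrict x V) [] = node_value \<gamma> (\<lambda>i. \<omega> i p) U (restrict x V) []"
          by (rule node_value_cong[where \<kappa>=\<kappa>, OF \<gamma> U]) (auto simp: p)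
        also have "\<dots> = value_at t p x"
          using p by (simp add: tree_value_def tree_map_def random_tree_def random_leaves_def)
        finally show ?thesis .
      qed
      have sp: "space (history t) = space M" using subalgebra_history[of t] by (simp add: subalgebra_def)
      have "?S \<inter> Ev UV = {p \<in> Ev UV. (p, \<lambda>i\<in>V. C.X' i p) \<in> ?T}"
      proof -
        have "(p, \<lambda>i\<in>V. C.X' i p) \<in> ?T \<longleftrightarrow> ?G p \<in> A" if p: "p \<in> Ev UV" for p
        proof -
          have "(\<lambda>i\<in>V. C.X' i p) = restrict (\<lambda>i. X i p) V"
            using p by (auto simp: Ev_def UV_eq C.X'_def fun_eq_iff)
          moreover have "p \<in> space M" using p by (auto simp: Ev_def UV_eq)
          ultimately show ?thesis
            using node[OF p, of "\<lambda>i. X i p"] by (simp add: space_pair_measure sp space_PiM cong del: if_weak_cong)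
        qed
        then show ?thesis by (auto simp: Ev_def UV_eq)
      qed
      then have "emeasure M (?S \<inter> Ev UV) = (\<integral>\<^sup>+p. indicator (Ev UV) p * emeasure (\<Pi>\<^sub>M i\<in>V. \<mu>) (Pair p -` ?T) \<partial>M)"
        using C.emeasure_joint[OF V EvF[of UV] _ T] by (simp add: Ev_def UV_eq)
      also have "\<dots> = (\<integral>\<^sup>+p. indicator (Ev UV) p * f p \<partial>M)"
      proof (rule nn_integral_cong)
        fix p
        show "indicator (Ev UV) p * emeasure (\<Pi>\<^sub>M i\<in>V. \<mu>) (Pair p -` ?T) = indicator (Ev UV) p * f p"
        proof (cases "p \<in> Ev UV")
          case True
          then have pM: "p \<in> space M" by (auto simp: Ev_def UV_eq)
          have Tp: "Pair p -` ?T \<in> sets (\<Pi>\<^sub>M i\<in>V. \<mu>)"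
            unfolding setsX by (rule sets_Pair1[OF T])
          \<comment> \<open>The law on \<open>V\<close> is a projection of the product over all
            words, which brings in the fresh values of \<open>f\<close>.\<close>
          have "emeasure (\<Pi>\<^sub>M i\<in>V. \<mu>) (Pair p -` ?T) =
              emeasure (distr ?PX (\<Pi>\<^sub>M i\<in>V. \<mu>) (\<lambda>x. restrict x V)) (Pair p -` ?T)"
            by (simp add: distr_PiM_restrict[OF \<mu>(1)])
          also have "\<dots> = emeasure ?PX ((\<lambda>x. restrict x V) -` (Pair p -` ?T) \<inter> space ?PX)"
            using Tp by (intro emeasure_distr measurable_restrict_subset) auto
          also have "\<dots> = (\<integral>\<^sup>+x. indicator ((\<lambda>x. restrict x V) -` (Pair p -` ?T) \<inter> space ?PX) x \<partial>?PX)"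
            using Tp by (intro nn_integral_indicator[symmetric] measurable_sets[OF measurable_restrict_subset]) auto
          also have "\<dots> = f p"
            unfolding f_def
          proof (rule nn_integral_cong)
            fix x assume "x \<in> space ?PX"
            then show "indicator ((\<lambda>x. restrict x V) -` (Pair p -` ?T) \<inter> space ?PX) x = (indicator A (value_at t p x) :: ennreal)"
              using node[OF True, of x] pM by (simp add: indicator_def space_pair_measure sp space_PiM cong del: if_weak_cong)
          qed
          finally show ?thesis by simp
        qed simp
      qed
      finally show ?thesis .
    qed
    let ?W = "\<Union>UV\<in>?I. Ev UV"
    have cnt: "countable ?I" by (intro countable_SIGMA countable_Collect_finite)
    have disj: "disjoint_family_on Ev ?I" by (auto simp: disjoint_family_on_def Ev_def)
    have W: "AE p in M. p \<in> ?W"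
      using AE_finite_extinct[OF t] AE_space
    proof eventually_elim
      case (elim p)
      then have "finite (alive t p)"
        unfolding random_leaves_def random_tree_def by (intro finite_leaves_at)
      then have "p \<in> Ev (extinct t p, alive t p)" "(extinct t p, alive t p) \<in> ?I"
        using elim by (auto simp: Ev_def)
      then show ?case by blast
    qed
    have WM: "?W \<in> sets M" using EvM by (intro sets.countable_UN' cnt) auto
    have "emeasure M ?S = emeasure M (?S \<inter> ?W)"
      using W S WM by (intro emeasure_eq_AE) auto
    also have "?S \<inter> ?W = (\<Union>UV\<in>?I. ?S \<inter> Ev UV)" by auto
    also have "emeasure M \<dots> = (\<integral>\<^sup>+UV. emeasure M (?S \<inter> Ev UV) \<partial>count_space ?I)"
    proof (rule emeasure_UN_countable[OF _ cnt])
      show "?S \<inter> Ev UV \<in> sets M" for UV using S EvM by (rule sets.Int)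
      show "disjoint_family_on (\<lambda>UV. ?S \<inter> Ev UV) ?I"
        using disj unfolding disjoint_family_on_def by blast
    qed
    \<comment> \<open>Reading the integrals over the events as values of the measure with density
      \<open>f\<close> lets countable additivity sum them.\<close>
    also have "\<dots> = (\<integral>\<^sup>+UV. emeasure (density M f) (Ev UV) \<partial>count_space ?I)"
    proof (rule nn_integral_cong)
      fix UV assume "UV \<in> space (count_space ?I)"
      then show "emeasure M (?S \<inter> Ev UV) = emeasure (density M f) (Ev UV)"
        using key[of UV] EvM f by (simp add: emeasure_density mult.commute)
    qed
    also have "\<dots> = emeasure (density M f) ?W"
      using EvM by (intro emeasure_UN_countable[symmetric] cnt disj) simp
    also have "\<dots> = (\<integral>\<^sup>+p. f p * indicator ?W p \<partial>M)"
      using WM f by (intro emeasure_density)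
    also have "\<dots> = (\<integral>\<^sup>+p. f p \<partial>M)"
    proof (rule nn_integral_cong_AE)
      show "AE p in M. f p * indicator ?W p = f p"
        using W by eventually_elim (simp only: indicator_simps mult_1_right)
    qed
    also have "\<dots> = emeasure (law t) A"
      unfolding f_def by (rule nn_integral_value_at[OF A])
    finally show ?thesis .
  qed
  show ?thesis
    unfolding random_map_eq_value_at
  proof (rule measure_eqI)
    fix A assume "A \<in> sets (distr M borel ?G)"
    then show "emeasure (distr M borel ?G) A = emeasure (law t) A"
      using distr_eq by (simp add: emeasure_distr[OF G])
  qed simp
qed

end

theorem theorem6:
  fixes r :: "'w::polish_space measure"
    and \<gamma> :: "'w \<Rightarrow> (nat \<Rightarrow> 'a::polish_space) \<Rightarrow> 'a"
    and \<kappa> :: "'w \<Rightarrow> nat"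
    and d :: enat
    and M :: "'p measure"
    and \<omega> :: "nat list \<Rightarrow> 'p \<Rightarrow> 'w"
    and \<sigma> :: "nat list \<Rightarrow> 'p \<Rightarrow> real"
    and t :: real
    and \<mu> :: "'a measure"
    and X :: "nat list \<Rightarrow> 'p \<Rightarrow> 'a"
  assumes r: "finite_measure r" "sets r = sets borel" "emeasure r (space r) \<noteq> 0"
    and \<gamma>_measurable:
      "(\<lambda>(w, x). \<gamma> w x) \<in> borel \<Otimes>\<^sub>M (\<Pi>\<^sub>M k\<in>{1..}. borel) \<rightarrow>\<^sub>M borel"
    and \<kappa>_measurable: "\<kappa> \<in> borel \<rightarrow>\<^sub>M count_space UNIV"
    and \<gamma>_depends:
      "\<And>w x y. x \<in> space (\<Pi>\<^sub>M k\<in>{1..}. borel) \<Longrightarrow> y \<in> space (\<Pi>\<^sub>M k\<in>{1..}. borel) \<Longrightarrow>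
         (\<forall>k\<in>{1..\<kappa> w}. x k = y k) \<Longrightarrow> \<gamma> w x = \<gamma> w y"
    and \<kappa>_integrable: "(\<integral>\<^sup>+ w. of_nat (\<kappa> w) \<partial>r) < \<infinity>"
    and d: "1 \<le> d" "\<And>w. enat (\<kappa> w) \<le> d"
    and M: "prob_space M"
    and \<omega>_iid: "prob_space.indep_vars M (\<lambda>_. borel) \<omega> (words d)"
      "\<And>i. i \<in> words d \<Longrightarrow> distr M borel (\<omega> i) = normalized r"
    and \<sigma>_iid: "prob_space.indep_vars M (\<lambda>_. borel) \<sigma> (words d)"
      "\<And>i. i \<in> words d \<Longrightarrow> distributed M lborel (\<sigma> i) (exponential_density (mass r))"
    and \<omega>_\<sigma>_indep:
      "prob_space.indep_set M
         (sets (vimage_algebra (space M) (\<lambda>p. \<lambda>i\<in>words d. \<omega> i p) (\<Pi>\<^sub>M i\<in>words d. borel)))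
         (sets (vimage_algebra (space M) (\<lambda>p. \<lambda>i\<in>words d. \<sigma> i p) (\<Pi>\<^sub>M i\<in>words d. borel)))"
    and t: "0 \<le> t"
    and \<mu>: "prob_space \<mu>" "sets \<mu> = sets borel"
    and X_cond_iid:
      "cond_iid M (history_sigma M d \<kappa> \<omega> \<sigma> t) (random_leaves d \<kappa> \<omega> \<sigma> t) X \<mu>"
  shows "T_flow r \<gamma> t \<mu> =
    distr M borel
      (\<lambda>p. random_map d \<kappa> \<gamma> \<omega> \<sigma> t p (\<lambda>i\<in>random_leaves d \<kappa> \<omega> \<sigma> t p. X i p))"
proof -
  \<comment> \<open>The points of the product space are exactly the extensional sequences, the form
    in which the dependence property is used throughout.\<close>
  have space: "space (\<Pi>\<^sub>M k\<in>{1::nat..}. (borel :: 'a measure)) = extensional {1..}"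
    by (auto simp: space_PiM PiE_iff extensional_def)
  interpret M: prob_space M by (rule M)
  have "mean_field r \<gamma> \<kappa>"
  proof (rule mean_field.intro[OF r \<gamma>_measurable \<kappa>_measurable _ \<kappa>_integrable])
    show "\<gamma> v x = \<gamma> v y"
      if "x \<in> extensional {1..}" "y \<in> extensional {1..}" "\<forall>k\<in>{1..\<kappa> v}. x k = y k" for v x y
      using that unfolding space[symmetric] by (rule \<gamma>_depends)
  qed
  then interpret tree_model r \<gamma> \<kappa> \<mu> M d \<omega> \<sigma>
    by (intro tree_model.intro branching.intro branching_axioms.intro tree_model_axioms.intro
      \<mu> M d(2) \<omega>_iid \<sigma>_iid \<omega>_\<sigma>_indep)
  show ?thesis
    unfolding distr_random_map[OF t X_cond_iid] by (rule T_flow_eq_law[OF t])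
qed

end
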